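(* For a natural number $N$, let $Z_I(N)$, $Z_{II}(N)$ and $Z_{III}(N)$ denote, respectively, the number of ordered pairs $(\lambda,\mu)$ of partitions of $N$ that are zeros of type I, of type II, and of type III (as defined in the context). Then for integers $N\ge 3$, each of $Z_I(N)$, $Z_{II}(N)$, $Z_{III}(N)$ equals $$ p(N)^2\Big(\frac{2}{\log N}+O\Big(\frac{(\log\log N)^2}{(\log N)^2}\Big)\Big), $$ where $p(N)$ is the number of partitions of $N$. Moreover, $$ Z_{III}(N)-Z_{II}(N)=O\big(N^{-1/2}p(N)^2\big). $$
   Context: For partitions $\lambda,\mu$ of $N$, $\chi^\lambda_\mu$ denotes the value of the irreducible character of the symmetric group $S_N$ indexed by $\lambda$ on the conjugacy class of permutations of cycle type $\mu$. Write the parts of $\mu$ as $\mu_1\ge\mu_2\ge\dots\ge\mu_{\ell(\mu)}$. For a box $u$ of the Young diagram of $\lambda$, the hook length $h(u)$ is the number of boxes in the same row to the right of $u$, plus the number in the same column below $u$, plus one. For a natural number $t$, $\mathcal{H}_t(\lambda)$ is the number of boxes $u$ of $\lambda$ with $t\mid h(u)$, and $\lambda$ is a $t$-core if $\mathcal{H}_t(\lambda)=0$. Let $\mathcal{P}_t(\mu)=\frac1t\sum_{j:\,t\mid\mu_j}\mu_j$. A pair $(\lambda,\mu)$ of partitions of $N$ is a zero of type I if $\lambda$ is a $\mu_1$-core; a zero of type II if $\lambda$ is a $t$-core for some part $t$ of $\mu$; a zero of type III if $\mathcal{P}_t(\mu)>\mathcal{H}_t(\lambda)$ for some natural number $t$.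 (In each case $\chi^\lambda_\mu=0$; type I pairs are type II pairs, which are type III pairs.) *)

theory Defs
  imports Complex_Main
begin

definition partitions :: "nat \<Rightarrow> nat list set" where
  "partitions N = {lam. sorted_wrt (\<ge>) lam \<and> (\<forall>x\<in>set lam. 0 < x) \<and> sum_list lam = N}"

definition num_partitions :: "nat \<Rightarrow> nat" where
  "num_partitions N = card (partitions N)"

definition boxes :: "nat list \<Rightarrow> (nat \<times> nat) set" where
  "boxes lam = {(i, j). i < length lam \<and> j < lam ! i}"

text \<open>Hook length: arm (boxes to the right) + leg (boxes below) + 1.\<close>
definition hook :: "nat list \<Rightarrow> nat \<times> nat \<Rightarrow> nat" where
  "hook lam u = (lam ! fst u - snd u - 1)
     + card {k. fst u < k \<and> k < length lam \<and> snd u < lam ! k} + 1"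

definition hooks_div :: "nat \<Rightarrow> nat list \<Rightarrow> nat" where
  "hooks_div t lam = card {u \<in> boxes lam. t dvd hook lam u}"

definition is_core :: "nat \<Rightarrow> nat list \<Rightarrow> bool" where
  "is_core t lam \<longleftrightarrow> hooks_div t lam = 0"

definition P_t :: "nat \<Rightarrow> nat list \<Rightarrow> real" where
  "P_t t mu = (1 / real t) * (\<Sum>j<length mu. if t dvd mu ! j then real (mu ! j) else 0)"

definition zero_I :: "nat list \<Rightarrow> nat list \<Rightarrow> bool" where
  "zero_I lam mu \<longleftrightarrow> is_core (mu ! 0) lam"

definition zero_II :: "nat list \<Rightarrow> nat list \<Rightarrow> bool" where
  "zero_II lam mu \<longleftrightarrow> (\<exists>t\<in>set mu. is_core t lam)"

definition zero_III :: "nat list \<Rightarrow> nat list \<Rightarrow> bool" where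
  "zero_III lam mu \<longleftrightarrow> (\<exists>t::nat. 1 \<le> t \<and> P_t t mu > real (hooks_div t lam))"

definition count_zeros :: "(nat list \<Rightarrow> nat list \<Rightarrow> bool) \<Rightarrow> nat \<Rightarrow> nat" where
  "count_zeros Z N = card {(lam, mu). lam \<in> partitions N \<and> mu \<in> partitions N \<and> Z lam mu}"

end

theory Submission
  imports Defs "HOL-Analysis.Analysis" "HOL-Library.Multiset" "HOL-Real_Asymp.Real_Asymp"
begin

text \<open>
  Let \<open>y\<close> be the saddle point for \<open>p(N)\<close>, so that \<open>y\<^sup>2\<close> is of order \<open>1 / N\<close>, and let \<open>L = - ln y\<close>, which is
  \<open>ln N / 2 + O(1)\<close>. A Fourier integral gives \<open>p(N - j) = exp (- y j) p(N) (1 + O(j y\<^bsup>3/2\<^esup>))\<close> and a lower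
  bound for \<open>p(N)\<close>.

  Let \<open>P\<^sub>t\<close> and \<open>H\<^sub>t\<close> be the two statistics compared in a zero of type III. For \<open>t \<ge> 2\<close> with \<open>y t \<le> L - ln 72\<close>,
  the pairs with \<open>P\<^sub>t > H\<^sub>t\<close> are rare: \<open>H\<^sub>t\<close> is a sum of \<open>t\<close> independent copies of \<open>P\<^sub>t\<close> under Boltzmann weights
  (up to a factor that counts \<open>t\<close>-cores), so exponential tilting bounds their number. For larger \<open>t\<close>, the
  event \<open>P\<^sub>t \<ge> 2\<close> is rare, and \<open>P\<^sub>t = 1 > H\<^sub>t\<close> means that \<open>t\<close> is a part of \<open>mu\<close> and \<open>lam\<close> is a \<open>t\<close>-core, a zero
  of type II.

  The generating function of \<open>t\<close>-cores is that of partitions times \<open>(1 - z\<^sup>t) (1 - z\<^bsup>2t\<^esup>) \<dots>\<close> to the power \<open>t\<close>.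
  Bonferroni inequalities for this product show that a proportion of about \<open>exp (- t exp (- y t))\<close> of the partitions
  are \<open>t\<close>-cores. Since \<open>t\<close> is a part with probability about \<open>exp (- y t)\<close>, the number of zeros over \<open>p(N)\<^sup>2\<close>
  is close to the sum over \<open>t\<close> of \<open>exp (- y t) exp (- t exp (- y t))\<close>. Replacing the outer \<open>t\<close> in the second exponent by
  \<open>(L - ln 72) / y\<close> or \<open>(L + 2 ln L) / y\<close> makes this sum telescope, with value about \<open>1 / L\<close>. For the lower bound it
  suffices to count the pairs for which \<open>t\<close> is the largest part of \<open>mu\<close>: in the range of \<open>t\<close> where \<open>t\<close>-cores are
  not rare, a part larger than \<open>t\<close> has small probability.
\<close>

section \<open>Partitions as multisets of parts\<close>

text \<open>The sharp constants of the partition function never enter. Since ln N = 2 L + O(1), the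
  main term 1 / L is already 2 / ln N + O(1 / (ln N)^2), so y is needed only up to bounded factors.
  Boltzmann weights give independence but not a fixed size. Passing to size N costs the inverse of
  the peak probability, of order y^(-3/2), for each of lam and mu, so y^(-3) for a pair. There are
  at most about y^(-2) values of t below the threshold, so the tilted expectation has to be O(y^6)
  to leave O(y), which is the N^(-1/2) of the second claim; the threshold L - ln 72 is tuned to
  this. Beyond it, the obstacle is that the alternating sums lose a factor exp m, with m = t exp (-
  y t), on an error of order sqrt y up to powers of L. This is affordable for m up to L / 4, where
  exp m = y^(-1/4); for larger m some of the factors are left out. The main sum is concentrated on y
  t between L and L + 2 ln L, and the relative width 2 ln L / L of this window is the source of the
  iterated logarithm in the error.\<close>

definition mparts :: "nat \<Rightarrow> nat multiset set" where
  "mparts N = {M. 0 \<notin># M \<and> sum_mset M = N}"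

lemma bij_mset_partitions: "bij_betw mset (partitions N) (mparts N)"
proof (rule bij_betwI[where g="\<lambda>M. rev (sorted_list_of_multiset M)"])
  show "mset \<in> partitions N \<rightarrow> mparts N"
    by (auto simp: partitions_def mparts_def sum_mset_sum_list)
  show "(\<lambda>M. rev (sorted_list_of_multiset M)) \<in> mparts N \<rightarrow> partitions N"
  proof
    fix M assume M: "M \<in> mparts N"
    have "sum_list (sorted_list_of_multiset M) = sum_mset M"
      by (metis mset_sorted_list_of_multiset sum_mset_sum_list)
    moreover have "sorted_wrt (\<ge>) (rev (sorted_list_of_multiset M))"
      by (simp add: sorted_wrt_rev)
    moreover have "\<forall>x\<in>#M. 0 < x" using M unfolding mparts_def
      by (metis (mono_tags, lifting) gr0I mem_Collect_eq)
    ultimately show "rev (sorted_list_of_multiset M) \<in> partitions N"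
      using M by (simp add: partitions_def mparts_def sum_list_rev)
  qed
  show "rev (sorted_list_of_multiset (mset xs)) = xs" if "xs \<in> partitions N" for xs
  proof -
    have "sorted (rev xs)" using that by (simp add: partitions_def sorted_wrt_rev)
    then have "sort xs = rev xs" by (metis mset_rev properties_for_sort)
    then show ?thesis by simp
  qed
  show "mset (rev (sorted_list_of_multiset M)) = M" if "M \<in> mparts N" for M
    by simp
qed

lemma length_le_sum_list: "\<forall>x\<in>set xs. 0 < (x::nat) \<Longrightarrow> length xs \<le> sum_list xs"
  by (induction xs) auto

lemma finite_partitions [simp]: "finite (partitions N)"
proof (rule finite_subset)
  show "partitions N \<subseteq> {xs. set xs \<subseteq> {..N} \<and> length xs \<le> N}"
    by (auto simp: partitions_def member_le_sum_list dest!: length_le_sum_list)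
  show "finite {xs. set xs \<subseteq> {..N} \<and> length xs \<le> N}"
    by (rule finite_lists_length_le) simp
qed

lemma finite_mparts [simp]: "finite (mparts N)"
  using bij_mset_partitions finite_partitions bij_betw_finite by blast

lemma card_mparts: "card (mparts N) = num_partitions N"
  unfolding num_partitions_def using bij_betw_same_card[OF bij_mset_partitions] by metis

lemma card_partitions_mset:
  "card {mu \<in> partitions N. Q (mset mu)} = card {M \<in> mparts N. Q M}"
proof (rule bij_betw_same_card[of mset])
  show "bij_betw mset {mu \<in> partitions N. Q (mset mu)} {M \<in> mparts N. Q M}"
    using bij_mset_partitions[of N] unfolding bij_betw_def inj_on_def by auto
qed

definition parts_in :: "nat set \<Rightarrow> nat \<Rightarrow> nat" where
  "parts_in A n = card {M \<in> mparts n. set_mset M \<subseteq> A}"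

lemma parts_in_UNIV: "parts_in UNIV n = num_partitions n"
  by (simp add: parts_in_def card_mparts)

lemma card_mparts_member:
  assumes "t \<in> A" "0 < t"
  shows "card {M \<in> mparts n. t \<in># M \<and> set_mset M \<subseteq> A} = (if t \<le> n then parts_in A (n - t) else 0)"
proof (cases "t \<le> n")
  case True
  have "bij_betw (add_mset t) {M \<in> mparts (n - t). set_mset M \<subseteq> A} {M \<in> mparts n. t \<in># M \<and> set_mset M \<subseteq> A}"
  proof (rule bij_betwI[where g="\<lambda>M. M - {#t#}"])
    show "(\<lambda>M. M - {#t#}) \<in> {M \<in> mparts n. t \<in># M \<and> set_mset M \<subseteq> A} \<rightarrow> {M \<in> mparts (n - t). set_mset M \<subseteq> A}"
      by (auto simp: mparts_def sum_mset.remove dest: in_diffD)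
  qed (use assms True in \<open>auto simp: mparts_def\<close>)
  then show ?thesis using True by (auto simp: parts_in_def dest: bij_betw_same_card)
next
  case False
  then have "{M \<in> mparts n. t \<in># M \<and> set_mset M \<subseteq> A} = {}"
    by (auto simp: mparts_def sum_mset.remove)
  then show ?thesis using False by (simp only: card.empty) simp
qed

lemma parts_in_remove:
  assumes "t \<in> A" "0 < t"
  shows "parts_in A n = parts_in (A - {t}) n + (if t \<le> n then parts_in A (n - t) else 0)"
proof -
  have "{M \<in> mparts n. set_mset M \<subseteq> A} =
      {M \<in> mparts n. set_mset M \<subseteq> A - {t}} \<union> {M \<in> mparts n. t \<in># M \<and> set_mset M \<subseteq> A}"
    by auto
  moreover have "card \<dots> = card {M \<in> mparts n. set_mset M \<subseteq> A - {t}} + card {M \<in> mparts n. t \<in># M \<and> set_mset M \<subseteq> A}"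
    by (rule card_Un_disjoint) auto
  ultimately show ?thesis using card_mparts_member[OF assms] by (simp add: parts_in_def)
qed

lemma parts_in_le: "parts_in A n \<le> num_partitions n"
  unfolding parts_in_def card_mparts[symmetric] by (rule card_mono) auto

lemma num_partitions_0 [simp]: "num_partitions 0 = 1"
proof -
  have "mparts 0 = {{#}}"
  proof -
    have "M = {#}" if "sum_mset M = 0" "0 \<notin># M" for M :: "nat multiset"
      using that by (metis add_eq_0_iff_both_eq_0 multiset_nonemptyE sum_mset.remove)
    then show ?thesis by (auto simp: mparts_def)
  qed
  then show ?thesis by (simp add: card_mparts[symmetric])
qed

lemma num_partitions_Suc: "num_partitions n \<le> num_partitions (Suc n)"
  using parts_in_remove[of 1 UNIV "Suc n"] by (simp add: parts_in_UNIV)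

lemma num_partitions_mono: "m \<le> n \<Longrightarrow> num_partitions m \<le> num_partitions n"
  by (rule lift_Suc_mono_le[of num_partitions, OF num_partitions_Suc])

lemma num_partitions_pos: "0 < num_partitions n"
  using num_partitions_mono[of 0 n] by simp

text \<open>Counts the partitions of N that contain one or two prescribed parts of total j.
  Extending by zero beyond N lets the estimates run over all j; \<open>partitions_local\<close>
  covers j > N as well.\<close>

definition pd :: "nat \<Rightarrow> nat \<Rightarrow> nat" where
  "pd N j = (if j \<le> N then num_partitions (N - j) else 0)"

lemma card_containing:
  assumes "0 < t" shows "card {mu \<in> partitions N. t \<in> set mu} = pd N t"
proof -
  have "card {mu \<in> partitions N. t \<in> set mu} = card {M \<in> mparts N. t \<in># M}"
    using card_partitions_mset[of N "\<lambda>M. t \<in># M"] by simp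
  then show ?thesis using card_mparts_member[of t UNIV N] assms by (simp add: pd_def parts_in_UNIV)
qed

lemma card_containing2:
  assumes "0 < t" "0 < s"
  shows "card {mu \<in> partitions N. {#t, s#} \<subseteq># mset mu} = pd N (t + s)"
proof (cases "t + s \<le> N")
  case True
  have "bij_betw (\<lambda>M. M + {#t, s#}) (mparts (N - (t + s))) {M \<in> mparts N. {#t, s#} \<subseteq># M}"
  proof (rule bij_betwI[where g="\<lambda>M. M - {#t, s#}"])
    show "(\<lambda>M. M - {#t, s#}) \<in> {M \<in> mparts N. {#t, s#} \<subseteq># M} \<rightarrow> mparts (N - (t + s))"
    proof
      fix M assume "M \<in> {M \<in> mparts N. {#t, s#} \<subseteq># M}"
      then have M: "0 \<notin># M" "sum_mset M = N" "{#t, s#} \<subseteq># M" by (auto simp: mparts_def)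
      have "sum_mset (M - {#t, s#}) = N - (t + s)" using M by (subst sum_mset_diff) auto
      then show "M - {#t, s#} \<in> mparts (N - (t + s))" using M in_diffD by (fastforce simp: mparts_def)
    qed
    show "M - {#t, s#} + {#t, s#} = M" if "M \<in> {M \<in> mparts N. {#t, s#} \<subseteq># M}" for M
      using that by (intro subset_mset.diff_add) auto
  qed (use assms True in \<open>auto simp: mparts_def\<close>)
  then have "card {M \<in> mparts N. {#t, s#} \<subseteq># M} = card (mparts (N - (t + s)))"
    by (rule bij_betw_same_card[symmetric])
  then show ?thesis
    using True unfolding card_partitions_mset[of N "\<lambda>M. {#t, s#} \<subseteq># M"] card_mparts pd_def
    by (simp only: if_True)
next
  case False
  have "{M \<in> mparts N. {#t, s#} \<subseteq># M} = {}"
  proof -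
    have "t + s \<le> sum_mset M" if "{#t, s#} \<subseteq># M" for M
      using arg_cong[OF subset_mset.add_diff_inverse[OF that], of sum_mset] by simp
    then show ?thesis using False by (auto simp: mparts_def)
  qed
  then show ?thesis
    unfolding card_partitions_mset[of N "\<lambda>M. {#t, s#} \<subseteq># M"] pd_def using False by (simp only: card.empty if_False)
qed

section \<open>The parts divisible by t, and the statistic \<open>P_t\<close> as a natural
  number\<close>

definition mult_weight :: "nat \<Rightarrow> nat multiset \<Rightarrow> nat" where
  "mult_weight t M = sum_mset (image_mset (\<lambda>x. x div t) (filter_mset (\<lambda>x. t dvd x) M))"

lemma P_t_eq_mult_weight:
  assumes "0 < t"
  shows "P_t t mu = real (mult_weight t (mset mu))"
proof -
  have "(\<Sum>j<length mu. if t dvd mu ! j then real (mu ! j) else 0) =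
     sum_list (map (\<lambda>x. if t dvd x then real x else 0) mu)"
    by (simp add: sum_list_sum_nth atLeast0LessThan)
  also have "\<dots> = real t * real (mult_weight t (mset mu))"
    by (induction mu) (use assms in \<open>auto simp: mult_weight_def algebra_simps real_of_nat_div\<close>)
  finally show ?thesis using assms by (simp add: P_t_def)
qed

lemma filter_image_mult:
  assumes "0 < (t::nat)"
  shows "image_mset (\<lambda>x. x * t) (image_mset (\<lambda>x. x div t) (filter_mset (\<lambda>x. t dvd x) M)) = filter_mset (\<lambda>x. t dvd x) M"
  unfolding image_mset.compositionality comp_def
  by (rule multiset.map_ident_strong) (use assms in auto)

lemma sum_image_mult: "sum_mset (image_mset (\<lambda>x. x * t) M) = t * sum_mset (M :: nat multiset)"
  by (induction M) (auto simp: algebra_simps)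

lemma sum_filter_dvd:
  assumes "0 < t"
  shows "sum_mset (filter_mset (\<lambda>x. t dvd x) M) = t * mult_weight t M"
  using arg_cong[OF filter_image_mult[OF assms, of M], of sum_mset]
  unfolding sum_image_mult mult_weight_def by (rule sym)

text \<open>A partition splits into its multiples of t, which divided by t form an arbitrary
  partition of v, and the parts not divisible by t. The count therefore has the same product shape
  as \<open>card_hooks_div\<close>, with one partition in place of t, and both feed
  \<open>chernoff_coefficient\<close>.\<close>

lemma card_mult_weight:
  assumes "0 < t"
  shows "card {M \<in> mparts N. mult_weight t M = v} =
    (if t * v \<le> N then num_partitions v * parts_in {x. \<not> t dvd x} (N - t * v) else 0)"
proof (cases "t * v \<le> N")
  case True
  let ?div = "\<lambda>M. image_mset (\<lambda>x. x div t) (filter_mset (\<lambda>x. t dvd x) M)"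
  let ?nd = "filter_mset (\<lambda>x. \<not> t dvd x)"
  let ?B = "{M \<in> mparts (N - t * v). set_mset M \<subseteq> {x. \<not> t dvd x}}"
  have sumM: "sum_mset M = t * mult_weight t M + sum_mset (?nd M)" for M
  proof -
    have "sum_mset M = sum_mset (filter_mset (\<lambda>x. t dvd x) M) + sum_mset (?nd M)"
      using arg_cong[OF multiset_partition[of M "\<lambda>x. t dvd x"], of sum_mset] unfolding sum_mset.union .
    also have "sum_mset (filter_mset (\<lambda>x. t dvd x) M) = t * mult_weight t M"
      by (rule sum_filter_dvd[OF assms])
    finally show ?thesis .
  qed
  have "bij_betw (\<lambda>(A, B). image_mset (\<lambda>x. x * t) A + B) (mparts v \<times> ?B) {M \<in> mparts N. mult_weight t M = v}"
  proof (rule bij_betwI[where g="\<lambda>M. (?div M, ?nd M)"])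
    have 1: "filter_mset (\<lambda>x. t dvd x) (image_mset (\<lambda>x. x * t) A + B) = image_mset (\<lambda>x. x * t) A"
      and 2: "?nd (image_mset (\<lambda>x. x * t) A + B) = B" if "B \<in> ?B" for A B
    proof -
      have "\<forall>x\<in>#B. \<not> t dvd x" using that by auto
      then have c: "x \<in># B \<Longrightarrow> \<not> t dvd x" for x by blast
      have "filter_mset (\<lambda>x. t dvd x) B = {#}"
      proof (rule multiset_eqI)
        fix x show "count (filter_mset (\<lambda>x. t dvd x) B) x = count {#} x"
          using c[of x] by (cases "x \<in># B") (simp_all add: not_in_iff)
      qed
      moreover have "?nd B = B"
      proof (rule multiset_eqI)
        fix x show "count (?nd B) x = count B x"
          using c[of x] by (cases "x \<in># B") (simp_all add: not_in_iff)
      qed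
      ultimately show "filter_mset (\<lambda>x. t dvd x) (image_mset (\<lambda>x. x * t) A + B) = image_mset (\<lambda>x. x * t) A"
        "?nd (image_mset (\<lambda>x. x * t) A + B) = B"
        by (auto simp: filter_mset_image_mset)
    qed
    have 3: "image_mset (\<lambda>x. x div t) (image_mset (\<lambda>x. x * t) A) = A" for A
      using assms by (simp add: image_mset.compositionality comp_def)
    show "(\<lambda>(A, B). image_mset (\<lambda>x. x * t) A + B) \<in> mparts v \<times> ?B \<rightarrow> {M \<in> mparts N. mult_weight t M = v}"
    proof clarify
      fix A B assume A: "A \<in> mparts v" and B: "B \<in> mparts (N - t * v)" "set_mset B \<subseteq> {x. \<not> t dvd x}"
      then have B': "B \<in> ?B" by auto
      have "mult_weight t (image_mset (\<lambda>x. x * t) A + B) = v"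
        unfolding mult_weight_def 1[OF B'] 3 using A by (simp add: mparts_def)
      moreover have "image_mset (\<lambda>x. x * t) A + B \<in> mparts N"
        using A B assms True by (auto simp: mparts_def sum_image_mult)
      ultimately show "image_mset (\<lambda>x. x * t) A + B \<in> mparts N \<and> mult_weight t (image_mset (\<lambda>x. x * t) A + B) = v" by simp
    qed
    show "(\<lambda>M. (?div M, ?nd M)) \<in> {M \<in> mparts N. mult_weight t M = v} \<rightarrow> mparts v \<times> ?B"
    proof
      fix M assume "M \<in> {M \<in> mparts N. mult_weight t M = v}"
      then have M: "M \<in> mparts N" "mult_weight t M = v" by auto
      have "0 \<notin># ?div M" using M assms by (auto simp: mparts_def dvd_div_eq_0_iff)
      then have "?div M \<in> mparts v" using M by (simp add: mparts_def mult_weight_def)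
      moreover have s: "sum_mset M = N" "0 \<notin># M" using M(1) by (simp_all add: mparts_def)
      have "sum_mset (?nd M) = N - t * v" using sumM[of M, unfolded M(2) s(1)] by linarith
      then have "?nd M \<in> mparts (N - t * v)" by (simp add: mparts_def s(2))
      ultimately show "(?div M, ?nd M) \<in> mparts v \<times> ?B" by auto
    qed
    show "(?div ((\<lambda>(A, B). image_mset (\<lambda>x. x * t) A + B) z), ?nd ((\<lambda>(A, B). image_mset (\<lambda>x. x * t) A + B) z)) = z"
      if "z \<in> mparts v \<times> ?B" for z
    proof (cases z)
      case (Pair A B)
      then have B: "B \<in> ?B" using that by auto
      show ?thesis unfolding Pair prod.case 1[OF B] 2[OF B] 3 ..
    qed
    show "(\<lambda>(A, B). image_mset (\<lambda>x. x * t) A + B) (?div M, ?nd M) = M" for M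
      unfolding prod.case filter_image_mult[OF assms] by (rule multiset_partition[symmetric])
  qed
  then have "card {M \<in> mparts N. mult_weight t M = v} = card (mparts v \<times> ?B)"
    by (rule bij_betw_same_card[symmetric])
  then show ?thesis using True by (simp add: card_cartesian_product card_mparts parts_in_def)
next
  case False
  have "t * mult_weight t M \<le> sum_mset M" for M
    using arg_cong[OF multiset_partition[of M "\<lambda>x. t dvd x"], of sum_mset]
    unfolding sum_mset.union sum_filter_dvd[OF assms] by linarith
  then have "{M \<in> mparts N. mult_weight t M = v} = {}" using False by (auto simp: mparts_def)
  then show ?thesis using False by (simp only: card.empty if_False)
qed

section \<open>Hook lengths and beta-sets\<close>

text \<open>A partition is encoded by its beta-set \<open>beads n lam\<close>, the first-column hook lengths after padding
  with zero rows to \<open>n\<close> rows. Its hooks correspond to the pairs of a bead and a smaller gap, the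
  difference of the two being the hook length.\<close>
definition excess :: "nat \<Rightarrow> nat set \<Rightarrow> nat" where
  "excess t X = card {(a, b). a < b \<and> a \<notin> X \<and> b \<in> X \<and> t dvd b - a}"

definition rowlen :: "nat list \<Rightarrow> nat \<Rightarrow> nat" where
  "rowlen lam i = (if i < length lam then lam ! i else 0)"

definition beads :: "nat \<Rightarrow> nat list \<Rightarrow> nat set" where
  "beads n lam = (\<lambda>i. rowlen lam i + (n - 1 - i)) ` {..<n}"

lemma rowlen_antimono:
  assumes "sorted_wrt (\<ge>) lam" "i \<le> j" shows "rowlen lam j \<le> rowlen lam i"
  using assms by (cases "i = j") (auto simp: rowlen_def sorted_wrt_iff_nth_less)

lemma bead_less:
  assumes "sorted_wrt (\<ge>) lam" "i < j" "j < n"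
  shows "rowlen lam j + (n - 1 - j) < rowlen lam i + (n - 1 - i)"
  using rowlen_antimono[OF assms(1), of i j] assms by linarith

lemma inj_on_bead:
  assumes "sorted_wrt (\<ge>) lam"
  shows "inj_on (\<lambda>i. rowlen lam i + (n - 1 - i)) {..<n}"
proof (rule inj_onI)
  fix i j assume "i \<in> {..<n}" "j \<in> {..<n}" "rowlen lam i + (n - 1 - i) = rowlen lam j + (n - 1 - j)"
  then show "i = j" using bead_less[OF assms, of i j n] bead_less[OF assms, of j i n]
    by (metis lessThan_iff less_irrefl nat_neq_iff)
qed

lemma finite_beads [simp]: "finite (beads n lam)" by (simp add: beads_def)

lemma card_beads: "sorted_wrt (\<ge>) lam \<Longrightarrow> card (beads n lam) = n"
  unfolding beads_def using card_image[OF inj_on_bead, of lam n] by simp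

lemma finite_excess_pairs: "finite X \<Longrightarrow> finite {(a, b). a < b \<and> a \<notin> X \<and> b \<in> X \<and> Q a (b :: nat)}"
proof (rule finite_subset)
  show "{(a, b). a < b \<and> a \<notin> X \<and> b \<in> X \<and> Q a b} \<subseteq> (\<Union>b\<in>X. {..<b} \<times> {b})" by auto
qed auto

lemma card_gaps:
  assumes "finite (X :: nat set)"
  shows "card {a. a < b \<and> a \<notin> X} + card {a \<in> X. a < b} = b"
proof -
  have "card ({a. a < b \<and> a \<notin> X} \<union> {a \<in> X. a < b}) = card {a. a < b \<and> a \<notin> X} + card {a \<in> X. a < b}"
    by (rule card_Un_disjoint) (use assms in auto)
  moreover have "{a. a < b \<and> a \<notin> X} \<union> {a \<in> X. a < b} = {..<b}" by auto
  ultimately show ?thesis by simp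
qed

lemma finite_boxes [simp]: "finite (boxes lam)"
proof (rule finite_subset)
  show "boxes lam \<subseteq> (SIGMA i:{..<length lam}. {..<lam ! i})" by (auto simp: boxes_def)
qed auto

text \<open>The parts of the conjugate partition, indexed from 0.\<close>

definition col :: "nat list \<Rightarrow> nat \<Rightarrow> nat" where
  "col lam j = card {k. k < length lam \<and> j < lam ! k}"

lemma col_iff:
  assumes "sorted_wrt (\<ge>) lam"
  shows "k < length lam \<and> j < lam ! k \<longleftrightarrow> k < col lam j"
proof -
  let ?S = "{k. k < length lam \<and> j < lam ! k}"
  have down: "i \<in> ?S" if "k \<in> ?S" "i \<le> k" for i k
    using that rowlen_antimono[OF assms that(2)] by (auto simp: rowlen_def)
  have fin: "finite ?S" by simp
  have "?S = {..<card ?S}"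
  proof (cases "?S = {}")
    case False
    have "?S = {..Max ?S}"
    proof
      show "?S \<subseteq> {..Max ?S}" using Max_ge[OF fin] by blast
      show "{..Max ?S} \<subseteq> ?S" using Max_in[OF fin False] down by blast
    qed
    then show ?thesis by (metis card_atMost lessThan_Suc_atMost)
  qed (metis card.empty lessThan_0)
  then show ?thesis unfolding col_def by blast
qed

text \<open>Row i gives the bead \<open>?b i\<close> and column j the gap \<open>?a j\<close>: these
  are the positions of the vertical and the horizontal steps of the boundary path of the diagram,
  and their difference is arm plus leg plus one. So the boxes of row i correspond to the gaps below
  \<open>?b i\<close>.\<close>

lemma hooks_div_eq_excess:
  assumes srt: "sorted_wrt (\<ge>) lam" and len: "length lam \<le> n"
  shows "hooks_div t lam = excess t (beads n lam)"
proof -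
  let ?b = "\<lambda>i. rowlen lam i + (n - 1 - i)"
  let ?a = "\<lambda>j. j + (n - col lam j)"
  have col_le: "col lam j \<le> length lam" for j
    unfolding col_def using card_mono[of "{..<length lam}" "{k. k < length lam \<and> j < lam ! k}"] by auto
  have col_anti: "col lam j' \<le> col lam j" if "j \<le> j'" for j j'
    unfolding col_def using that by (intro card_mono) auto
  have a_mono: "?a j < ?a j'" if "j < j'" for j j'
    using col_anti[of j j'] that by (auto intro: add_less_le_mono diff_le_mono2)
  have a_inj: "inj ?a"
  proof (rule injI)
    fix j j' assume "?a j = ?a j'"
    then show "j = j'" using a_mono[of j j'] a_mono[of j' j] by (cases j j' rule: linorder_cases) auto
  qed
  have hook: "?b i - ?a j = hook lam (i, j) \<and> ?a j < ?b i"
    if "i < length lam" "j < lam ! i" for i j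
  proof -
    have il: "i < col lam j" using col_iff[OF srt] that by blast
    have "{k. i < k \<and> k < length lam \<and> j < lam ! k} = {i<..<col lam j}"
    proof (rule set_eqI)
      fix k show "k \<in> {k. i < k \<and> k < length lam \<and> j < lam ! k} \<longleftrightarrow> k \<in> {i<..<col lam j}"
        using col_iff[OF srt, of k j] by auto
    qed
    then have "card {k. i < k \<and> k < length lam \<and> j < lam ! k} = col lam j - i - 1" by simp
    then have "hook lam (i, j) = (lam ! i - j - 1) + (col lam j - i - 1) + 1"
      by (simp only: hook_def fst_conv snd_conv)
    moreover have "rowlen lam i = lam ! i" using that by (simp add: rowlen_def)
    ultimately show ?thesis using il that(2) col_le[of j] len by linarith
  qed
  have a_notin: "?a j \<notin> beads n lam" for j
  proof
    assume "?a j \<in> beads n lam"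
    then obtain k where k: "k < n" "?a j = ?b k" by (auto simp: beads_def)
    show False
    proof (cases "k < col lam j")
      case True
      then have "k < length lam" "j < lam ! k" using col_iff[OF srt] by blast+
      then show False using k True by (simp add: rowlen_def)
    next
      case False
      then have "rowlen lam k \<le> j" using col_iff[OF srt, of k j] by (auto simp: rowlen_def)
      moreover have "n - 1 - k < n - col lam j" using False k by simp
      ultimately show False using k by simp
    qed
  qed
  \<comment> \<open>One inclusion and equal cardinality: of the \<open>?b i\<close> positions below
    the bead, the n - 1 - i later rows occupy one each, so lam ! i are free.\<close>
  have gaps: "?a ` {..<lam ! i} = {a. a < ?b i \<and> a \<notin> beads n lam}" if i: "i < length lam" for i
  proof (rule card_subset_eq)
    show "?a ` {..<lam ! i} \<subseteq> {a. a < ?b i \<and> a \<notin> beads n lam}"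
      using hook[OF i] a_notin by auto
    have "{x \<in> beads n lam. x < ?b i} = ?b ` {i<..<n}"
    proof -
      have "?b k < ?b i \<longleftrightarrow> i < k" if "k < n" for k
        using bead_less[OF srt, of k i n] bead_less[OF srt, of i k n] that i len
        by (metis less_irrefl less_trans linorder_neqE_nat order_less_le_trans)
      then show ?thesis by (auto simp: beads_def)
    qed
    moreover have "inj_on ?b {i<..<n}"
      by (rule inj_on_subset[OF inj_on_bead[OF srt, of n]]) auto
    then have "card (?b ` {i<..<n}) = card {i<..<n}" by (rule card_image)
    moreover have "card {i<..<n} = n - 1 - i" by simp
    ultimately have "card {a. a < ?b i \<and> a \<notin> beads n lam} = lam ! i"
      using card_gaps[of "beads n lam" "?b i"] i by (simp add: rowlen_def)
    then show "card (?a ` {..<lam ! i}) = card {a. a < ?b i \<and> a \<notin> beads n lam}"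
      using card_image[OF inj_on_subset[OF a_inj subset_UNIV], of "{..<lam ! i}"] by simp
  qed simp
  have "bij_betw (\<lambda>(i, j). (?a j, ?b i)) {u \<in> boxes lam. t dvd hook lam u}
    {(a, b). a < b \<and> a \<notin> beads n lam \<and> b \<in> beads n lam \<and> t dvd b - a}"
    unfolding bij_betw_def
  proof
    show "inj_on (\<lambda>(i, j). (?a j, ?b i)) {u \<in> boxes lam. t dvd hook lam u}"
    proof (rule inj_onI, clarify)
      fix i j i' j' assume u: "(i, j) \<in> boxes lam" "(i', j') \<in> boxes lam" "?a j = ?a j'" "?b i = ?b i'"
      then have "i < n" "i' < n" using len by (auto simp: boxes_def)
      then show "i = i' \<and> j = j'"
        using inj_onD[OF inj_on_bead[OF srt, of n], of i i'] injD[OF a_inj, of j j'] u by blast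
    qed
    show "(\<lambda>(i, j). (?a j, ?b i)) ` {u \<in> boxes lam. t dvd hook lam u} =
      {(a, b). a < b \<and> a \<notin> beads n lam \<and> b \<in> beads n lam \<and> t dvd b - a}" (is "?L = ?R")
    proof
      show "?L \<subseteq> ?R"
      proof clarify
        fix i j assume u: "(i, j) \<in> boxes lam" "t dvd hook lam (i, j)"
        then have "i < length lam" "j < lam ! i" by (auto simp: boxes_def)
        moreover from this have "?b i \<in> beads n lam" using len by (auto simp: beads_def)
        ultimately show "?a j < ?b i \<and> ?a j \<notin> beads n lam \<and> ?b i \<in> beads n lam \<and> t dvd ?b i - ?a j"
          using hook[of i j] a_notin[of j] u by simp
      qed
      show "?R \<subseteq> ?L"
      proof clarify
        fix a b assume ab: "a < b" "a \<notin> beads n lam" "b \<in> beads n lam" "t dvd b - a"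
        then obtain i where i: "i < n" "b = ?b i" by (auto simp: beads_def)
        \<comment> \<open>Below the bead of a padding row every position is a bead, so such a row
          has no gap to pair with.\<close>
        have il: "i < length lam"
        proof (rule ccontr)
          assume "\<not> i < length lam"
          then have "a < n - 1 - i" using i ab by (simp add: rowlen_def)
          then have "n - 1 - a < n" "rowlen lam (n - 1 - a) = 0" "n - 1 - (n - 1 - a) = a" 
            using \<open>\<not> i < length lam\<close> by (auto simp: rowlen_def)
          then have "a \<in> beads n lam" unfolding beads_def
            by (metis (no_types, lifting) add_0 imageI lessThan_iff)
          then show False using ab by simp
        qed
        then obtain j where "j < lam ! i" "a = ?a j" using gaps[OF il] ab i by auto
        then show "(a, b) \<in> ?L" using hook[OF il] ab il i
          by (intro image_eqI[of _ _ "(i, j)"]) (auto simp: boxes_def)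
      qed
    qed
  qed
  then show ?thesis unfolding hooks_div_def excess_def by (rule bij_betw_same_card)
qed

lemma card_boxes: "card (boxes lam) = sum_list lam"
proof -
  have "boxes lam = (SIGMA i:{..<length lam}. {..<lam ! i})" by (auto simp: boxes_def)
  then show ?thesis by (simp add: sum_list_sum_nth atLeast0LessThan)
qed

lemma hooks_div_1: "hooks_div 1 lam = sum_list lam"
  by (simp add: hooks_div_def card_boxes)

lemma sorted_list_of_beads:
  assumes "sorted_wrt (\<ge>) lam"
  shows "rev (sorted_list_of_set (beads n lam)) = map (\<lambda>i. rowlen lam i + (n - 1 - i)) [0..<n]"
proof -
  let ?l = "map (\<lambda>i. rowlen lam i + (n - 1 - i)) [0..<n]"
  have "sorted_wrt (\<lambda>x y. y < x) ?l"
    unfolding sorted_wrt_iff_nth_less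
  proof (intro allI impI)
    fix i j assume "i < j" "j < length ?l"
    then show "?l ! j < ?l ! i" using bead_less[OF assms, of i j n] by simp
  qed
  then have "sorted_wrt (<) (rev ?l)" by (simp only: sorted_wrt_rev)
  moreover have "set (rev ?l) = beads n lam" by (auto simp: beads_def)
  ultimately have "sorted_list_of_set (beads n lam) = rev ?l"
    by (metis sorted_list_of_set.idem_if_sorted_distinct strict_sorted_iff)
  then show ?thesis by simp
qed

text \<open>The bound on N makes room for every partition of N, which has at most N parts.
  Conversely, subtracting \<open>n - 1 - i\<close> from the i-th largest bead (counted from 0)
  leaves weakly decreasing row lengths, and \<open>takeWhile\<close> cuts off the zero rows.\<close>

lemma bij_beads:
  assumes "N \<le> n"
  shows "bij_betw (beads n) (partitions N) {X. finite X \<and> card X = n \<and> excess 1 X = N}"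
  unfolding bij_betw_def
proof
  show "inj_on (beads n) (partitions N)"
  proof (rule inj_onI)
    fix l m assume l: "l \<in> partitions N" and m: "m \<in> partitions N" and eq: "beads n l = beads n m"
    have len: "length l \<le> n" "length m \<le> n"
      using l m assms length_le_sum_list[of l] length_le_sum_list[of m] by (auto simp: partitions_def)
    have mp: "map (\<lambda>i. rowlen l i + (n - 1 - i)) [0..<n] = map (\<lambda>i. rowlen m i + (n - 1 - i)) [0..<n]"
      using sorted_list_of_beads[of l n] sorted_list_of_beads[of m n] l m eq
      by (simp add: partitions_def)
    have "rowlen l i = rowlen m i" if "i < n" for i
    proof -
      have "rowlen l i + (n - 1 - i) = rowlen m i + (n - 1 - i)"
        using arg_cong[OF mp, of "\<lambda>x. x ! i"] that by simp
      then show ?thesis by simp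
    qed
    then have row: "rowlen l i = rowlen m i" for i using len by (cases "i < n") (auto simp: rowlen_def)
    have pos: "0 < l ! i" if "i < length l" for i using l that by (auto simp: partitions_def)
    have pos': "0 < m ! i" if "i < length m" for i using m that by (auto simp: partitions_def)
    have "i < length l \<longleftrightarrow> i < length m" for i
      using row[of i] pos[of i] pos'[of i] by (auto simp: rowlen_def split: if_splits)
    then have "length l = length m" by (metis linorder_neqE_nat less_irrefl)
    then show "l = m" using row by (auto simp: rowlen_def intro!: nth_equalityI split: if_splits) metis
  qed
  have hd: "excess 1 (beads n l) = sum_list l" if "sorted_wrt (\<ge>) l" "length l \<le> n" for l
    using hooks_div_eq_excess[OF that, of 1] hooks_div_1[of l] by simp
  show "beads n ` partitions N = {X. finite X \<and> card X = n \<and> excess 1 X = N}" (is "?L = ?R")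
  proof
    show "?L \<subseteq> ?R"
      using hd assms length_le_sum_list by (fastforce simp: partitions_def card_beads)
    show "?R \<subseteq> ?L"
    proof
      fix X assume "X \<in> ?R"
      then have X: "finite X" "n = card X" "N = excess 1 X" by auto
      define f where "f = rev (sorted_list_of_set X)"
      have lf: "length f = n" using X by (simp add: f_def)
      have setf: "set f = X" using X by (simp add: f_def)
      have dec: "f ! j < f ! i" if "i < j" "j < n" for i j
      proof -
        have "sorted_wrt (>) f" unfolding f_def sorted_wrt_rev by simp
        then show ?thesis using that lf by (auto simp: sorted_wrt_iff_nth_less)
      qed
      have dec2: "f ! j + (j - i) \<le> f ! i" if "i \<le> j" "j < n" for i j
        using that
      proof (induction "j - i" arbitrary: j)
        case (Suc d)
        then have "f ! (j - 1) + ((j - 1) - i) \<le> f ! i" by (intro Suc) auto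
        moreover have "f ! j < f ! (j - 1)" using Suc by (intro dec) auto
        ultimately show ?case using Suc by linarith
      qed auto
      define g where "g i = f ! i - (n - 1 - i)" for i
      have gf: "g i + (n - 1 - i) = f ! i" if "i < n" for i
      unfolding g_def using dec2[of i "n - 1"] that by linarith
      have ganti: "g j \<le> g i" if "i \<le> j" "j < n" for i j
        using dec2[OF that] gf[of i] gf[of j] that by linarith
      define lam where "lam = takeWhile (\<lambda>x. 0 < x) (map g [0..<n])"
      have "sorted_wrt (\<ge>) (map g [0..<n])"
        using ganti by (auto simp: sorted_wrt_iff_nth_less)
      then have srt: "sorted_wrt (\<ge>) lam"
        unfolding lam_def by (metis sorted_wrt_append takeWhile_dropWhile_id)
      have len: "length lam \<le> n" unfolding lam_def using length_takeWhile_le by (metis diff_zero length_map length_upt)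
      have row: "rowlen lam i = g i" if "i < n" for i
      proof (cases "i < length lam")
        case True
        then show ?thesis using takeWhile_nth[of i "\<lambda>x. 0 < x" "map g [0..<n]"] that
          by (simp add: rowlen_def lam_def)
      next
        case False
        have "g (length lam) = 0"
          using nth_length_takeWhile[of "\<lambda>x. 0 < x" "map g [0..<n]"] that False by (simp add: lam_def)
        then show ?thesis using ganti[of "length lam" i] that False by (simp add: rowlen_def)
      qed
      have "beads n lam = (\<lambda>i. f ! i) ` {..<n}"
        unfolding beads_def using row gf by (intro image_cong) auto
      also have "\<dots> = X" using setf lf by (auto simp: set_conv_nth)
      finally have bX: "beads n lam = X" .
      then have "sum_list lam = N" using hd[OF srt len] X by simp
      moreover have "\<forall>x\<in>set lam. 0 < x" unfolding lam_def using set_takeWhileD by fastforce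
      ultimately have "lam \<in> partitions N" using srt by (simp add: partitions_def)
      then show "X \<in> ?L" using bX by blast
    qed
  qed
qed

section \<open>Runners of the abacus\<close>

definition runner :: "nat \<Rightarrow> nat \<Rightarrow> nat set \<Rightarrow> nat set" where
  "runner t s X = {k. s + t * k \<in> X}"

definition set_runner :: "nat \<Rightarrow> nat \<Rightarrow> nat set \<Rightarrow> nat set \<Rightarrow> nat set" where
  "set_runner t s X Y = {x \<in> X. x mod t \<noteq> s} \<union> (\<lambda>k. s + t * k) ` Y"

lemma inj_runner: "0 < t \<Longrightarrow> inj_on (\<lambda>k. s + t * k) (A :: nat set)"
  by (auto simp: inj_on_def)

lemma finite_runner: assumes "0 < t" "finite X" shows "finite (runner t s X)"
proof -
  have "finite ((\<lambda>k. s + t * k) ` runner t s X)"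
    by (rule finite_subset[OF _ assms(2)]) (auto simp: runner_def)
  then show ?thesis using finite_imageD inj_runner[OF assms(1)] by blast
qed

lemma finite_set_runner: "finite X \<Longrightarrow> finite Y \<Longrightarrow> finite (set_runner t s X Y)"
  by (simp add: set_runner_def)

lemma runner_set_runner_same: "0 < t \<Longrightarrow> s < t \<Longrightarrow> runner t s (set_runner t s X Y) = Y"
  by (auto simp: runner_def set_runner_def)

lemma runner_set_runner_other:
  "r < t \<Longrightarrow> s < t \<Longrightarrow> r \<noteq> s \<Longrightarrow> runner t r (set_runner t s X Y) = runner t r X"
proof (rule set_eqI)
  fix k assume a: "r < t" "s < t" "r \<noteq> s"
  have "r + t * k \<notin> (\<lambda>k. s + t * k) ` Y"
  proof
    assume "r + t * k \<in> (\<lambda>k. s + t * k) ` Y"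
    then obtain l where "r + t * k = s + t * l" by blast
    then have "(r + t * k) mod t = (s + t * l) mod t" by (rule arg_cong)
    then show False using a by simp
  qed
  then show "k \<in> runner t r (set_runner t s X Y) \<longleftrightarrow> k \<in> runner t r X"
    using a by (simp add: runner_def set_runner_def)
qed

lemma runner_image: assumes "s < t" shows "(\<lambda>k. s + t * k) ` runner t s X = {x \<in> X. x mod t = s}"
proof
  show "(\<lambda>k. s + t * k) ` runner t s X \<subseteq> {x \<in> X. x mod t = s}"
    using assms by (auto simp: runner_def)
  show "{x \<in> X. x mod t = s} \<subseteq> (\<lambda>k. s + t * k) ` runner t s X"
  proof
    fix x assume x: "x \<in> {x \<in> X. x mod t = s}"
    have "x = s + t * (x div t)" using x mod_mult_div_eq[of x t] by simp
    then show "x \<in> (\<lambda>k. s + t * k) ` runner t s X"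
      using x unfolding runner_def by (intro image_eqI[of _ _ "x div t"]) simp_all
  qed
qed

lemma set_runner_runner: assumes "s < t" shows "set_runner t s X (runner t s X) = X"
  unfolding set_runner_def runner_image[OF assms] by blast

lemma set_runner_set_runner:
  assumes "s < t" shows "set_runner t s (set_runner t s X Y) Z = set_runner t s X Z"
proof -
  have "(s + t * k) mod t = s" for k using assms by simp
  then show ?thesis by (auto simp: set_runner_def)
qed

lemma sum_set_runner:
  fixes g :: "nat \<Rightarrow> nat"
  assumes "s < t" "finite X" "finite Y"
  shows "sum g (set_runner t s X Y) = sum g {x \<in> X. x mod t \<noteq> s} + (\<Sum>k\<in>Y. g (s + t * k))"
proof -
  have "{x \<in> X. x mod t \<noteq> s} \<inter> (\<lambda>k. s + t * k) ` Y = {}" using assms by auto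
  then have "sum g (set_runner t s X Y) = sum g {x \<in> X. x mod t \<noteq> s} + sum g ((\<lambda>k. s + t * k) ` Y)"
    unfolding set_runner_def using assms by (intro sum.union_disjoint) auto
  also have "sum g ((\<lambda>k. s + t * k) ` Y) = (\<Sum>k\<in>Y. g (s + t * k))"
    using inj_runner[of t s Y] assms by (subst sum.reindex) auto
  finally show ?thesis .
qed

lemma card_set_runner:
  assumes "s < t" "finite X" "finite Y" "card Y = card (runner t s X)"
  shows "card (set_runner t s X Y) = card X"
proof -
  have "card X = card (set_runner t s X (runner t s X))" using set_runner_runner[OF assms(1)] by simp
  then show ?thesis
    using assms sum_set_runner[of s t X Y "\<lambda>_. 1"] sum_set_runner[of s t X "runner t s X" "\<lambda>_. 1"]
      finite_runner[of t X s] by (simp add: finite_set_runner)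
qed

lemma sum_card_less:
  assumes "finite (X :: nat set)"
  shows "(\<Sum>b\<in>X. card {a \<in> X. a < b}) = \<Sum>{..<card X}"
  using assms
proof (induction X rule: finite_linorder_max_induct)
  case (insert m X)
  have 1: "{a \<in> insert m X. a < m} = X" using insert by auto
  have "card {a \<in> insert m X. a < b} = card {a \<in> X. a < b}" if "b \<in> X" for b
    using insert that by (intro arg_cong[of _ _ card]) fastforce
  then have "(\<Sum>b\<in>X. card {a \<in> insert m X. a < b}) = \<Sum>{..<card X}"
    using insert.IH by simp
  moreover have m: "m \<notin> X" using insert by auto
  ultimately show ?case
    unfolding sum.insert[OF insert.hyps(1) m] card_insert_disjoint[OF insert.hyps(1) m] 1
    by (simp add: lessThan_Suc)
qed auto

text \<open>Of the b positions below a bead b the gaps are counted by \<open>excess 1 X\<close>; the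
  beads among them, summed over b, give every pair of beads once. So the size is the sum of the
  positions minus a constant that depends only on the number of beads.\<close>

lemma excess_1_sum:
  assumes "finite X"
  shows "excess 1 X + \<Sum>{..<card X} = \<Sum>X"
proof -
  have "{(a, b). a < b \<and> a \<notin> X \<and> b \<in> X \<and> 1 dvd b - a} = (\<lambda>(b, a). (a, b)) ` (SIGMA b:X. {a. a < b \<and> a \<notin> X})"
    by auto
  then have "excess 1 X = card (SIGMA b:X. {a. a < b \<and> a \<notin> X})"
    unfolding excess_def by (simp only:) (rule card_image, auto simp: inj_on_def)
  also have "\<dots> = (\<Sum>b\<in>X. card {a. a < b \<and> a \<notin> X})"
    using assms by (intro card_SigmaI) auto
  finally have "excess 1 X + \<Sum>{..<card X} = (\<Sum>b\<in>X. card {a. a < b \<and> a \<notin> X} + card {a \<in> X. a < b})"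
    by (simp only: sum.distrib sum_card_less[OF assms])
  also have "\<dots> = \<Sum>X" by (simp only: card_gaps[OF assms])
  finally show ?thesis .
qed

text \<open>As the runner keeps its number of beads, the triangular numbers of
  \<open>excess_1_sum\<close> cancel, and a move by one place on a runner is a move by t places in
  X.\<close>

lemma excess_set_runner:
  assumes "s < t" "finite X" "finite Y" "card Y = card (runner t s X)"
  shows "excess 1 (set_runner t s X Y) + t * excess 1 (runner t s X) = excess 1 X + t * excess 1 Y"
proof -
  let ?R = "runner t s X"
  have fR: "finite ?R" using assms finite_runner by simp
  have "\<Sum>(set_runner t s X Y) + t * \<Sum>?R = \<Sum>X + t * \<Sum>Y"
    using sum_set_runner[OF assms(1-3), of "\<lambda>x. x"] sum_set_runner[OF assms(1,2) fR, of "\<lambda>x. x"] assms(4)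
    by (simp add: sum.distrib sum_distrib_left[symmetric] set_runner_runner[OF assms(1)])
  then have "(excess 1 (set_runner t s X Y) + \<Sum>{..<card (set_runner t s X Y)}) + t * (excess 1 ?R + \<Sum>{..<card ?R})
      = (excess 1 X + \<Sum>{..<card X}) + t * (excess 1 Y + \<Sum>{..<card Y})"
    using excess_1_sum assms(2,3) fR finite_set_runner by presburger
  then show ?thesis unfolding card_set_runner[OF assms] assms(4) by (simp add: distrib_left)
qed

text \<open>A bead and a gap whose distance is divisible by t lie on the same runner, so the hooks
  divisible by t are the hooks of the t components of the t-quotient.\<close>

lemma excess_runners:
  assumes "0 < t" "finite X"
  shows "excess t X = (\<Sum>s<t. excess 1 (runner t s X))"
proof -
  let ?P = "\<lambda>s. {(k, l). k < l \<and> k \<notin> runner t s X \<and> l \<in> runner t s X \<and> 1 dvd l - k}"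
  let ?f = "\<lambda>(s, k, l). (s + t * k, s + t * l)"
  have fin: "finite (?P s)" for s using finite_excess_pairs[OF finite_runner[OF assms]] .
  have "{(a, b). a < b \<and> a \<notin> X \<and> b \<in> X \<and> t dvd b - a} = ?f ` (SIGMA s:{..<t}. ?P s)" (is "?L = ?R")
  proof
    show "?R \<subseteq> ?L" using assms(1) by (auto simp: runner_def diff_mult_distrib2[symmetric])
    show "?L \<subseteq> ?R"
    proof
      fix x assume "x \<in> ?L"
      then obtain a b where x: "x = (a, b)" and ab: "a < b" "a \<notin> X" "b \<in> X" "t dvd b - a" by blast
      obtain d where d: "b - a = t * d" using ab by blast
      have a: "a = a mod t + t * (a div t)" by simp
      have b: "b = a mod t + t * (a div t + d)" using d ab a by (simp add: distrib_left)
      have "d > 0" using d ab by (cases d) auto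
      then have "(a mod t, a div t, a div t + d) \<in> (SIGMA s:{..<t}. ?P s)"
        using assms(1) ab a b by (simp add: runner_def)
      moreover have "x = ?f (a mod t, a div t, a div t + d)" using x a b by simp
      ultimately show "x \<in> ?R" by blast
    qed
  qed
  moreover have "inj_on ?f (SIGMA s:{..<t}. ?P s)"
  proof (rule inj_onI)
    fix x y assume xy: "x \<in> (SIGMA s:{..<t}. ?P s)" "y \<in> (SIGMA s:{..<t}. ?P s)" "?f x = ?f y"
    obtain s k l where x: "x = (s, k, l)" "s < t" using xy(1) by auto
    obtain s' k' l' where y: "y = (s', k', l')" "s' < t" using xy(2) by auto
    have eq: "s + t * k = s' + t * k'" "s + t * l = s' + t * l'" using xy(3) x y by simp_all
    have "s = s'" using arg_cong[OF eq(1), of "\<lambda>x. x mod t"] x y by simp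
    then show "x = y" using eq x y assms(1) by simp
  qed
  ultimately have "excess t X = card (SIGMA s:{..<t}. ?P s)"
    unfolding excess_def by (simp only: card_image)
  also have "\<dots> = (\<Sum>s<t. excess 1 (runner t s X))"
    unfolding excess_def using fin by (intro card_SigmaI) auto
  finally show ?thesis .
qed

section \<open>The core-quotient decomposition, one runner at a time\<close>

lemma atMost_of_down_closed:
  assumes "finite (X :: nat set)" "X \<noteq> {}" "\<And>a b. b \<in> X \<Longrightarrow> a < b \<Longrightarrow> a \<in> X"
  shows "X = {..Max X}"
proof
  show "X \<subseteq> {..Max X}" using Max_ge[OF assms(1)] by blast
  show "{..Max X} \<subseteq> X" using Max_in[OF assms(1,2)] assms(3) le_neq_implies_less by blast
qed

lemma excess_1_eq_0_iff: assumes "finite X" shows "excess 1 X = 0 \<longleftrightarrow> X = {..<card X}"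
proof
  assume 0: "excess 1 X = 0"
  have "{(a, b). a < b \<and> a \<notin> X \<and> b \<in> X \<and> 1 dvd b - a} = {}"
    using 0 unfolding excess_def card_0_eq[OF finite_excess_pairs[OF assms]] .
  then have "a \<in> X" if "b \<in> X" "a < b" for a b using that by auto
  then have "\<exists>m. X = {..<m}"
    by (cases "X = {}") (use atMost_of_down_closed[OF assms] lessThan_Suc_atMost in blast)+
  then obtain m where "X = {..<m}" by blast
  then show "X = {..<card X}" by simp
next
  assume X: "X = {..<card X}"
  have "{(a, b). a < b \<and> a \<notin> X \<and> b \<in> X \<and> 1 dvd b - a} = {}" by (subst X, subst (2) X) auto
  then show "excess 1 X = 0" unfolding excess_def by (simp only: card.empty)
qed

text \<open>A gap at a has at least \<open>card X - a\<close> beads above it, each contributing a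
  pair. This keeps the low positions full, so that no runner is too short for the partitions placed
  on it.\<close>

lemma lessThan_subset_of_excess:
  assumes "finite X" "excess 1 X \<le> N" "N \<le> card X"
  shows "{..<card X - N} \<subseteq> X"
proof
  fix a assume a: "a \<in> {..<card X - N}"
  show "a \<in> X"
  proof (rule ccontr)
    assume na: "a \<notin> X"
    have "card X = card {x \<in> X. x < a} + card {x \<in> X. a < x}"
    proof -
      have "x < a \<or> a < x" if "x \<in> X" for x using na that nat_neq_iff by blast
      then have "X = {x \<in> X. x < a} \<union> {x \<in> X. a < x}" by blast
      moreover have "card ({x \<in> X. x < a} \<union> {x \<in> X. a < x}) = card {x \<in> X. x < a} + card {x \<in> X. a < x}"
        using assms(1) by (intro card_Un_disjoint) auto
      ultimately show ?thesis by simp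
    qed
    moreover have "card {x \<in> X. x < a} \<le> a" using card_mono[of "{..<a}" "{x \<in> X. x < a}"] by auto
    moreover have "card {x \<in> X. a < x} \<le> excess 1 X"
      unfolding excess_def by (rule card_inj_on_le[of "\<lambda>x. (a, x)"])
        (use na finite_excess_pairs[OF assms(1), of "\<lambda>a b. 1 dvd b - a"] in \<open>auto simp: inj_on_def\<close>)
    ultimately show False using a assms by simp
  qed
qed

text \<open>The runners below s are already flushed, that is, their quotient components are empty.
  For s = 0 these sets encode the partitions of N with w hooks divisible by t; for s = t only w = 0
  is possible and they encode the t-cores.\<close>

definition bead_sets :: "nat \<Rightarrow> nat \<Rightarrow> nat \<Rightarrow> nat \<Rightarrow> nat \<Rightarrow> nat set set" where
  "bead_sets n t s N w = {X. finite X \<and> card X = n \<and> excess 1 X = N \<and>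
     (\<forall>r<s. excess 1 (runner t r X) = 0) \<and> excess t X = w}"

definition fps_partitions :: "real fps" where
  "fps_partitions = Abs_fps (\<lambda>n. real (num_partitions n))"

lemma finite_bead_sets:
  assumes "N \<le> n" shows "finite (bead_sets n t s N w)"
proof (rule finite_subset)
  show "bead_sets n t s N w \<subseteq> {X. finite X \<and> card X = n \<and> excess 1 X = N}"
    unfolding bead_sets_def by blast
  show "finite {X. finite X \<and> card X = n \<and> excess 1 X = N}"
    using bij_betw_finite[OF bij_beads[OF assms]] finite_partitions by blast
qed

lemma card_beads_excess: "v \<le> m \<Longrightarrow> card {Y. finite Y \<and> card Y = m \<and> excess 1 Y = v} = num_partitions v"
  using bij_betw_same_card[OF bij_beads[of v m]] by (simp add: num_partitions_def)

lemma excess_t_set_runner: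
  assumes "s < t" "finite X" "finite Y"
  shows "excess t (set_runner t s X Y) + excess 1 (runner t s X) = excess t X + excess 1 Y"
proof -
  have t: "0 < t" and s: "s \<in> {..<t}" using assms by auto
  have "excess t (set_runner t s X Y) = excess 1 Y + (\<Sum>r\<in>{..<t} - {s}. excess 1 (runner t r (set_runner t s X Y)))"
    unfolding excess_runners[OF t finite_set_runner[OF assms(2,3)]] sum.remove[OF finite_lessThan s]
    using runner_set_runner_same[OF t assms(1)] by simp
  also have "(\<Sum>r\<in>{..<t} - {s}. excess 1 (runner t r (set_runner t s X Y))) = (\<Sum>r\<in>{..<t} - {s}. excess 1 (runner t r X))"
    using runner_set_runner_other assms(1) by (intro sum.cong) auto
  finally show ?thesis
    unfolding excess_runners[OF t assms(2)] sum.remove[OF finite_lessThan s] by simp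
qed

text \<open>That many beads fill the first t N positions, hence N places on each runner.\<close>

lemma card_runner_ge:
  assumes "s < t" "finite X" "excess 1 X \<le> N" "N + t * N \<le> card X"
  shows "N \<le> card (runner t s X)"
proof -
  have "{..<N} \<subseteq> runner t s X"
  proof
    fix k assume "k \<in> {..<N}"
    then have "t * Suc k \<le> t * N" by (intro mult_le_mono2) simp
    then have "s + t * k < t * N" using assms(1) by simp
    then have "s + t * k \<in> {..<card X - N}" using assms(4) by simp
    then show "k \<in> runner t s X"
      using lessThan_subset_of_excess[of X N] assms unfolding runner_def by auto
  qed
  then have "card {..<N} \<le> card (runner t s X)"
    using finite_runner[of t X s] assms by (intro card_mono) auto
  then show ?thesis by simp
qed

text \<open>Pushing the beads of runner s down to an initial segment takes out a partition of some
  size v and lowers N by t v and w by v. Conversely, any partition of v can be put on the flushed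
  runner; the lower bound on n guarantees enough beads for it.\<close>

lemma card_bead_sets_step:
  assumes st: "s < t" and n: "N + t * N \<le> n"
  shows "card (bead_sets n t s N w) =
    (\<Sum>v | v \<le> w \<and> t * v \<le> N. card (bead_sets n t (Suc s) (N - t * v) (w - v)) * num_partitions v)"
proof -
  let ?V = "{v. v \<le> w \<and> t * v \<le> N}"
  let ?A = "\<lambda>v. bead_sets n t (Suc s) (N - t * v) (w - v)"
  let ?Y = "\<lambda>v X. {Y. finite Y \<and> card Y = card (runner t s X) \<and> excess 1 Y = v}"
  let ?S = "SIGMA v:?V. SIGMA X:?A v. ?Y v X"
  let ?f = "\<lambda>(v, X, Y). set_runner t s X Y"
  let ?g = "\<lambda>X. (excess 1 (runner t s X), set_runner t s X {..<card (runner t s X)}, runner t s X)"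
  have t: "0 < t" using st by simp
  have bij: "bij_betw ?f ?S (bead_sets n t s N w)"
  proof (rule bij_betwI[where g="?g"])
    show "?f \<in> ?S \<rightarrow> bead_sets n t s N w"
    proof
      fix x assume "x \<in> ?S"
      then obtain v X Y where x: "x = (v, X, Y)" and v: "v \<le> w" "t * v \<le> N"
        and X: "X \<in> ?A v" and Y: "finite Y" "card Y = card (runner t s X)" "excess 1 Y = v" by auto
      have X': "finite X" "card X = n" "excess 1 X = N - t * v"
        "\<And>r. r < Suc s \<Longrightarrow> excess 1 (runner t r X) = 0" "excess t X = w - v"
        using X unfolding bead_sets_def by auto
      have "excess 1 (set_runner t s X Y) = N"
        using excess_set_runner[OF st X'(1) Y(1,2)] X' Y v by simp
      moreover have "excess t (set_runner t s X Y) = w"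
        using excess_t_set_runner[OF st X'(1) Y(1)] X' Y v by simp
      moreover have "excess 1 (runner t r (set_runner t s X Y)) = 0" if "r < s" for r
        using runner_set_runner_other[of r t s X Y] X'(4)[of r] that st by simp
      moreover have "card (set_runner t s X Y) = n"
        using card_set_runner[OF st X'(1) Y(1,2)] X'(2) by simp
      ultimately show "?f x \<in> bead_sets n t s N w"
        using finite_set_runner[OF X'(1) Y(1)] unfolding x bead_sets_def by simp
    qed
    show "?g \<in> bead_sets n t s N w \<rightarrow> ?S"
    proof
      fix X assume "X \<in> bead_sets n t s N w"
      then have X: "finite X" "card X = n" "excess 1 X = N"
        "\<And>r. r < s \<Longrightarrow> excess 1 (runner t r X) = 0" "excess t X = w"
        unfolding bead_sets_def by auto
      define v where "v = excess 1 (runner t s X)"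
      define c where "c = card (runner t s X)"
      let ?X = "set_runner t s X {..<c}"
      have e0: "excess 1 {..<c} = 0" using excess_1_eq_0_iff[of "{..<c}"] by simp
      have fr: "finite (runner t s X)" using finite_runner[OF t X(1)] .
      have 1: "excess 1 ?X + t * v = N"
        using excess_set_runner[OF st X(1), of "{..<c}"] X(3) e0 by (simp add: c_def v_def)
      have 2: "excess t ?X + v = w"
        using excess_t_set_runner[OF st X(1), of "{..<c}"] X(5) e0 by (simp add: v_def)
      have 3: "excess 1 (runner t r ?X) = 0" if "r < Suc s" for r
        using that runner_set_runner_other[of r t s X "{..<c}"] runner_set_runner_same[OF t st, of X "{..<c}"]
          X(4)[of r] st e0 by (cases "r = s") simp_all
      have 4: "card ?X = n" using card_set_runner[OF st X(1), of "{..<c}"] X(2) by (simp add: c_def)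
      have "?X \<in> ?A v" unfolding bead_sets_def using 1 2 3 4 finite_set_runner[OF X(1)] by auto
      moreover have "v \<in> ?V" using 1 2 by auto
      moreover have "runner t s X \<in> ?Y v ?X"
        using fr runner_set_runner_same[OF t st, of X "{..<c}"] by (simp add: c_def v_def)
      ultimately show "?g X \<in> ?S" unfolding v_def c_def by blast
    qed
    show "?g (?f x) = x" if xS: "x \<in> ?S" for x
    proof -
      obtain v X Y where x: "x = (v, X, Y)"
        and X: "X \<in> ?A v" and Y: "finite Y" "card Y = card (runner t s X)" "excess 1 Y = v" using xS by auto
      have X': "finite X" "excess 1 (runner t s X) = 0" using X unfolding bead_sets_def by auto
      have "runner t s X = {..<card Y}"
        using X'(2) excess_1_eq_0_iff[OF finite_runner[OF t X'(1)]] Y(2) by simp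
      then have "set_runner t s X {..<card Y} = X" using set_runner_runner[OF st, of X] by simp
      then show ?thesis unfolding x
        by (simp add: runner_set_runner_same[OF t st] set_runner_set_runner[OF st] Y(2) Y(3)[unfolded One_nat_def])
    qed
    show "?f (?g X) = X" for X
      by (simp add: set_runner_set_runner[OF st] set_runner_runner[OF st])
  qed
  have cY: "card (?Y v X) = num_partitions v" if "v \<in> ?V" "X \<in> ?A v" for v X
  proof (rule card_beads_excess)
    have X: "finite X" "card X = n" "excess 1 X = N - t * v" using that unfolding bead_sets_def by auto
    have "N \<le> card (runner t s X)" using card_runner_ge[OF st X(1), of N] X n by simp
    moreover have "1 * v \<le> t * v" using t by (intro mult_le_mono1) simp
    moreover have "t * v \<le> N" using that(1) by blast
    ultimately show "v \<le> card (runner t s X)" by linarith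
  qed
  have finY: "finite (?Y v X)" if "v \<in> ?V" "X \<in> ?A v" for v X
    using cY[OF that] num_partitions_pos[of v] card_ge_0_finite by metis
  have finA: "finite (?A v)" for v using n by (intro finite_bead_sets) simp
  have finV: "finite ?V" by simp
  have "card (bead_sets n t s N w) = card ?S" using bij_betw_same_card[OF bij] by simp
  also have "\<dots> = (\<Sum>v\<in>?V. card (SIGMA X:?A v. ?Y v X))"
    using finV finA finY by (intro card_SigmaI) auto
  also have "\<dots> = (\<Sum>v\<in>?V. card (?A v) * num_partitions v)"
  proof (rule sum.cong)
    fix v assume v: "v \<in> ?V"
    have "card (SIGMA X:?A v. ?Y v X) = (\<Sum>X\<in>?A v. card (?Y v X))"
      using finA finY[OF v] by (intro card_SigmaI) auto
    then show "card (SIGMA X:?A v. ?Y v X) = card (?A v) * num_partitions v"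
      using cY[OF v] by simp
  qed simp
  finally show ?thesis .
qed

text \<open>Each flushed runner contributes one convolution with the partition numbers, which
  becomes one more factor \<open>fps_partitions\<close>.\<close>

lemma card_bead_sets_iterate:
  assumes n: "N + t * N \<le> n" and "s \<le> t"
  shows "real (card (bead_sets n t 0 N w)) =
    (\<Sum>v\<le>w. (if t * v \<le> N then real (card (bead_sets n t s (N - t * v) (w - v))) else 0) * fps_nth (fps_partitions ^ s) v)"
  using assms(2)
proof (induction s)
  case 0
  have "(\<Sum>v\<le>w. (if t * v \<le> N then real (card (bead_sets n t 0 (N - t * v) (w - v))) else 0) * fps_nth (fps_partitions ^ 0) v)
    = (\<Sum>v\<in>{0}. (if t * v \<le> N then real (card (bead_sets n t 0 (N - t * v) (w - v))) else 0) * fps_nth (fps_partitions ^ 0) v)"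
    by (rule sum.mono_neutral_right) auto
  then show ?case by simp
next
  case (Suc s)
  define a where "a s v = (if t * v \<le> N then real (card (bead_sets n t s (N - t * v) (w - v))) else 0)" for s v
  have step: "a s v = (\<Sum>u\<le>w - v. a (Suc s) (v + u) * real (num_partitions u))" for v
  proof (cases "t * v \<le> N")
    case True
    have "N - t * v + t * (N - t * v) \<le> N + t * N" by (intro add_mono mult_le_mono2) auto
    then have n': "N - t * v + t * (N - t * v) \<le> n" using n by simp
    have "a s v = (\<Sum>u | u \<le> w - v \<and> t * u \<le> N - t * v. a (Suc s) (v + u) * real (num_partitions u))"
      unfolding a_def using True Suc.prems
      by (auto simp: card_bead_sets_step[OF _ n'] distrib_left le_diff_conv2 algebra_simps intro!: sum.cong)
    also have "\<dots> = (\<Sum>u\<le>w - v. a (Suc s) (v + u) * real (num_partitions u))"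
      using True by (intro sum.mono_neutral_left) (auto simp: a_def distrib_left)
    finally show ?thesis .
  next
    case False
    then have "a (Suc s) (v + u) = 0" for u by (auto simp: a_def distrib_left)
    then show ?thesis using False by (simp add: a_def)
  qed
  let ?c = "\<lambda>s v. fps_nth (fps_partitions ^ s) v"
  have "real (card (bead_sets n t 0 N w)) = (\<Sum>v\<le>w. a s v * ?c s v)"
    using Suc by (simp add: a_def)
  also have "\<dots> = (\<Sum>v\<le>w. \<Sum>u\<le>w - v. a (Suc s) (v + u) * (?c s v * fps_nth fps_partitions u))"
    by (intro sum.cong) (simp_all add: step sum_distrib_left fps_partitions_def mult_ac)
  also have "\<dots> = (\<Sum>(v, u) | v + u \<le> w. a (Suc s) (v + u) * (?c s v * fps_nth fps_partitions u))"
    by (subst sum.Sigma) (auto intro!: sum.cong)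
  also have "\<dots> = (\<Sum>m\<le>w. \<Sum>v\<le>m. a (Suc s) m * (?c s v * fps_nth fps_partitions (m - v)))"
    by (subst sum.triangle_reindex_eq) (auto intro!: sum.cong)
  also have "\<dots> = (\<Sum>m\<le>w. a (Suc s) m * ?c (Suc s) m)"
    by (simp add: fps_mult_nth sum_distrib_left atMost_atLeast0 mult.commute[of fps_partitions])
  finally show ?case by (simp add: a_def)
qed

lemma bij_beads_hooks:
  assumes "N \<le> n"
  shows "card {lam \<in> partitions N. hooks_div t lam = w} = card (bead_sets n t 0 N w)"
proof -
  have h: "hooks_div t lam = excess t (beads n lam)" if "lam \<in> partitions N" for lam
    using that assms length_le_sum_list[of lam] by (intro hooks_div_eq_excess) (auto simp: partitions_def)
  have img: "beads n ` partitions N = {X. finite X \<and> card X = n \<and> excess 1 X = N}"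
    and inj: "inj_on (beads n) (partitions N)"
    using bij_beads[OF assms] unfolding bij_betw_def by blast+
  have "beads n ` {lam \<in> partitions N. hooks_div t lam = w} = bead_sets n t 0 N w"
  proof
    show "beads n ` {lam \<in> partitions N. hooks_div t lam = w} \<subseteq> bead_sets n t 0 N w"
    proof clarify
      fix lam assume l: "lam \<in> partitions N" "w = hooks_div t lam"
      then have "beads n lam \<in> {X. finite X \<and> card X = n \<and> excess 1 X = N}" using img by blast
      then show "beads n lam \<in> bead_sets n t 0 N (hooks_div t lam)"
        using h[OF l(1)] by (simp add: bead_sets_def)
    qed
    show "bead_sets n t 0 N w \<subseteq> beads n ` {lam \<in> partitions N. hooks_div t lam = w}"
    proof
      fix X assume X: "X \<in> bead_sets n t 0 N w"
      then have "X \<in> beads n ` partitions N" unfolding img bead_sets_def by blast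
      then obtain lam where l: "lam \<in> partitions N" "X = beads n lam" by blast
      then have "hooks_div t lam = w" using h[OF l(1)] X by (simp add: bead_sets_def)
      then show "X \<in> beads n ` {lam \<in> partitions N. hooks_div t lam = w}" using l by blast
    qed
  qed
  moreover have "card (beads n ` {lam \<in> partitions N. hooks_div t lam = w}) = card {lam \<in> partitions N. hooks_div t lam = w}"
    by (rule card_image) (rule inj_on_subset[OF inj], blast)
  ultimately show ?thesis by simp
qed

definition cores :: "nat \<Rightarrow> nat \<Rightarrow> nat" where
  "cores t N = card {lam \<in> partitions N. is_core t lam}"

text \<open>The core-quotient theorem in counting form: a partition with w hooks divisible by t
  amounts to a t-core of N - t w together with t partitions of total size w.\<close>

theorem card_hooks_div:
  assumes "0 < t"
  shows "real (card {lam \<in> partitions N. hooks_div t lam = w}) =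
    (if t * w \<le> N then fps_nth (fps_partitions ^ t) w * real (cores t (N - t * w)) else 0)"
proof -
  define n where "n = N + t * N"
  have ex: "excess t X = 0 \<longleftrightarrow> (\<forall>r<t. excess 1 (runner t r X) = 0)" if "finite X" for X
    unfolding excess_runners[OF assms that] by (subst sum_eq_0_iff) auto
  have empty: "bead_sets n t t M v = {}" if "v \<noteq> 0" for M v
  proof (rule equals0I)
    fix X assume "X \<in> bead_sets n t t M v"
    then have "finite X" "\<forall>r<t. excess 1 (runner t r X) = 0" "excess t X = v"
      unfolding bead_sets_def by blast+
    then show False using ex[of X] \<open>v \<noteq> 0\<close> by simp
  qed
  have top: "bead_sets n t t M 0 = bead_sets n t 0 M 0" for M
  proof (rule set_eqI)
    fix X show "X \<in> bead_sets n t t M 0 \<longleftrightarrow> X \<in> bead_sets n t 0 M 0"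
      using ex[of X] unfolding bead_sets_def mem_Collect_eq by (cases "finite X") simp_all
  qed
  have "real (card {lam \<in> partitions N. hooks_div t lam = w}) = real (card (bead_sets n t 0 N w))"
    using bij_beads_hooks[of N n] by (simp add: n_def)
  also have "\<dots> = (\<Sum>v\<le>w. (if t * v \<le> N then real (card (bead_sets n t t (N - t * v) (w - v))) else 0) * fps_nth (fps_partitions ^ t) v)"
    by (rule card_bead_sets_iterate) (auto simp: n_def)
  also have "\<dots> = (\<Sum>v\<in>{w}. (if t * v \<le> N then real (card (bead_sets n t t (N - t * v) (w - v))) else 0) * fps_nth (fps_partitions ^ t) v)"
    by (rule sum.mono_neutral_right) (auto simp: empty)
  also have "\<dots> = (if t * w \<le> N then fps_nth (fps_partitions ^ t) w * real (card (bead_sets n t 0 (N - t * w) 0)) else 0)"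
    by (simp add: top)
  also have "card (bead_sets n t 0 (N - t * w) 0) = cores t (N - t * w)"
    unfolding cores_def is_core_def by (subst bij_beads_hooks[of _ n]) (auto simp: n_def)
  finally show ?thesis .
qed

section \<open>The generating function of the partition numbers\<close>

lemma mparts_0: "mparts 0 = {{#}}"
proof -
  have "M = {#}" if "sum_mset M = 0" "0 \<notin># M" for M :: "nat multiset"
    using that by (metis add_eq_0_iff_both_eq_0 multiset_nonemptyE sum_mset.remove)
  then show ?thesis by (auto simp: mparts_def)
qed

lemma parts_in_greaterThan_0: "parts_in {0<..} n = num_partitions n"
proof -
  have "{M \<in> mparts n. set_mset M \<subseteq> {0<..}} = mparts n"
    by (auto simp: mparts_def) (metis gr0I)
  then show ?thesis by (simp add: parts_in_def card_mparts)
qed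

lemma parts_in_0 [simp]: "parts_in A 0 = 1"
proof -
  have "{M \<in> mparts 0. set_mset M \<subseteq> A} = {{#}}" by (auto simp: mparts_0)
  then show ?thesis by (simp add: parts_in_def)
qed

lemma parts_in_greaterThan_small:
  assumes "0 < n" "n \<le> m" shows "parts_in {m<..} n = 0"
proof -
  have "{M \<in> mparts n. set_mset M \<subseteq> {m<..}} = {}"
  proof (rule equals0I)
    fix M assume M: "M \<in> {M \<in> mparts n. set_mset M \<subseteq> {m<..}}"
    then have "M \<noteq> {#}" using assms by (auto simp: mparts_def)
    then obtain x where x: "x \<in># M" by blast
    then have "x \<le> sum_mset M" by (simp add: sum_mset.remove)
    moreover have "m < x" using M x by blast
    ultimately show False using M assms by (simp add: mparts_def)
  qed
  then show ?thesis by (simp only: parts_in_def card.empty)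
qed

lemma parts_in_greaterThan_rec:
  "parts_in {m<..} n = parts_in {Suc m<..} n + (if Suc m \<le> n then parts_in {m<..} (n - Suc m) else 0)"
proof -
  have "{m<..} - {Suc m} = {Suc m<..}" by auto
  then show ?thesis using parts_in_remove[of "Suc m" "{m<..}" n] by simp
qed

text \<open>Forbidding the part m + 1 costs at most the factor \<open>1 / (1 - q ^ Suc m)\<close>.
  Stopping the sums at K avoids any appeal to convergence, and once all parts up to K are forbidden
  only the empty partition is left.\<close>

lemma sum_partitions_le:
  fixes q :: real
  assumes q: "0 \<le> q" "q < 1"
  shows "(\<Sum>n\<le>K. real (num_partitions n) * q ^ n) \<le> exp (1 / (1 - q)\<^sup>2)"
proof -
  define S where "S m = (\<Sum>n\<le>K. real (parts_in {m<..} n) * q ^ n)" for m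
  have Spos: "0 \<le> S m" for m unfolding S_def using q by (intro sum_nonneg) auto
  have step: "S m \<le> exp (q ^ Suc m / (1 - q)) * S (Suc m)" for m
  proof -
    let ?t = "Suc m"
    have "S m = S ?t + (\<Sum>n\<le>K. (if ?t \<le> n then real (parts_in {m<..} (n - ?t)) else 0) * q ^ n)"
      unfolding S_def sum.distrib[symmetric]
      by (rule sum.cong[OF refl], subst parts_in_greaterThan_rec) (auto simp: algebra_simps)
    also have "(\<Sum>n\<le>K. (if ?t \<le> n then real (parts_in {m<..} (n - ?t)) else 0) * q ^ n) =
        (\<Sum>n\<in>{?t..K}. real (parts_in {m<..} (n - ?t)) * q ^ n)"
      by (rule sum.mono_neutral_cong_right) auto
    also have "\<dots> = (\<Sum>n\<in>{n. n + ?t \<le> K}. real (parts_in {m<..} n) * q ^ (n + ?t))"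
      by (rule sum.reindex_bij_witness[of _ "\<lambda>n. n + ?t" "\<lambda>n. n - ?t"]) auto
    also have "\<dots> \<le> (\<Sum>n\<le>K. real (parts_in {m<..} n) * q ^ (n + ?t))"
      using q by (intro sum_mono2) auto
    also have "\<dots> = q ^ ?t * S m" by (simp add: S_def sum_distrib_left power_add mult_ac)
    finally have 1: "(1 - q ^ ?t) * S m \<le> S ?t" by (simp add: algebra_simps)
    have qt: "q ^ ?t \<le> q" using q by (simp add: mult_left_le power_le_one)
    have "1 / (1 - q ^ ?t) = 1 + q ^ ?t / (1 - q ^ ?t)" using qt q by (simp add: field_simps)
    also have "\<dots> \<le> 1 + q ^ ?t / (1 - q)" using q qt by (intro add_left_mono divide_left_mono mult_pos_pos) auto
    also have "\<dots> \<le> exp (q ^ ?t / (1 - q))" by (rule exp_ge_add_one_self)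
    finally have 2: "1 / (1 - q ^ ?t) \<le> exp (q ^ ?t / (1 - q))" .
    have "S m = 1 / (1 - q ^ ?t) * ((1 - q ^ ?t) * S m)" using qt q by simp
    also have "\<dots> \<le> exp (q ^ ?t / (1 - q)) * S ?t"
      using 1 2 qt q Spos by (intro mult_mono) auto
    finally show ?thesis .
  qed
  have iter: "S 0 \<le> exp (\<Sum>j<m. q ^ Suc j / (1 - q)) * S m" for m
  proof (induction m)
    case (Suc m)
    have "S 0 \<le> exp (\<Sum>j<m. q ^ Suc j / (1 - q)) * (exp (q ^ Suc m / (1 - q)) * S (Suc m))"
      using Suc step[of m] by (meson exp_ge_zero mult_left_mono order_trans)
    then show ?case by (simp add: exp_add mult_ac)
  qed simp
  have "S K = (\<Sum>n\<in>{0}. real (parts_in {K<..} n) * q ^ n)"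
    unfolding S_def by (rule sum.mono_neutral_right) (auto simp: parts_in_greaterThan_small)
  then have SK: "S K = 1" by simp
  have "(\<Sum>j<K. q ^ Suc j / (1 - q)) \<le> 1 / (1 - q)\<^sup>2"
  proof -
    have "(\<Sum>j<K. q ^ j) = (1 - q ^ K) / (1 - q)" using q by (subst sum_gp_strict) auto
    also have "\<dots> \<le> 1 / (1 - q)" using q by (intro divide_right_mono) auto
    finally have a: "(\<Sum>j<K. q ^ j) \<le> 1 / (1 - q)" .
    have "(\<Sum>j<K. q ^ Suc j / (1 - q)) = q / (1 - q) * (\<Sum>j<K. q ^ j)"
      by (simp add: sum_distrib_left)
    also have "\<dots> \<le> 1 / (1 - q) * (1 / (1 - q))"
      using a q by (intro mult_mono divide_right_mono) (auto intro!: sum_nonneg)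
    finally show ?thesis by (simp add: power2_eq_square)
  qed
  then have "exp (\<Sum>j<K. q ^ Suc j / (1 - q)) \<le> exp (1 / (1 - q)\<^sup>2)" by simp
  then have "S 0 \<le> exp (1 / (1 - q)\<^sup>2)" using iter[of K] unfolding SK by linarith
  then show ?thesis by (simp add: S_def parts_in_greaterThan_0)
qed

lemma summable_partitions_real:
  fixes q :: real
  assumes q: "0 \<le> q" "q < 1"
  shows "summable (\<lambda>n. real (num_partitions n) * q ^ n)"
  by (rule bounded_imp_summable[of _ "exp (1 / (1 - q)\<^sup>2)"])
    (use q sum_partitions_le[OF q] in auto)

definition pgf :: "'a :: {real_normed_field, banach} \<Rightarrow> 'a" where
  "pgf z = (\<Sum>n. of_nat (num_partitions n) * z ^ n)"

lemma summable_norm_parts_in: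
  fixes z :: "'a :: {real_normed_field, banach}"
  assumes "norm z < 1"
  shows "summable (\<lambda>n. norm (of_nat (parts_in A n) * z ^ n))"
proof (rule summable_comparison_test')
  show "summable (\<lambda>n. real (num_partitions n) * norm z ^ n)"
    using assms by (intro summable_partitions_real) auto
  show "norm (norm (of_nat (parts_in A n) * z ^ n)) \<le> real (num_partitions n) * norm z ^ n" if "n \<ge> 0" for n
    using parts_in_le[of A n] by (simp add: norm_mult norm_power mult_right_mono)
qed

lemma summable_norm_partitions:
  fixes z :: "'a :: {real_normed_field, banach}"
  assumes "norm z < 1"
  shows "summable (\<lambda>n. norm (of_nat (num_partitions n) * z ^ n))"
  using summable_norm_parts_in[OF assms, of UNIV] by (simp add: parts_in_UNIV)

lemma pgf_sums:
  fixes z :: "'a :: {real_normed_field, banach}"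
  assumes "norm z < 1"
  shows "(\<lambda>n. of_nat (num_partitions n) * z ^ n) sums pgf z"
  unfolding pgf_def using summable_norm_cancel[OF summable_norm_partitions[OF assms]] by (rule summable_sums)

lemma pgf_prod:
  fixes z :: "'a :: {real_normed_field, banach}"
  assumes z: "norm z < 1"
  shows "pgf z * (\<Prod>j<m. 1 - z ^ Suc j) = (\<Sum>n. of_nat (parts_in {m<..} n) * z ^ n)"
proof (induction m)
  case 0
  then show ?case by (simp add: pgf_def parts_in_greaterThan_0)
next
  case (Suc m)
  let ?R = "\<lambda>m. (\<Sum>n. of_nat (parts_in {m<..} n) * z ^ n)"
  have sm: "summable (\<lambda>n. of_nat (parts_in {m<..} n) * z ^ n)" for m
    using summable_norm_cancel[OF summable_norm_parts_in[OF z]] .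
  let ?g = "\<lambda>n. (if Suc m \<le> n then of_nat (parts_in {m<..} (n - Suc m)) else 0) * z ^ n"
  have "(\<lambda>n. z ^ Suc m * (of_nat (parts_in {m<..} n) * z ^ n)) sums (z ^ Suc m * ?R m)"
    by (intro sums_mult summable_sums sm)
  then have "(\<lambda>n. ?g (n + Suc m)) sums (z ^ Suc m * ?R m)"
    by (simp add: power_add mult_ac)
  then have g: "?g sums (z ^ Suc m * ?R m)"
    by (subst (asm) sums_zero_iff_shift) auto
  have "(\<lambda>n. of_nat (parts_in {Suc m<..} n) * z ^ n + ?g n) sums (?R (Suc m) + z ^ Suc m * ?R m)"
    by (intro sums_add g summable_sums sm)
  moreover have "of_nat (parts_in {Suc m<..} n) * z ^ n + ?g n = of_nat (parts_in {m<..} n) * z ^ n" for n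
    by (subst (3) parts_in_greaterThan_rec) (simp add: distrib_right)
  ultimately have "?R m = ?R (Suc m) + z ^ Suc m * ?R m"
    by (simp add: sums_iff)
  then have "?R (Suc m) = ?R m * (1 - z ^ Suc m)" by (simp add: algebra_simps)
  then show ?case using Suc by (simp add: mult.assoc)
qed

text \<open>The coefficients of degree 1 to m have vanished and the others are still bounded by
  partition numbers, so the distance to 1 is at most a tail of the partition series. This is Euler's
  product.\<close>

lemma pgf_prod_tendsto:
  fixes z :: "'a :: {real_normed_field, banach}"
  assumes z: "norm z < 1"
  shows "(\<lambda>m. pgf z * (\<Prod>j<m. 1 - z ^ Suc j)) \<longlonglongrightarrow> 1"
proof -
  let ?a = "\<lambda>n. real (num_partitions n) * norm z ^ n"
  have sa: "summable ?a" using z by (intro summable_partitions_real) auto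
  have bound: "norm (pgf z * (\<Prod>j<m. 1 - z ^ Suc j) - 1) \<le> (\<Sum>n. ?a (n + Suc m))" for m
  proof -
    let ?f = "\<lambda>n. of_nat (parts_in {m<..} n) * z ^ n"
    have sf: "summable (\<lambda>n. norm (?f n))" using summable_norm_parts_in[OF z] .
    have "(\<Sum>n<Suc m. ?f n) = (\<Sum>n\<in>{0}. ?f n)"
      by (rule sum.mono_neutral_right) (auto simp: parts_in_greaterThan_small)
    then have "suminf ?f - 1 = (\<Sum>n. ?f (n + Suc m))"
      using suminf_split_initial_segment[OF summable_norm_cancel[OF sf], of "Suc m"] by simp
    moreover have "norm (\<Sum>n. ?f (n + Suc m)) \<le> (\<Sum>n. norm (?f (n + Suc m)))"
      using sf by (intro summable_norm) (subst summable_iff_shift)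
    moreover have "(\<Sum>n. norm (?f (n + Suc m))) \<le> (\<Sum>n. ?a (n + Suc m))"
    proof (rule suminf_le)
      show "norm (?f (n + Suc m)) \<le> ?a (n + Suc m)" for n
        using parts_in_le[of "{m<..}" "n + Suc m"] by (simp add: norm_mult norm_power mult_right_mono)
      show "summable (\<lambda>n. norm (?f (n + Suc m)))" using sf by (subst summable_iff_shift)
      show "summable (\<lambda>n. ?a (n + Suc m))" using sa by (subst summable_iff_shift)
    qed
    ultimately show ?thesis unfolding pgf_prod[OF z] by simp
  qed
  have "(\<lambda>m. \<Sum>n. ?a (n + m)) \<longlonglongrightarrow> 0"
    by (rule suminf_exist_split2[OF sa])
  then have "(\<lambda>m. \<Sum>n. ?a (n + Suc m)) \<longlonglongrightarrow> 0"
    by (rule LIMSEQ_Suc)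
  then have "(\<lambda>m. pgf z * (\<Prod>j<m. 1 - z ^ Suc j) - 1) \<longlonglongrightarrow> 0"
    by (rule Lim_null_comparison[rotated]) (use bound in auto)
  then show ?thesis by (simp add: LIM_zero_iff)
qed

section \<open>Euler's product in logarithmic form\<close>

lemma norm_Ln_1_minus_le:
  assumes "norm (w :: complex) \<le> b" "b < 1"
  shows "norm (Ln (1 - w)) \<le> norm w / (1 - b)"
proof -
  have w: "norm w < 1" using assms by simp
  have "(\<lambda>n. - ((w) ^ n) / of_nat n) sums Ln (1 - w)"
    using Ln_series'[of "-w"] w by simp
  then have s: "(\<lambda>n. - (w ^ Suc n) / of_nat (Suc n)) sums Ln (1 - w)"
    using sums_Suc_iff[of "\<lambda>n. - (w ^ n) / of_nat n" "Ln (1 - w)"] by simp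
  have g: "(\<lambda>n. norm w * norm w ^ n) sums (norm w * (1 / (1 - norm w)))"
    by (intro sums_mult geometric_sums) (use w in auto)
  have "norm (Ln (1 - w)) \<le> norm w * (1 / (1 - norm w))"
  proof (rule norm_sums_le[OF s g])
    fix n
    have "norm (w ^ Suc n) / real (Suc n) \<le> norm (w ^ Suc n) / 1"
      by (intro divide_left_mono) auto
    then show "norm (- (w ^ Suc n) / of_nat (Suc n)) \<le> norm w * norm w ^ n"
      by (simp add: norm_divide norm_mult norm_power del: of_nat_Suc)
  qed
  also have "\<dots> \<le> norm w * (1 / (1 - b))"
    using assms w by (intro mult_left_mono divide_left_mono mult_pos_pos) auto
  finally show ?thesis by simp
qed

lemma summable_Ln:
  assumes z: "norm (z :: complex) < 1"
  shows "summable (\<lambda>n. Ln (1 - z ^ Suc n))"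
proof (rule summable_comparison_test')
  show "summable (\<lambda>n. norm z * norm z ^ n * (1 / (1 - norm z)))"
    using z by (intro summable_mult summable_mult2 summable_geometric) auto
  fix n :: nat
  have "norm (z ^ Suc n) \<le> norm z"
    using z by (simp add: norm_mult norm_power mult_left_le power_le_one)
  from norm_Ln_1_minus_le[OF this z]
  show "norm (Ln (1 - z ^ Suc n)) \<le> norm z * norm z ^ n * (1 / (1 - norm z))"
    by (simp add: norm_mult norm_power)
qed

text \<open>In this form the modulus and the phase of the product become sums over the part size,
  which can be estimated term by term.\<close>

lemma pgf_eq_exp:
  assumes z: "norm (z :: complex) < 1"
  shows "pgf z = exp (- (\<Sum>n. Ln (1 - z ^ Suc n)))"
proof -
  have ne: "1 - z ^ Suc n \<noteq> 0" for n
  proof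
    assume "1 - z ^ Suc n = 0"
    then have "norm (z ^ Suc n) = 1" by simp
    then show False using z power_less_one_iff[of "norm z" "Suc n"] by (simp add: norm_mult norm_power)
  qed
  have "(\<lambda>m. \<Sum>j<m. Ln (1 - z ^ Suc j)) \<longlonglongrightarrow> (\<Sum>n. Ln (1 - z ^ Suc n))"
    using summable_Ln[OF z] by (rule summable_LIMSEQ)
  then have "(\<lambda>m. pgf z * exp (\<Sum>j<m. Ln (1 - z ^ Suc j))) \<longlonglongrightarrow> pgf z * exp (\<Sum>n. Ln (1 - z ^ Suc n))"
    by (intro tendsto_intros)
  moreover have "exp (\<Sum>j<m. Ln (1 - z ^ Suc j)) = (\<Prod>j<m. 1 - z ^ Suc j)" for m
    using ne by (simp add: exp_sum exp_Ln del: power_Suc)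
  ultimately have "pgf z * exp (\<Sum>n. Ln (1 - z ^ Suc n)) = 1"
    using pgf_prod_tendsto[OF z] LIMSEQ_unique by simp
  then show ?thesis by (simp add: exp_minus field_simps)
qed

lemma pgf_of_real: "\<bar>q\<bar> < 1 \<Longrightarrow> pgf (complex_of_real q) = of_real (pgf q)"
  using sums_of_real[OF pgf_sums[of q], where ?'a = complex] pgf_sums[of "complex_of_real q"]
  by (auto simp: sums_iff)

lemma summable_ln_real:
  assumes "0 \<le> q" "q < (1 :: real)"
  shows "summable (\<lambda>n. ln (1 - q ^ Suc n))"
proof -
  have "q ^ Suc n < 1" for n using assms power_Suc_less_one[of q n] by (cases "q = 0") auto
  then have "Ln (1 - complex_of_real q ^ Suc n) = of_real (ln (1 - q ^ Suc n))" for n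
    using Ln_of_real[of "1 - q ^ Suc n"] by (simp del: power_Suc)
  then have "summable (\<lambda>n. complex_of_real (ln (1 - q ^ Suc n)))"
    using summable_Ln[of "complex_of_real q"] assms by (simp del: power_Suc)
  then show ?thesis by (rule summable_complex_of_real[THEN iffD1])
qed

lemma pgf_real_eq_exp:
  assumes "0 \<le> q" "q < (1 :: real)"
  shows "pgf q = exp (- (\<Sum>n. ln (1 - q ^ Suc n)))"
proof -
  have "q ^ Suc n < 1" for n using assms power_Suc_less_one[of q n] by (cases "q = 0") auto
  then have "Ln (1 - complex_of_real q ^ Suc n) = of_real (ln (1 - q ^ Suc n))" for n
    using Ln_of_real[of "1 - q ^ Suc n"] by (simp del: power_Suc)
  then have "complex_of_real (pgf q) = exp (- (\<Sum>n. of_real (ln (1 - q ^ Suc n))))"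
    using pgf_eq_exp[of "complex_of_real q"] assms by (simp add: pgf_of_real del: power_Suc)
  also have "\<dots> = of_real (exp (- (\<Sum>n. ln (1 - q ^ Suc n))))"
    using suminf_of_real[OF summable_ln_real[OF assms], where ?'a = complex]
    by (simp add: exp_of_real[symmetric] del: power_Suc)
  finally show ?thesis by (simp only: of_real_eq_iff)
qed

section \<open>Modulus and phase of the generating function on a circle\<close>

lemma sums_Suc_times_Suc_Suc:
  assumes "0 \<le> Q" "Q < (1::real)"
  shows "(\<lambda>k. real (Suc k) * real (Suc (Suc k)) * Q ^ k) sums (2 / (1 - Q) ^ 3)"
proof -
  have s1: "(\<lambda>n. real (Suc n) * Q ^ n) sums (1 / (1 - Q)\<^sup>2)"
    using geometric_deriv_sums[of Q] assms by simp
  have s2: "(\<lambda>n. Q ^ n) sums (1 / (1 - Q))" using assms by (intro geometric_sums) auto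
  have A: "(\<lambda>k. \<Sum>i\<le>k. (real (Suc i) * Q ^ i) * Q ^ (k - i)) sums ((\<Sum>n. real (Suc n) * Q ^ n) * (\<Sum>n. Q ^ n))"
  proof (rule Cauchy_product_sums)
    show "summable (\<lambda>k. norm (real (Suc k) * Q ^ k))"
      using sums_summable[OF s1] assms by (simp add: abs_mult)
    show "summable (\<lambda>k. norm (Q ^ k))" using sums_summable[OF s2] assms by simp
  qed
  have conv: "(\<Sum>i\<le>k. (real (Suc i) * Q ^ i) * Q ^ (k - i)) = real (Suc k) * real (Suc (Suc k)) / 2 * Q ^ k" for k
  proof -
    have "(\<Sum>i\<le>k. (real (Suc i) * Q ^ i) * Q ^ (k - i)) = (\<Sum>i\<le>k. real (Suc i)) * Q ^ k"
      by (simp add: sum_distrib_right mult.assoc power_add[symmetric])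
    moreover have "(\<Sum>i\<le>k. real (Suc i)) = real (Suc k) * real (Suc (Suc k)) / 2"
      by (induction k) (auto simp: field_simps)
    ultimately show ?thesis by simp
  qed
  have P: "(\<Sum>n. real (Suc n) * Q ^ n) * (\<Sum>n. Q ^ n) = 1 / (1 - Q) ^ 3"
    using s1 s2 by (simp add: sums_iff power2_eq_square power3_eq_cube)
  from sums_mult[OF A[unfolded conv P], of 2] show ?thesis by (simp add: mult.assoc)
qed

lemma abs_sin_minus_le: "\<bar>sin x - x\<bar> \<le> \<bar>x\<bar> ^ 3 / (6::real)"
proof -
  have "(\<Sum>m<3. sin_coeff m * x ^ m) = x"
    by (simp add: sin_coeff_def numeral_3_eq_3)
  then show ?thesis using Maclaurin_sin_bound[of x 3] by (simp add: fact_numeral)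
qed

lemma one_minus_cos_le: "1 - cos x \<le> x\<^sup>2 / (2::real)"
proof -
  have "1 - cos x = 2 * (sin (x / 2))\<^sup>2" using cos_double_sin[of "x / 2"] by simp
  moreover have "(sin (x / 2))\<^sup>2 \<le> (x / 2)\<^sup>2" using abs_sin_x_le_abs_x[of "x / 2"] by (simp only: abs_le_square_iff)
  ultimately show ?thesis by (simp add: power_divide)
qed

text \<open>With u = |x| / 2, which is at most 2, sin u \<ge> u - u^3 / 6 \<ge> u / 3; hence 1 - cos
  x \<ge> 2 (u / 3)^2 = x^2 / 18.\<close>

lemma one_minus_cos_ge:
  assumes "\<bar>x\<bar> \<le> pi" shows "x\<^sup>2 / 18 \<le> 1 - cos (x::real)"
proof -
  define u where "u = \<bar>x\<bar> / 2"
  have u: "0 \<le> u" "u \<le> 2" using assms pi_less_4 by (auto simp: u_def)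
  have "1 - cos x = 2 * (sin u)\<^sup>2"
    using cos_double_sin[of u] by (simp add: u_def)
  moreover have "u / 3 \<le> sin u"
  proof -
    have "u - u ^ 3 / 6 \<le> sin u" 
      using abs_sin_minus_le[of u] abs_ge_minus_self[of "sin u - u"] u by simp
    moreover have "u ^ 3 \<le> 4 * u"
    proof -
      have "u * u \<le> 2 * 2" using u by (intro mult_mono) auto
      then have "u * (u * u) \<le> u * 4" using u by (intro mult_left_mono) auto
      then show ?thesis by (simp add: power3_eq_cube mult.assoc mult.commute)
    qed
    ultimately show ?thesis by simp
  qed
  then have "(u / 3)\<^sup>2 \<le> (sin u)\<^sup>2" using u by (intro power_mono) auto
  moreover have "u\<^sup>2 = x\<^sup>2 / 4" by (simp add: u_def power_divide)
  ultimately show ?thesis by (simp add: power_divide)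
qed

text \<open>Compares the factor of one part size on the circle with its value on the real axis. In
  the modulus all terms of the logarithm series have one sign, so the first is a lower bound; the
  upper bound comes from |1 - W|^2 = (1 - Q)^2 + 2 Q (1 - cos a) and ln x \<le> x - 1. In the phase,
  sin (n a) is replaced by n a: the linear part sums to the mean, the cubic remainder to the
  error.\<close>

lemma Ln_factor_bounds:
  fixes Q a :: real
  assumes Q: "0 < Q" "Q < 1"
  defines "W \<equiv> of_real Q * cis a"
  shows "Q * (1 - cos a) \<le> Re (Ln (1 - W)) - ln (1 - Q)"
    and "Re (Ln (1 - W)) - ln (1 - Q) \<le> a\<^sup>2 / 2 * (Q / (1 - Q)\<^sup>2)"
    and "\<bar>Im (Ln (1 - W)) + a * (Q / (1 - Q))\<bar> \<le> \<bar>a\<bar> ^ 3 / 3 * (Q / (1 - Q) ^ 3)"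
proof -
  have nW: "norm W < 1" using Q by (simp add: W_def norm_mult)
  have Wn: "W ^ k = of_real (Q ^ k) * cis (real k * a)" for k
    by (simp add: W_def power_mult_distrib Complex.DeMoivre)
  have "(\<lambda>n. - (W ^ n) / of_nat n) sums Ln (1 - W)"
    using Ln_series'[of "-W"] nW by simp
  then have S: "(\<lambda>n. - (W ^ Suc n) / of_nat (Suc n)) sums Ln (1 - W)"
    using sums_Suc_iff[of "\<lambda>n. - (W ^ n) / of_nat n" "Ln (1 - W)"] by simp
  have R: "(\<lambda>n. - (Q ^ Suc n * cos (real (Suc n) * a)) / real (Suc n)) sums Re (Ln (1 - W))"
    using sums_Re[OF S] by (simp add: Wn Re_divide_of_nat del: of_nat_Suc power_Suc)
  have I: "(\<lambda>n. - (Q ^ Suc n * sin (real (Suc n) * a)) / real (Suc n)) sums Im (Ln (1 - W))"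
    using sums_Im[OF S] by (simp add: Wn Im_divide_of_nat del: of_nat_Suc power_Suc)
  have S0: "(\<lambda>n. - (Q ^ Suc n) / real (Suc n)) sums ln (1 - Q)"
  proof -
    have "(\<lambda>n. - (complex_of_real Q ^ n) / of_nat n) sums Ln (1 - of_real Q)"
      using Ln_series'[of "- of_real Q"] Q by simp
    then have "(\<lambda>n. - (complex_of_real Q ^ Suc n) / of_nat (Suc n)) sums Ln (1 - of_real Q)"
      using sums_Suc_iff[of "\<lambda>n. - (complex_of_real Q ^ n) / of_nat n" "Ln (1 - of_real Q)"] by simp
    moreover have "Ln (1 - of_real Q) = of_real (ln (1 - Q))"
      using Ln_of_real[of "1 - Q"] Q by simp
    ultimately have "(\<lambda>n. complex_of_real (- (Q ^ Suc n) / real (Suc n))) sums of_real (ln (1 - Q))"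
      by (simp del: of_nat_Suc power_Suc)
    then show ?thesis by (rule sums_of_real_iff[THEN iffD1])
  qed
  have "(\<lambda>n. Q ^ Suc n * (1 - cos (real (Suc n) * a)) / real (Suc n)) sums (Re (Ln (1 - W)) - ln (1 - Q))"
    using sums_diff[OF R S0] by (simp add: diff_divide_distrib right_diff_distrib del: of_nat_Suc power_Suc)
  note f = this
  have nn: "0 \<le> Q ^ Suc n * (1 - cos (real (Suc n) * a)) / real (Suc n)" for n
    using Q by (intro divide_nonneg_nonneg mult_nonneg_nonneg) auto
  have "(\<Sum>n<1. Q ^ Suc n * (1 - cos (real (Suc n) * a)) / real (Suc n)) \<le> Re (Ln (1 - W)) - ln (1 - Q)"
    unfolding sums_unique[OF f] by (intro sum_le_suminf sums_summable[OF f] nn) auto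
  then show "Q * (1 - cos a) \<le> Re (Ln (1 - W)) - ln (1 - Q)" by simp
  have nz: "1 - W \<noteq> 0" using nW by auto
  have sq: "(cmod (1 - W))\<^sup>2 = (1 - Q)\<^sup>2 + 2 * Q * (1 - cos a)"
  proof -
    have "(cmod (1 - W))\<^sup>2 = (1 - Q * cos a)\<^sup>2 + (Q * sin a)\<^sup>2"
      by (simp add: cmod_power2 W_def)
    also have "\<dots> = (1 - Q)\<^sup>2 + 2 * Q * (1 - cos a)"
      using sin_cos_squared_add[of a] by algebra
    finally show ?thesis .
  qed
  have "2 * (Re (Ln (1 - W)) - ln (1 - Q)) = ln ((cmod (1 - W))\<^sup>2) - ln ((1 - Q)\<^sup>2)"
    using nz Q by (simp add: Re_Ln ln_realpow)
  also have "\<dots> = ln ((cmod (1 - W))\<^sup>2 / (1 - Q)\<^sup>2)"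
    using nz Q by (subst ln_div) auto
  also have "\<dots> \<le> (cmod (1 - W))\<^sup>2 / (1 - Q)\<^sup>2 - 1"
    using nz Q by (intro ln_le_minus_one) auto
  also have "\<dots> = 2 * (Q / (1 - Q)\<^sup>2) * (1 - cos a)"
    using Q by (simp add: sq field_simps)
  also have "\<dots> \<le> 2 * (Q / (1 - Q)\<^sup>2) * (a\<^sup>2 / 2)"
    using Q one_minus_cos_le by (intro mult_left_mono) auto
  also have "\<dots> = 2 * (a\<^sup>2 / 2 * (Q / (1 - Q)\<^sup>2))" by simp
  finally show "Re (Ln (1 - W)) - ln (1 - Q) \<le> a\<^sup>2 / 2 * (Q / (1 - Q)\<^sup>2)"
    by (rule mult_left_le_imp_le) simp
  have G: "(\<lambda>n. a * Q ^ Suc n) sums (a * (Q / (1 - Q)))"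
    using sums_mult[OF geometric_sums[of Q], of "a * Q"] Q by (simp add: mult_ac)
  have D: "(\<lambda>n. - (Q ^ Suc n * sin (real (Suc n) * a)) / real (Suc n) + a * Q ^ Suc n) sums (Im (Ln (1 - W)) + a * (Q / (1 - Q)))"
    by (rule sums_add[OF I G])
  have B: "(\<lambda>n. \<bar>a\<bar> ^ 3 / 6 * Q * (real (Suc n) * real (Suc (Suc n)) * Q ^ n)) sums (\<bar>a\<bar> ^ 3 / 6 * Q * (2 / (1 - Q) ^ 3))"
    using Q by (intro sums_mult sums_Suc_times_Suc_Suc) auto
  have "norm (Im (Ln (1 - W)) + a * (Q / (1 - Q))) \<le> \<bar>a\<bar> ^ 3 / 6 * Q * (2 / (1 - Q) ^ 3)"
  proof (rule norm_sums_le[OF D B])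
    fix n
    let ?m = "real (Suc n)"
    have m: "0 < ?m" by simp
    have "- (Q ^ Suc n * sin (?m * a)) / ?m + a * Q ^ Suc n = - (Q ^ Suc n / ?m * (sin (?m * a) - ?m * a))"
      using m by (simp add: field_simps del: of_nat_Suc)
    then have "norm (- (Q ^ Suc n * sin (?m * a)) / ?m + a * Q ^ Suc n) = Q ^ Suc n / ?m * \<bar>sin (?m * a) - ?m * a\<bar>"
      using Q m by (simp add: abs_mult del: of_nat_Suc power_Suc)
    also have "\<dots> \<le> Q ^ Suc n / ?m * (\<bar>?m * a\<bar> ^ 3 / 6)"
      using Q m by (intro mult_left_mono abs_sin_minus_le) (auto simp del: of_nat_Suc)
    also have "\<dots> = \<bar>a\<bar> ^ 3 / 6 * Q * (?m * ?m * Q ^ n)"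
      using m by (simp add: abs_mult power_mult_distrib power3_eq_cube del: of_nat_Suc)
    also have "\<dots> \<le> \<bar>a\<bar> ^ 3 / 6 * Q * (?m * real (Suc (Suc n)) * Q ^ n)"
      using Q by (intro mult_left_mono mult_right_mono) auto
    finally show "norm (- (Q ^ Suc n * sin (?m * a)) / ?m + a * Q ^ Suc n) \<le> \<bar>a\<bar> ^ 3 / 6 * Q * (?m * real (Suc (Suc n)) * Q ^ n)" .
  qed
  then show "\<bar>Im (Ln (1 - W)) + a * (Q / (1 - Q))\<bar> \<le> \<bar>a\<bar> ^ 3 / 3 * (Q / (1 - Q) ^ 3)" by (simp add: mult.commute)
qed

text \<open>From u / (1 - exp (- u)) \<le> 1 + u \<le> 2 k exp (u / (2 k)): the k-th power uses up
  only half of the decay exp (- u), and the other half remains for the summation.\<close>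

lemma moment_term_le:
  assumes u: "0 < (u::real)" and k: "1 \<le> k"
  shows "u ^ k * (exp (- u) / (1 - exp (- u)) ^ k) \<le> (2 * real k) ^ k * exp (- (u / 2))"
proof -
  have pos: "0 < 1 - exp (- u)" using u by simp
  have "exp (- u) \<le> 1 / (1 + u)"
    using exp_ge_add_one_self[of u] u by (simp add: exp_minus field_simps)
  then have "u / (1 + u) \<le> 1 - exp (- u)" using u by (simp add: field_simps)
  then have "u \<le> (1 + u) * (1 - exp (- u))" using u by (simp add: field_simps)
  then have a: "u / (1 - exp (- u)) \<le> 1 + u" using pos by (simp add: pos_divide_le_eq)
  have "1 + u \<le> 2 * real k * (1 + u / (2 * real k))" using k by (simp add: distrib_left)
  also have "\<dots> \<le> 2 * real k * exp (u / (2 * real k))"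
    using k by (intro mult_left_mono exp_ge_add_one_self) auto
  finally have "u / (1 - exp (- u)) \<le> 2 * real k * exp (u / (2 * real k))" using a by simp
  then have "(u / (1 - exp (- u))) ^ k \<le> (2 * real k * exp (u / (2 * real k))) ^ k"
    using u pos by (intro power_mono) auto
  also have "\<dots> = (2 * real k) ^ k * exp (u / 2)"
    using k by (simp add: power_mult_distrib exp_of_nat_mult[symmetric])
  finally have "(u / (1 - exp (- u))) ^ k * exp (- u) \<le> (2 * real k) ^ k * exp (u / 2) * exp (- u)"
    by (intro mult_right_mono) auto
  moreover have "exp (u / 2) * exp (- u) = exp (- (u / 2))"
    unfolding exp_add[symmetric] by simp
  ultimately show ?thesis by (simp add: power_divide mult.assoc)
qed

text \<open>Let m = \<open>Suc n\<close> be the part size, whose multiplicity is geometric under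
  Boltzmann weights. Then k = 1 and k = 2 give the mean and the variance of the contribution of m to
  the size; k = 3 bounds the third-order phase error.\<close>

definition moment :: "nat \<Rightarrow> real \<Rightarrow> nat \<Rightarrow> real" where
  "moment k q n = real (Suc n) ^ k * (q ^ Suc n / (1 - q ^ Suc n) ^ k)"

lemma exp_half_sums:
  assumes "0 < (y::real)"
  shows "(\<lambda>n. exp (- (y * real (Suc n) / 2))) sums (1 / (exp (y / 2) - 1))"
proof -
  let ?r = "exp (- (y / 2))"
  have r: "?r < 1" using assms by simp
  have "(\<lambda>n. ?r * ?r ^ n) sums (?r * (1 / (1 - ?r)))"
    using r by (intro sums_mult geometric_sums) auto
  moreover have "?r * ?r ^ n = exp (- (y * real (Suc n) / 2))" for n
    by (simp add: exp_of_nat_mult[symmetric] exp_add[symmetric] algebra_simps)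
  moreover have "?r * (1 / (1 - ?r)) = 1 / (exp (y / 2) - 1)"
    using r by (simp add: exp_minus field_simps)
  ultimately show ?thesis by simp
qed

lemma moment_nonneg: "0 < y \<Longrightarrow> 0 \<le> moment k (exp (- y)) n"
proof -
  assume y: "0 < y"
  have "exp (- y) ^ Suc n \<le> 1" using y by (intro power_le_one) auto
  then show ?thesis unfolding moment_def by (intro mult_nonneg_nonneg divide_nonneg_nonneg zero_le_power) auto
qed

lemma moment_le:
  assumes y: "0 < y" and k: "1 \<le> k"
  shows "moment k (exp (- y)) n \<le> (2 * real k) ^ k / y ^ k * exp (- (y * real (Suc n) / 2))"
proof -
  have "y ^ k * moment k (exp (- y)) n = (y * real (Suc n)) ^ k * (exp (- (y * real (Suc n))) / (1 - exp (- (y * real (Suc n)))) ^ k)"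
    by (simp add: moment_def exp_of_nat_mult[symmetric] power_mult_distrib mult_ac del: power_Suc of_nat_Suc)
  also have "\<dots> \<le> (2 * real k) ^ k * exp (- (y * real (Suc n) / 2))"
    using y k by (intro moment_term_le) auto
  finally show ?thesis using y by (simp add: field_simps)
qed

lemma moment_sum:
  assumes y: "0 < y" and k: "1 \<le> k"
  shows "summable (moment k (exp (- y)))"
    and "(\<Sum>n. moment k (exp (- y)) n) \<le> 2 * (2 * real k) ^ k / y ^ Suc k"
proof -
  let ?B = "\<lambda>n. (2 * real k) ^ k / y ^ k * exp (- (y * real (Suc n) / 2))"
  have s: "?B sums ((2 * real k) ^ k / y ^ k * (1 / (exp (y / 2) - 1)))"
    by (intro sums_mult exp_half_sums y)
  note le = moment_le[OF y k] and nn = moment_nonneg[OF y]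
  show sm: "summable (moment k (exp (- y)))"
    by (rule summable_comparison_test'[OF sums_summable[OF s]]) (use le nn in auto)
  have "(\<Sum>n. moment k (exp (- y)) n) \<le> (\<Sum>n. ?B n)"
    by (rule suminf_le[OF le sm sums_summable[OF s]])
  also have "\<dots> = (2 * real k) ^ k / y ^ k * (1 / (exp (y / 2) - 1))" using s by (simp add: sums_iff)
  also have "\<dots> \<le> (2 * real k) ^ k / y ^ k * (2 / y)"
  proof (rule mult_left_mono)
    have "y / 2 \<le> exp (y / 2) - 1" using exp_ge_add_one_self[of "y / 2"] by linarith
    then have "1 / (exp (y / 2) - 1) \<le> 1 / (y / 2)" using y by (intro divide_left_mono mult_pos_pos) auto
    then show "1 / (exp (y / 2) - 1) \<le> 2 / y" by simp
    show "0 \<le> (2 * real k) ^ k / y ^ k" using y by simp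
  qed
  finally show "(\<Sum>n. moment k (exp (- y)) n) \<le> 2 * (2 * real k) ^ k / y ^ Suc k" by (simp add: mult_ac)
qed

text \<open>Under Boltzmann weights \<open>q ^ N\<close> the size of a random partition has mean \<open>mean_size q\<close>.\<close>
definition mean_size :: "real \<Rightarrow> real" where
  "mean_size q = (\<Sum>n. moment 1 q n)"

text \<open>D is the loss in modulus and E the deviation from the linear phase
  \<open>th * mean_size (exp (- y))\<close>, which the choice of y cancels at size N. The lower
  bound on D stays a series because it is evaluated exactly for large angles. The constants 16 and
  144 are 1/2 * 2 * 4^2 and 1/3 * 2 * 6^3, from \<open>moment_sum\<close>.\<close>

lemma pgf_polar:
  fixes y :: real
  assumes y: "0 < y"
  obtains D E where "pgf (of_real (exp (- y)) * cis th) = of_real (pgf (exp (- y)) * exp (- D)) * cis (th * mean_size (exp (- y)) - E)"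
    "(\<Sum>n. exp (- y) ^ Suc n * (1 - cos (real (Suc n) * th))) \<le> D"
    "D \<le> 16 * th\<^sup>2 / y ^ 3" "\<bar>E\<bar> \<le> 144 * \<bar>th\<bar> ^ 3 / y ^ 4"
proof -
  define q where "q = exp (- y)"
  have q: "0 < q" "q < 1" using y by (auto simp: q_def)
  let ?z = "of_real q * cis th"
  let ?Q = "\<lambda>n. q ^ Suc n"
  let ?a = "\<lambda>n. real (Suc n) * th"
  have Q: "0 < ?Q n" "?Q n < 1" for n using q power_Suc_less_one[of q n] by auto
  have W: "?z ^ Suc n = of_real (?Q n) * cis (?a n)" for n
    by (simp add: power_mult_distrib Complex.DeMoivre del: power_Suc of_nat_Suc)
  note bnd = Ln_factor_bounds[OF Q]
  let ?L = "\<lambda>n. Ln (1 - of_real (?Q n) * cis (?a n))"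
  have nz: "norm ?z < 1" using q by (simp add: norm_mult)
  have sL: "summable ?L" using summable_Ln[OF nz] by (simp only: W)
  have sl: "summable (\<lambda>n. ln (1 - ?Q n))" using summable_ln_real[of q] q by simp
  define d where "d n = Re (?L n) - ln (1 - ?Q n)" for n
  define e where "e n = Im (?L n) + ?a n * (?Q n / (1 - ?Q n))" for n
  have sd: "summable d" unfolding d_def by (intro summable_diff summable_Re sL sl)
  have m1: "?a n * (?Q n / (1 - ?Q n)) = th * moment 1 q n" for n by (simp add: moment_def)
  have sm: "summable (moment k q)" if "1 \<le> k" for k using moment_sum(1)[OF y that] by (simp add: q_def)
  have se: "summable e" unfolding e_def m1 by (intro summable_add summable_Im sL summable_mult sm) auto
  have sumd: "suminf d = (\<Sum>n. Re (?L n)) - (\<Sum>n. ln (1 - ?Q n))"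
    unfolding d_def by (rule suminf_diff[symmetric, OF summable_Re[OF sL] sl])
  have "suminf e = (\<Sum>n. Im (?L n)) + (\<Sum>n. th * moment 1 q n)"
    unfolding e_def m1 by (rule suminf_add[symmetric]) (intro summable_Im sL summable_mult sm; simp)+
  then have sume: "suminf e = (\<Sum>n. Im (?L n)) + th * mean_size q"
    unfolding mean_size_def using suminf_mult[OF sm[of 1]] by simp
  have ReL: "Re (suminf ?L) = suminf d + (\<Sum>n. ln (1 - ?Q n))"
    and ImL: "Im (suminf ?L) = suminf e - th * mean_size q"
    using sumd sume Re_suminf[OF sL] Im_suminf[OF sL] by simp_all
  have "pgf ?z = exp (- suminf ?L)" using pgf_eq_exp[OF nz] by (simp only: W)
  also have "\<dots> = of_real (exp (Re (- suminf ?L))) * cis (Im (- suminf ?L))"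
    by (simp add: exp_eq_polar)
  also have "exp (Re (- suminf ?L)) = pgf q * exp (- suminf d)"
  proof -
    have "pgf q = exp (- (\<Sum>n. ln (1 - q ^ Suc n)))" using pgf_real_eq_exp[of q] q by simp
    then show ?thesis unfolding uminus_complex.sel ReL minus_add_distrib exp_add by simp
  qed
  also have "Im (- suminf ?L) = th * mean_size q - suminf e"
    unfolding uminus_complex.sel ImL by simp
  finally have 1: "pgf ?z = of_real (pgf q * exp (- suminf d)) * cis (th * mean_size q - suminf e)" .
  have 2: "(\<Sum>n. ?Q n * (1 - cos (?a n))) \<le> suminf d"
  proof (rule suminf_le)
    show le: "?Q n * (1 - cos (?a n)) \<le> d n" for n unfolding d_def by (rule bnd(1))
    show "summable (\<lambda>n. ?Q n * (1 - cos (?a n)))"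
      by (rule summable_comparison_test'[OF sd, of 0])
        (use le q in \<open>auto simp: abs_mult simp del: power_Suc of_nat_Suc\<close>)
  qed (rule sd)
  have "suminf d \<le> (\<Sum>n. th\<^sup>2 / 2 * moment 2 q n)"
  proof (rule suminf_le)
    show "d n \<le> th\<^sup>2 / 2 * moment 2 q n" for n
      using bnd(2)[of n "?a n"] unfolding d_def by (simp add: moment_def power_mult_distrib mult_ac del: power_Suc of_nat_Suc)
    show "summable (\<lambda>n. th\<^sup>2 / 2 * moment 2 q n)" by (intro summable_mult sm) simp
  qed (rule sd)
  also have "\<dots> = th\<^sup>2 / 2 * suminf (moment 2 q)" by (rule suminf_mult) (simp add: sm)
  also have "\<dots> \<le> th\<^sup>2 / 2 * (2 * (2 * real 2) ^ 2 / y ^ Suc 2)"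
    using moment_sum(2)[OF y, of 2] unfolding q_def by (intro mult_left_mono) auto
  finally have 3: "suminf d \<le> 16 * th\<^sup>2 / y ^ 3" by (simp add: eval_nat_numeral)
  have "norm (suminf e) \<le> (\<Sum>n. \<bar>th\<bar> ^ 3 / 3 * moment 3 q n)"
  proof (rule norm_sums_le)
    show "e sums suminf e" using se by (rule summable_sums)
    show "(\<lambda>n. \<bar>th\<bar> ^ 3 / 3 * moment 3 q n) sums (\<Sum>n. \<bar>th\<bar> ^ 3 / 3 * moment 3 q n)"
      by (intro summable_sums summable_mult sm) simp
    show "norm (e n) \<le> \<bar>th\<bar> ^ 3 / 3 * moment 3 q n" for n
      using bnd(3)[of n "?a n"] unfolding e_def by (simp add: moment_def power_mult_distrib abs_mult mult_ac del: power_Suc of_nat_Suc)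
  qed
  also have "\<dots> = \<bar>th\<bar> ^ 3 / 3 * suminf (moment 3 q)" by (rule suminf_mult) (simp add: sm)
  also have "\<dots> \<le> \<bar>th\<bar> ^ 3 / 3 * (2 * (2 * real 3) ^ 3 / y ^ Suc 3)"
    using moment_sum(2)[OF y, of 3] unfolding q_def by (intro mult_left_mono) auto
  finally have 4: "\<bar>suminf e\<bar> \<le> 144 * \<bar>th\<bar> ^ 3 / y ^ 4" by (simp add: eval_nat_numeral)
  show thesis by (rule that[of "suminf d" "suminf e"]) (use 1 2 3 4 in \<open>simp_all only: q_def\<close>)
qed

section \<open>The saddle point\<close>

text \<open>Dropping the denominators of the moments leaves q / (1 - q)^2, where q is at least
  1/3.\<close>

lemma mean_size_ge:
  assumes y: "0 < y" "y \<le> 1"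
  shows "1 / (3 * y\<^sup>2) \<le> mean_size (exp (- y))"
proof -
  let ?q = "exp (- y)"
  have q: "0 < ?q" "?q < 1" using y by auto
  have s: "(\<lambda>n. ?q * (real (Suc n) * ?q ^ n)) sums (?q * (1 / (1 - ?q)\<^sup>2))"
    using geometric_deriv_sums[of ?q] q by (intro sums_mult) simp
  have "?q * (1 / (1 - ?q)\<^sup>2) = (\<Sum>n. ?q * (real (Suc n) * ?q ^ n))"
    using s by (simp add: sums_iff)
  also have "\<dots> \<le> mean_size ?q"
    unfolding mean_size_def
  proof (rule suminf_le)
    show "?q * (real (Suc n) * ?q ^ n) \<le> moment 1 ?q n" for n
    proof -
      have "?q ^ Suc n < 1" using power_Suc_less_one[of ?q n] q by auto
      then have "?q ^ Suc n / 1 \<le> ?q ^ Suc n / (1 - ?q ^ Suc n)"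
        using q by (intro divide_left_mono) auto
      then have "real (Suc n) * ?q ^ Suc n \<le> real (Suc n) * (?q ^ Suc n / (1 - ?q ^ Suc n))"
        by (intro mult_left_mono) auto
      then show ?thesis by (simp add: moment_def mult_ac)
    qed
  qed (use sums_summable[OF s] moment_sum(1)[of y 1] y in auto)
  finally have 1: "?q * (1 / (1 - ?q)\<^sup>2) \<le> mean_size ?q" .
  have "exp y \<le> 3" using exp_le y by (meson exp_le_cancel_iff order_trans)
  then have q3: "1 / 3 \<le> ?q" by (simp add: exp_minus field_simps)
  have "1 - ?q \<le> y" using exp_ge_add_one_self[of "- y"] by linarith
  then have "(1 - ?q)\<^sup>2 \<le> y\<^sup>2" using q by (intro power_mono) auto
  then have "1 / y\<^sup>2 \<le> 1 / (1 - ?q)\<^sup>2" using y q by (intro divide_left_mono) auto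
  then have "1 / 3 * (1 / y\<^sup>2) \<le> ?q * (1 / (1 - ?q)\<^sup>2)"
    using q3 by (intro mult_mono) auto
  then show ?thesis using 1 by simp
qed

lemma continuous_mean_size:
  assumes a: "0 < a"
  shows "continuous_on {a..b} (\<lambda>y. mean_size (exp (- y)))"
proof -
  let ?M = "\<lambda>n. 2 / a * exp (- (a * real (Suc n) / 2))"
  have "uniform_limit {a..b} (\<lambda>n y. \<Sum>i<n. moment 1 (exp (- y)) i) (\<lambda>y. \<Sum>i. moment 1 (exp (- y)) i) sequentially"
  proof (rule Weierstrass_m_test)
    show "summable ?M" using exp_half_sums[OF a] by (intro summable_mult) (rule sums_summable)
    fix n y assume "y \<in> {a..b}"
    then have y: "a \<le> y" "0 < y" using a by auto
    have "moment 1 (exp (- y)) n \<le> 2 / y * exp (- (y * real (Suc n) / 2))"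
      using moment_le[of y 1 n] y by simp
    also have "\<dots> \<le> ?M n"
      using y a by (intro mult_mono divide_left_mono) (auto intro!: mult_right_mono)
    finally show "norm (moment 1 (exp (- y)) n) \<le> ?M n"
      using moment_nonneg[of y 1 n] y by simp
  qed
  moreover have "continuous_on {a..b} (\<lambda>y. moment 1 (exp (- y)) i)" for i
  proof -
    have "exp (- y) ^ Suc i \<noteq> 1" if "y \<in> {a..b}" for y
      using that a power_Suc_less_one[of "exp (- y)" i] by auto
    then show ?thesis unfolding moment_def by (intro continuous_intros) auto
  qed
  then have "\<forall>\<^sub>F n in sequentially. continuous_on {a..b} (\<lambda>y. \<Sum>i<n. moment 1 (exp (- y)) i)"
    by (intro always_eventually allI continuous_intros)
  ultimately show ?thesis
    unfolding mean_size_def by (intro uniform_limit_theorem) auto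
qed

text \<open>The mean is continuous in y, at least N at y = 1 / sqrt (3 N) by
  \<open>mean_size_ge\<close>, and at most 4 at y = 1 by \<open>moment_sum\<close>.\<close>

lemma exists_saddle_point:
  assumes N: "5 \<le> (N::nat)"
  obtains y where "0 < y" "y \<le> 1" "mean_size (exp (- y)) = real N" "1 / (3 * real N) \<le> y\<^sup>2" "y\<^sup>2 \<le> 4 / real N"
proof -
  define a where "a = 1 / sqrt (3 * real N)"
  have N0: "0 < real N" using N by simp
  have a2: "a\<^sup>2 = 1 / (3 * real N)" using N0 by (simp add: a_def power_divide)
  have a: "0 < a" using N0 by (simp add: a_def)
  have "1 \<le> sqrt (3 * real N)" using N by simp
  then have a1: "a \<le> 1" by (simp add: a_def)
  have "real N \<le> mean_size (exp (- a))"
    using mean_size_ge[OF a a1] N0 by (simp add: a2)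
  moreover have "mean_size (exp (- 1)) \<le> real N"
    using moment_sum(2)[of 1 1] N by (simp add: mean_size_def)
  ultimately obtain y where y: "a \<le> y" "y \<le> 1" "mean_size (exp (- y)) = real N"
    using IVT2'[of "\<lambda>y. mean_size (exp (- y))" 1 "real N" a] a1 continuous_mean_size[OF a, of 1] by auto
  have y0: "0 < y" using a y by simp
  have "real N \<le> 4 / y\<^sup>2"
    using moment_sum(2)[OF y0, of 1] y(3) by (simp add: mean_size_def power2_eq_square)
  then have "y\<^sup>2 \<le> 4 / real N" using y0 N0 by (simp add: field_simps)
  moreover have "a\<^sup>2 \<le> y\<^sup>2" using a y by (intro power_mono) auto
  ultimately show thesis using that[of y] y y0 a2 by simp
qed

text \<open>The difference of two geometric series, in closed form. Quadratic bounds are useful only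
  for angles of order y, whereas decay is needed for all angles up to pi.\<close>

lemma suminf_one_minus_cos:
  assumes q: "0 < q" "q < (1::real)"
  shows "(\<Sum>n. q ^ Suc n * (1 - cos (real (Suc n) * th))) =
    q * (1 + q) * (1 - cos th) / ((1 - q) * ((1 - q)\<^sup>2 + 2 * q * (1 - cos th)))"
proof -
  let ?z = "of_real q * cis th"
  have nz: "norm ?z < 1" using q by (simp add: norm_mult)
  have "(\<lambda>n. ?z * ?z ^ n) sums (?z * (1 / (1 - ?z)))"
    by (intro sums_mult geometric_sums nz)
  moreover have "?z * ?z ^ n = of_real (q ^ Suc n) * cis (real (Suc n) * th)" for n
    by (simp add: power_mult_distrib Complex.DeMoivre cis_mult distrib_right add.commute)
  ultimately have "(\<lambda>n. of_real (q ^ Suc n) * cis (real (Suc n) * th)) sums (?z * (1 / (1 - ?z)))" by simp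
  then have 1: "(\<lambda>n. q ^ Suc n * cos (real (Suc n) * th)) sums Re (?z * (1 / (1 - ?z)))"
    using sums_Re by fastforce
  have 2: "(\<lambda>n. q ^ Suc n) sums (q * (1 / (1 - q)))"
    using sums_mult[OF geometric_sums[of q], of q] q by simp
  have "(\<lambda>n. q ^ Suc n * (1 - cos (real (Suc n) * th))) sums (q * (1 / (1 - q)) - Re (?z * (1 / (1 - ?z))))"
    using sums_diff[OF 2 1] by (simp add: right_diff_distrib)
  then have S: "(\<Sum>n. q ^ Suc n * (1 - cos (real (Suc n) * th))) = q * (1 / (1 - q)) - Re (?z * (1 / (1 - ?z)))"
    by (rule sums_unique[symmetric])
  have nz1: "1 - ?z \<noteq> 0" using nz by auto
  let ?D = "(1 - q)\<^sup>2 + 2 * q * (1 - cos th)"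
  have D0: "0 < ?D" using q by (intro add_pos_nonneg mult_nonneg_nonneg) auto
  have sq: "(Re (1 - ?z))\<^sup>2 + (Im (1 - ?z))\<^sup>2 = ?D"
  proof -
    have "(Re (1 - ?z))\<^sup>2 + (Im (1 - ?z))\<^sup>2 = (1 - q * cos th)\<^sup>2 + (q * sin th)\<^sup>2" by simp
    also have "\<dots> = ?D" using sin_cos_squared_add[of th] by algebra
    finally show ?thesis .
  qed
  have "?z * (1 / (1 - ?z)) = 1 / (1 - ?z) - 1" using nz1 by (simp add: field_simps)
  then have "Re (?z * (1 / (1 - ?z))) = Re (1 / (1 - ?z)) - 1" by simp
  also have "Re (1 / (1 - ?z)) = (1 - q * cos th) / ?D"
    unfolding Re_divide sq by simp
  finally have R: "Re (?z * (1 / (1 - ?z))) = (1 - q * cos th) / ?D - 1" .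
  have "q * (1 / (1 - q)) - ((1 - q * cos th) / ?D - 1) = 1 / (1 - q) - (1 - q * cos th) / ?D"
    using q by (simp add: field_simps)
  also have "\<dots> = (?D - (1 - q * cos th) * (1 - q)) / ((1 - q) * ?D)"
    using q D0 by (simp add: diff_frac_eq)
  also have "?D - (1 - q * cos th) * (1 - q) = q * (1 + q) * (1 - cos th)" by algebra
  finally show ?thesis using S R by simp
qed

text \<open>Up to angles of order y the closed form behaves like th^2 / y^3, beyond that like 1 / y;
  adding the two exponentials covers both cases. The bound q (1 + q) \<ge> 4/9 and the factor 20 in
  the comparison with v give 1/45, rounded to 1/50.\<close>

lemma norm_pgf_le:
  assumes y: "0 < y" "y \<le> 1" and th: "\<bar>th\<bar> \<le> pi"
  shows "norm (pgf (of_real (exp (- y)) * cis th)) \<le>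
    pgf (exp (- y)) * (exp (- (th\<^sup>2 / (50 * y ^ 3))) + exp (- (1 / (50 * y))))"
proof -
  obtain D E where pol: "pgf (of_real (exp (- y)) * cis th) = of_real (pgf (exp (- y)) * exp (- D)) * cis (th * mean_size (exp (- y)) - E)"
    and D: "(\<Sum>n. exp (- y) ^ Suc n * (1 - cos (real (Suc n) * th))) \<le> D"
    and "D \<le> 16 * th\<^sup>2 / y ^ 3" "\<bar>E\<bar> \<le> 144 * \<bar>th\<bar> ^ 3 / y ^ 4"
    by (rule pgf_polar[OF y(1), of th])
  define q v where "q = exp (- y)" and "v = 1 - cos th"
  have q: "0 < q" "q < 1" using y by (auto simp: q_def)
  have "exp y \<le> 3" using exp_le y by (meson exp_le_cancel_iff order_trans)
  then have q3: "1 / 3 \<le> q" by (simp add: q_def exp_minus field_simps)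
  have w: "1 - q \<le> y" using exp_ge_add_one_self[of "- y"] by (simp add: q_def)
  have v: "th\<^sup>2 \<le> 18 * v" "0 \<le> v" using one_minus_cos_ge[OF th] by (auto simp: v_def)
  have S: "q * (1 + q) * v / ((1 - q) * ((1 - q)\<^sup>2 + 2 * q * v)) \<le> D"
    using D suminf_one_minus_cos[OF q, of th] by (simp add: q_def v_def)
  have W0: "0 < y\<^sup>2 + 2 * v" using y v by (intro add_pos_nonneg) auto
  have A0: "0 < 20 * y\<^sup>2" using y by simp
  have "4 / 9 * v / (y * (y\<^sup>2 + 2 * v)) \<le> q * (1 + q) * v / ((1 - q) * ((1 - q)\<^sup>2 + 2 * q * v))"
  proof (rule frac_le)
    have "1 / 3 * (4 / 3) \<le> q * (1 + q)" using q3 by (intro mult_mono) auto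
    then show "4 / 9 * v \<le> q * (1 + q) * v" using v by (intro mult_right_mono) auto
    show "0 \<le> q * (1 + q) * v" using q v by simp
    show "0 < (1 - q) * ((1 - q)\<^sup>2 + 2 * q * v)" using q v by (intro mult_pos_pos add_pos_nonneg) auto
    have "q * v \<le> 1 * v" using q v by (intro mult_right_mono) auto
    moreover have "(1 - q)\<^sup>2 \<le> y\<^sup>2" using w q by (intro power_mono) auto
    ultimately show "(1 - q) * ((1 - q)\<^sup>2 + 2 * q * v) \<le> y * (y\<^sup>2 + 2 * v)"
      using w q v y by (intro mult_mono add_mono) (auto intro!: add_nonneg_nonneg)
  qed
  then have D1: "4 / 9 * v / (y * (y\<^sup>2 + 2 * v)) \<le> D" using S by linarith
  have "exp (- D) \<le> exp (- (th\<^sup>2 / (50 * y ^ 3))) + exp (- (1 / (50 * y)))"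
  proof (cases "th\<^sup>2 \<le> y\<^sup>2")
    case True
    have "th\<^sup>2 * (y\<^sup>2 + 2 * v) \<le> v * (20 * y\<^sup>2)"
    proof -
      have "th\<^sup>2 * y\<^sup>2 \<le> (18 * v) * y\<^sup>2" using v by (intro mult_right_mono) auto
      moreover have "th\<^sup>2 * v \<le> y\<^sup>2 * v" using True v by (intro mult_right_mono) auto
      ultimately show ?thesis by (simp add: algebra_simps)
    qed
    then have "th\<^sup>2 / (20 * y\<^sup>2) \<le> v / (y\<^sup>2 + 2 * v)"
      by (simp only: pos_divide_le_eq[OF A0] times_divide_eq_left pos_le_divide_eq[OF W0])
    then have "4 / 9 * (th\<^sup>2 / (20 * y\<^sup>2)) / y \<le> 4 / 9 * (v / (y\<^sup>2 + 2 * v)) / y"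
      using y by (intro divide_right_mono mult_left_mono) auto
    then have "th\<^sup>2 / (45 * y ^ 3) \<le> D" using D1 by (simp add: power3_eq_cube power2_eq_square mult_ac)
    moreover have "th\<^sup>2 / (50 * y ^ 3) \<le> th\<^sup>2 / (45 * y ^ 3)"
      using y by (intro divide_left_mono) auto
    ultimately have "exp (- D) \<le> exp (- (th\<^sup>2 / (50 * y ^ 3)))" by simp
    then show ?thesis by (simp add: add_increasing2)
  next
    case False
    then have "y\<^sup>2 \<le> 18 * v" using v by simp
    then have "1 / 20 * (y\<^sup>2 + 2 * v) \<le> v" by (simp add: field_simps)
    then have "1 / 20 \<le> v / (y\<^sup>2 + 2 * v)"
      by (simp only: pos_le_divide_eq[OF W0])
    then have "4 / 9 * (1 / 20) / y \<le> 4 / 9 * (v / (y\<^sup>2 + 2 * v)) / y"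
      using y by (intro divide_right_mono mult_left_mono) auto
    then have "1 / (45 * y) \<le> D" using D1 by (simp add: mult_ac)
    moreover have "1 / (50 * y) \<le> 1 / (45 * y)"
      using y by (intro divide_left_mono) auto
    ultimately have "exp (- D) \<le> exp (- (1 / (50 * y)))" by simp
    then show ?thesis by (simp add: add_increasing)
  qed
  moreover have "0 < pgf (exp (- y))" using pgf_real_eq_exp[of "exp (- y)"] y by simp
  ultimately show ?thesis unfolding pol by (simp add: norm_mult)
qed

section \<open>Partition numbers as Fourier coefficients\<close>

lemma cis_has_integral:
  "((\<lambda>th. cis (of_int j * th)) has_integral (if j = 0 then of_real (2 * pi) else 0)) {-pi..pi}"
proof (cases "j = 0")
  case True
  then show ?thesis using has_integral_const_real[of "1::complex" "-pi" pi]
    by (simp add: scaleR_conv_of_real)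
next
  case False
  define c where "c = complex_of_real (of_int j)"
  have c: "c \<noteq> 0" using False by (simp add: c_def)
  let ?F = "\<lambda>th. cis (of_int j * th) / (\<i> * c)"
  have "((\<lambda>th. cis (of_int j * th)) has_integral (?F pi - ?F (-pi))) {-pi..pi}"
  proof (rule fundamental_theorem_of_calculus)
    fix x
    have "((\<lambda>z. exp (\<i> * c * z) / (\<i> * c)) has_field_derivative exp (\<i> * c * of_real x)) (at (of_real x))"
      by (auto intro!: derivative_eq_intros simp: c)
    then have "((\<lambda>th. exp (\<i> * c * of_real th) / (\<i> * c)) has_vector_derivative exp (\<i> * c * of_real x)) (at x within {-pi..pi})"
      by (rule has_vector_derivative_real_field)
    then show "(?F has_vector_derivative cis (of_int j * x)) (at x within {-pi..pi})"
      by (simp add: cis_conv_exp c_def mult.assoc)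
  qed simp
  moreover have "cis (of_int j * pi) = cis (of_int j * (- pi))"
    using sin_zero_iff_int2 by (auto simp: complex_eq_iff)
  ultimately show ?thesis using False by simp
qed

text \<open>The size m ranges over the integers so that negative sizes get the coefficient 0;
  \<open>pd N j\<close> with j > N is then covered by the same estimates.\<close>

lemma pgf_fourier:
  fixes q :: real and m :: int
  assumes q: "0 < q" "q < 1"
  shows "((\<lambda>th. pgf (of_real q * cis th) * cis (- (of_int m * th))) has_integral
    of_real (2 * pi * (if 0 \<le> m then real (num_partitions (nat m)) * q ^ nat m else 0))) {-pi..pi}"
proof -
  let ?c = "\<lambda>n. real (num_partitions n) * q ^ n"
  let ?t = "\<lambda>n th. of_real (?c n) * cis (of_int (int n - m) * th)"
  let ?f = "\<lambda>K th. \<Sum>n<K. ?t n th"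
  let ?g = "\<lambda>th. pgf (of_real q * cis th) * cis (- (of_int m * th))"
  have "uniform_limit {-pi..pi} ?f (\<lambda>th. \<Sum>n. ?t n th) sequentially"
    by (rule Weierstrass_m_test[of _ _ ?c])
      (use q summable_partitions_real[of q] in \<open>auto simp: norm_mult norm_power\<close>)
  moreover have "(\<Sum>n. ?t n th) = ?g th" for th
  proof -
    have "norm (of_real q * cis th) < 1" using q by (simp add: norm_mult)
    from sums_mult2[OF pgf_sums[OF this], of "cis (- (of_int m * th))"]
    have "(\<lambda>n. of_nat (num_partitions n) * (of_real q * cis th) ^ n * cis (- (of_int m * th))) sums ?g th" .
    moreover have "of_nat (num_partitions n) * (of_real q * cis th) ^ n * cis (- (of_int m * th)) = ?t n th" for n
      by (simp add: power_mult_distrib Complex.DeMoivre mult.assoc cis_mult left_diff_distrib)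
    ultimately show ?thesis by (simp add: sums_iff)
  qed
  ultimately have ul: "uniform_limit {-pi..pi} ?f ?g sequentially" by simp
  have cont: "continuous_on {-pi..pi} (?f K)" for K by (intro continuous_intros)
  obtain I J where I: "\<And>K. (?f K has_integral I K) {-pi..pi}" and J: "(?g has_integral J) {-pi..pi}"
    and lim: "I \<longlonglongrightarrow> J"
    using uniform_limit_integral[OF ul cont] by auto
  let ?v = "\<lambda>n. of_real (?c n) * (if int n - m = 0 then complex_of_real (2 * pi) else 0)"
  have "(?f K has_integral (\<Sum>n<K. ?v n)) {-pi..pi}" for K
    by (intro has_integral_sum has_integral_mult_right cis_has_integral) simp
  then have IK: "I K = (\<Sum>n<K. ?v n)" for K using I has_integral_unique by blast
  let ?J = "complex_of_real (2 * pi * (if 0 \<le> m then ?c (nat m) else 0))"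
  have "I K = ?J" if "nat m < K" for K
  proof (cases "0 \<le> m")
    case True
    have "(\<Sum>n<K. ?v n) = (\<Sum>n\<in>{nat m}. ?v n)"
      using True that by (intro sum.mono_neutral_right) auto
    then show ?thesis using True by (simp add: IK)
  next
    case False
    then have "?v n = 0" for n by simp
    then show ?thesis using False by (simp add: IK)
  qed
  then have "I \<longlonglongrightarrow> ?J"
    by (intro tendsto_eventually eventually_mono[OF eventually_gt_at_top[of "nat m"]])
  then have "J = ?J" using lim LIMSEQ_unique by blast
  then show ?thesis using J by simp
qed

section \<open>Local behaviour of the partition numbers\<close>

lemma abs_times_gaussian_integral:
  assumes a: "0 < (a::real)"
  shows "((\<lambda>x. \<bar>x\<bar> * exp (- (a * x\<^sup>2))) has_integral ((1 - exp (- (a * pi\<^sup>2))) / a)) {-pi..pi}"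
proof -
  have 1: "((\<lambda>x. x * exp (- (a * x\<^sup>2))) has_integral (- exp (- (a * pi\<^sup>2)) / (2 * a) - (- exp (- (a * 0\<^sup>2)) / (2 * a)))) {0..pi}"
    by (rule fundamental_theorem_of_calculus)
      (use a in \<open>auto intro!: derivative_eq_intros simp: has_real_derivative_iff_has_vector_derivative[symmetric]\<close>)
  have 2: "((\<lambda>x. - x * exp (- (a * x\<^sup>2))) has_integral (exp (- (a * 0\<^sup>2)) / (2 * a) - exp (- (a * (- pi)\<^sup>2)) / (2 * a))) {-pi..0}"
    by (rule fundamental_theorem_of_calculus)
      (use a in \<open>auto intro!: derivative_eq_intros simp: has_real_derivative_iff_has_vector_derivative[symmetric]\<close>)
  have i1: "((\<lambda>x. \<bar>x\<bar> * exp (- (a * x\<^sup>2))) has_integral ((1 - exp (- (a * pi\<^sup>2))) / (2 * a))) {0..pi}"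
    by (rule has_integral_eq[of _ "\<lambda>x. x * exp (- (a * x\<^sup>2))"]) (use 1 in \<open>auto simp: diff_divide_distrib\<close>)
  have i2: "((\<lambda>x. \<bar>x\<bar> * exp (- (a * x\<^sup>2))) has_integral ((1 - exp (- (a * pi\<^sup>2))) / (2 * a))) {-pi..0}"
    by (rule has_integral_eq[of _ "\<lambda>x. - x * exp (- (a * x\<^sup>2))"]) (use 2 in \<open>auto simp: diff_divide_distrib\<close>)
  show ?thesis
    using has_integral_combine[OF _ _ i2 i1] by simp
qed

lemma norm_cis_diff_le: "norm (cis a - cis b) \<le> \<bar>a - b\<bar>"
proof -
  have "(norm (cis a - cis b))\<^sup>2 = 2 * (1 - cos (a - b))"
  proof -
    have "(norm (cis a - cis b))\<^sup>2 = (cos a - cos b)\<^sup>2 + (sin a - sin b)\<^sup>2"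
      by (simp add: cmod_power2)
    also have "\<dots> = 2 * (1 - (cos a * cos b + sin a * sin b))"
      using sin_cos_squared_add[of a] sin_cos_squared_add[of b] by algebra
    finally show ?thesis by (simp add: cos_diff)
  qed
  also have "\<dots> \<le> (a - b)\<^sup>2" using one_minus_cos_le[of "a - b"] by simp
  finally have "(norm (cis a - cis b))\<^sup>2 \<le> \<bar>a - b\<bar>\<^sup>2" by simp
  then show ?thesis by (rule power2_le_imp_le) simp
qed

lemma exp_neg_inverse_le:
  assumes "0 < (x::real)" shows "exp (- (1 / x)) \<le> 27 * x ^ 3"
proof -
  have "(1 / (3 * x)) ^ 3 \<le> (1 + (1 / x) / real 3) ^ 3"
    using assms by (intro power_mono) auto
  also have "\<dots> \<le> exp (1 / x)"
    using assms by (intro exp_ge_one_plus_x_over_n_power_n) (auto intro: order_trans[of _ 0])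
  finally show ?thesis using assms by (simp add: exp_minus field_simps power_mult_distrib)
qed

text \<open>The probability that the Boltzmann distribution with parameter \<open>y\<close> gives size \<open>m\<close>.\<close>
definition boltz :: "real \<Rightarrow> int \<Rightarrow> real" where
  "boltz y m = (if 0 \<le> m then real (num_partitions (nat m)) * exp (- y) ^ nat m else 0) / pgf (exp (- y))"

lemma pgf_pos: "0 < y \<Longrightarrow> 0 < pgf (exp (- y) :: real)"
  using pgf_real_eq_exp[of "exp (- y)"] by simp

lemma boltz_fourier:
  assumes y: "0 < y"
  shows "((\<lambda>th. pgf (of_real (exp (- y)) * cis th) / of_real (pgf (exp (- y))) * cis (- (of_int m * th)))
    has_integral of_real (2 * pi * boltz y m)) {-pi..pi}"
proof -
  have q: "0 < exp (- y)" "exp (- y) < 1" using y by auto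
  have "((\<lambda>th. pgf (of_real (exp (- y)) * cis th) * cis (- (of_int m * th)) / of_real (pgf (exp (- y))))
    has_integral of_real (2 * pi * (if 0 \<le> m then real (num_partitions (nat m)) * exp (- y) ^ nat m else 0)) / of_real (pgf (exp (- y)))) {-pi..pi}"
    by (rule has_integral_divide[OF pgf_fourier[OF q]])
  then show ?thesis unfolding boltz_def by (simp only: of_real_divide[symmetric] times_divide_eq_left times_divide_eq_right)
qed

text \<open>The exponential factors for m and m' differ by at most |m - m'| |th|, and the integral
  of |th| against a Gaussian of width y^(3/2) is of order y^3. The other term of
  \<open>norm_pgf_le\<close> is brought to order y^3 by \<open>exp_neg_inverse_le\<close>, which
  produces the large constant.\<close>

lemma boltz_lipschitz:
  assumes y: "0 < y" "y \<le> 1"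
  shows "\<bar>boltz y m - boltz y m'\<bar> \<le> 120000000 * y ^ 3 * \<bar>real_of_int (m - m')\<bar>"
proof -
  let ?d = "\<bar>real_of_int (m - m')\<bar>"
  let ?P = "\<lambda>th. pgf (of_real (exp (- y)) * cis th) / of_real (pgf (exp (- y)))"
  let ?f = "\<lambda>th. ?P th * cis (- (of_int m * th)) - ?P th * cis (- (of_int m' * th))"
  define a where "a = 1 / (50 * y ^ 3)"
  define e where "e = exp (- (1 / (50 * y)))"
  have a: "0 < a" using y by (simp add: a_def)
  let ?g = "\<lambda>th. ?d * (\<bar>th\<bar> * exp (- (a * th\<^sup>2)) + 4 * e)"
  have f: "(?f has_integral (of_real (2 * pi * boltz y m) - of_real (2 * pi * boltz y m'))) {-pi..pi}"
    by (intro has_integral_diff boltz_fourier y)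
  have g: "(?g has_integral ?d * ((1 - exp (- (a * pi\<^sup>2))) / a + 4 * e * (2 * pi))) {-pi..pi}"
    using has_integral_const_real[of "4 * e" "-pi" pi]
    by (intro has_integral_mult_right has_integral_add abs_times_gaussian_integral a) (simp add: mult.commute)
  have le: "norm (?f th) \<le> ?g th" if "th \<in> {-pi..pi}" for th
  proof -
    have th: "\<bar>th\<bar> \<le> pi" using that by auto
    have P: "norm (?P th) \<le> exp (- (a * th\<^sup>2)) + e"
      using norm_pgf_le[OF y th] pgf_pos[OF y(1)]
      by (simp add: norm_divide pos_divide_le_eq a_def e_def mult.commute)
    have c: "norm (cis (- (of_int m * th)) - cis (- (of_int m' * th))) \<le> ?d * \<bar>th\<bar>"
    proof -
      have "norm (cis (- (of_int m * th)) - cis (- (of_int m' * th))) \<le> \<bar>- (of_int m * th) - - (of_int m' * th)\<bar>"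
        by (rule norm_cis_diff_le)
      also have "- (of_int m * th) - - (of_int m' * th) = - (of_int (m - m') * th)" by (simp add: algebra_simps)
      finally show ?thesis by (simp only: abs_minus_cancel abs_mult)
    qed
    have "norm (?f th) = norm (?P th) * norm (cis (- (of_int m * th)) - cis (- (of_int m' * th)))"
      by (simp only: right_diff_distrib[symmetric] norm_mult)
    also have "\<dots> \<le> (exp (- (a * th\<^sup>2)) + e) * (?d * \<bar>th\<bar>)"
      using P c by (intro mult_mono) (auto simp: e_def intro!: add_nonneg_nonneg)
    also have "\<dots> = ?d * (\<bar>th\<bar> * exp (- (a * th\<^sup>2)) + \<bar>th\<bar> * e)" by (simp add: algebra_simps)
    also have "\<dots> \<le> ?g th"
      using th pi_less_4 by (intro mult_left_mono add_left_mono mult_right_mono) (auto simp: e_def)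
    finally show ?thesis .
  qed
  have "norm (complex_of_real (2 * pi * boltz y m) - of_real (2 * pi * boltz y m')) \<le> ?d * ((1 - exp (- (a * pi\<^sup>2))) / a + 4 * e * (2 * pi))"
    using integral_norm_bound_integral[OF has_integral_integrable[OF f] has_integral_integrable[OF g] le]
    by (simp only: integral_unique[OF f] integral_unique[OF g])
  also have "norm (complex_of_real (2 * pi * boltz y m) - of_real (2 * pi * boltz y m')) = 2 * pi * \<bar>boltz y m - boltz y m'\<bar>"
    by (simp only: of_real_diff[symmetric] norm_of_real right_diff_distrib[symmetric] abs_mult) simp
  also have "?d * ((1 - exp (- (a * pi\<^sup>2))) / a + 4 * e * (2 * pi)) \<le> ?d * (120000000 * y ^ 3)"
  proof (rule mult_left_mono)
    have "(1 - exp (- (a * pi\<^sup>2))) / a \<le> 1 / a" using a by (intro divide_right_mono) auto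
    moreover have "1 / a = 50 * y ^ 3" by (simp add: a_def)
    moreover have e: "e \<le> 27 * (50 * y) ^ 3" unfolding e_def using y by (intro exp_neg_inverse_le) auto
    moreover have "4 * e * (2 * pi) \<le> 4 * (27 * (50 * y) ^ 3) * (2 * 4)"
      using e pi_less_4 y by (intro mult_mono) (auto simp: e_def)
    moreover have "4 * (27 * (50 * y) ^ 3) * (2 * 4) = 108000000 * y ^ 3" by (simp add: power_mult_distrib)
    moreover have "0 \<le> y ^ 3" using y by simp
    ultimately show "(1 - exp (- (a * pi\<^sup>2))) / a + 4 * e * (2 * pi) \<le> 120000000 * y ^ 3"
      by linarith
  qed simp
  finally have "2 * pi * \<bar>boltz y m - boltz y m'\<bar> \<le> ?d * (120000000 * y ^ 3)" .
  moreover have "1 * \<bar>boltz y m - boltz y m'\<bar> \<le> 2 * pi * \<bar>boltz y m - boltz y m'\<bar>"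
    using pi_gt3 by (intro mult_right_mono) auto
  ultimately show ?thesis by (simp only: mult_1 mult_ac)
qed

text \<open>Near 0 the integrand has real part at least 1/2; in an intermediate range it is
  nonnegative because the phase error is at most 2/3; beyond that it is bounded by the decay T,
  which the hypothesis \<open>small\<close> makes negligible against the first range.\<close>

lemma boltz_ge:
  assumes y: "0 < y" "y \<le> 1" and mean: "mean_size (exp (- y)) = real N"
    and small: "8 * (exp (- (y powr (-1/3) / 1800)) + exp (- (1 / (50 * y)))) \<le> y powr (3/2) / 16"
  shows "y powr (3/2) / 128 \<le> boltz y (int N)"
proof -
  let ?P = "\<lambda>th. pgf (of_real (exp (- y)) * cis th) / of_real (pgf (exp (- y)))"
  let ?f = "\<lambda>th. ?P th * cis (- (of_int (int N) * th))"
  \<comment> \<open>The width of the peak is y^(3/2), and the factor 1/8 gives D \<le> 1/4. The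
    cubic phase error th^3 / y^4 stays bounded up to order y^(4/3), where th^2 / y^3 is already of
    order y^(-1/3), so what lies beyond is smaller than any power of y.\<close>
  define t0 t1 where "t0 = y powr (3/2) / 8" and "t1 = y powr (4/3) / 6"
  define T where "T = exp (- (y powr (-1/3) / 1800)) + exp (- (1 / (50 * y)))"
  have T: "0 \<le> T" by (simp add: T_def)
  have "y powr (3/2) \<le> 1" using y by (intro powr_le1) auto
  then have t0: "0 < t0" "t0 \<le> 1" using y by (auto simp: t0_def)
  have t0sq: "t0\<^sup>2 = y ^ 3 / 64"
  proof -
    have "(y powr (3/2))\<^sup>2 = y powr (3/2 * 2)" using y by (subst powr_powr[symmetric]) simp
    also have "\<dots> = y ^ 3" using y powr_realpow[of y 3] by simp
    finally show ?thesis by (simp add: t0_def power_divide)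
  qed
  have t1sq: "t1\<^sup>2 / (50 * y ^ 3) = y powr (-1/3) / 1800"
  proof -
    have "(y powr (4/3))\<^sup>2 = y powr (4/3 * 2)" using y by (subst powr_powr[symmetric]) simp
    moreover have "y ^ 3 = y powr 3" using y powr_realpow[of y 3] by simp
    moreover have "y powr (4/3 * 2) / y powr 3 = y powr (-1/3)" unfolding powr_diff[symmetric] by simp
    ultimately show ?thesis by (simp add: t1_def power_divide)
  qed
  have t1cube: "t1 ^ 3 = y ^ 4 / 216"
  proof -
    have "(y powr (4/3)) ^ 3 = y powr (4/3 * 3)" using y by (subst powr_powr[symmetric]) simp
    also have "\<dots> = y ^ 4" using y powr_realpow[of y 4] by simp
    finally show ?thesis by (simp add: t1_def power_divide)
  qed
  let ?h = "\<lambda>th. (if th \<in> {-t0..t0} then 1/2 else 0) - T"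
  have hint: "(?h has_integral (t0 - 2 * pi * T)) {-pi..pi}"
  proof (rule has_integral_diff)
    have "((\<lambda>th. 1/2 :: real) has_integral t0) {-t0..t0}"
      using has_integral_const_real[of "1/2::real" "-t0" t0] t0 by simp
    then show "((\<lambda>th. if th \<in> {-t0..t0} then 1/2 else 0) has_integral t0) {-pi..pi}"
      using t0 pi_gt3 by (subst has_integral_restrict) auto
    show "((\<lambda>th. T) has_integral (2 * pi * T)) {-pi..pi}"
      using has_integral_const_real[of T "-pi" pi] by simp
  qed
  have fint: "((\<lambda>th. Re (?f th)) has_integral (2 * pi * boltz y (int N))) {-pi..pi}"
    using has_integral_linear[OF boltz_fourier[OF y(1), of "int N"] bounded_linear_Re] by (simp add: o_def)
  have le: "?h th \<le> Re (?f th)" if "th \<in> {-pi..pi}" for th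
  proof -
    have th: "\<bar>th\<bar> \<le> pi" using that by auto
    obtain D E where pol: "pgf (of_real (exp (- y)) * cis th) = of_real (pgf (exp (- y)) * exp (- D)) * cis (th * mean_size (exp (- y)) - E)"
      and "(\<Sum>n. exp (- y) ^ Suc n * (1 - cos (real (Suc n) * th))) \<le> D"
      and D: "D \<le> 16 * th\<^sup>2 / y ^ 3" and E: "\<bar>E\<bar> \<le> 144 * \<bar>th\<bar> ^ 3 / y ^ 4"
      by (rule pgf_polar[OF y(1), of th])
    have "?f th = of_real (exp (- D)) * cis (- E)"
      using pgf_pos[OF y(1)] unfolding pol mean by (simp add: mult.assoc cis_mult mult.commute)
    then have Re: "Re (?f th) = exp (- D) * cos E" by simp
    have cosE: "1 - E\<^sup>2 / 2 \<le> cos E" using one_minus_cos_le[of E] by simp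
    show ?thesis
    proof (cases "\<bar>th\<bar> \<le> t1")
      case False
      then have "\<bar>t1\<bar> \<le> \<bar>th\<bar>" by (simp add: t1_def)
      then have not0: "t1\<^sup>2 \<le> th\<^sup>2" by (simp only: abs_le_square_iff)
      have "\<bar>Re (?f th)\<bar> \<le> norm (?f th)" by (rule abs_Re_le_cmod)
      also have "\<dots> = norm (pgf (of_real (exp (- y)) * cis th)) / pgf (exp (- y))"
        using pgf_pos[OF y(1)] by (simp add: norm_mult norm_divide)
      also have "\<dots> \<le> exp (- (th\<^sup>2 / (50 * y ^ 3))) + exp (- (1 / (50 * y)))"
        using norm_pgf_le[OF y th] pgf_pos[OF y(1)] by (simp add: pos_divide_le_eq mult.commute)
      also have "\<dots> \<le> T"
      proof -
        have "t1\<^sup>2 / (50 * y ^ 3) \<le> th\<^sup>2 / (50 * y ^ 3)" using not0 y by (intro divide_right_mono) auto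
        then show ?thesis unfolding T_def t1sq by simp
      qed
      finally have "- T \<le> Re (?f th)" by linarith
      moreover have "th \<notin> {-t0..t0}"
      proof
        assume "th \<in> {-t0..t0}"
        then have "\<bar>th\<bar> \<le> t0" by auto
        moreover have "t0 \<le> t1"
        proof -
          have "y powr (3/2) \<le> y powr (4/3)" using y by (intro powr_mono') auto
          then show ?thesis unfolding t0_def t1_def using powr_ge_zero[of y "4/3"] by linarith
        qed
        ultimately show False using False by simp
      qed
      then have "?h th = - T" by simp
      ultimately show ?thesis by (simp only:)
    next
      case True
      have "\<bar>th\<bar> ^ 3 \<le> t1 ^ 3" using True by (intro power_mono) auto
      then have "144 * \<bar>th\<bar> ^ 3 / y ^ 4 \<le> 144 * (y ^ 4 / 216) / y ^ 4"
        unfolding t1cube using y by (intro divide_right_mono mult_left_mono) auto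
      also have "\<dots> = 2 / 3" using y by simp
      finally have E1: "\<bar>E\<bar> \<le> 2 / 3" using E by linarith
      have "\<bar>E\<bar>\<^sup>2 \<le> (2 / 3)\<^sup>2" using E1 by (intro power_mono) auto
      then have c: "7 / 9 \<le> cos E" using cosE by (simp add: power_divide)
      show ?thesis
      proof (cases "th \<in> {-t0..t0}")
        case True
        then have "\<bar>th\<bar> \<le> \<bar>t0\<bar>" using t0 by auto
        then have "th\<^sup>2 \<le> t0\<^sup>2" by (simp only: abs_le_square_iff)
        then have "16 * th\<^sup>2 / y ^ 3 \<le> 16 * (y ^ 3 / 64) / y ^ 3"
          unfolding t0sq using y by (intro divide_right_mono mult_left_mono) auto
        also have "\<dots> = 1 / 4" using y by simp
        finally have "D \<le> 1 / 4" using D by simp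
        moreover have "1 + - D \<le> exp (- D)" by (rule exp_ge_add_one_self)
        ultimately have "3 / 4 \<le> exp (- D)" by linarith
        then have "3 / 4 * (7 / 9) \<le> exp (- D) * cos E" using c by (intro mult_mono) auto
        then have "1 / 2 \<le> Re (?f th)" unfolding Re by linarith
        moreover have "?h th = 1 / 2 - T" using True by simp
        ultimately show ?thesis using T by linarith
      next
        case False
        have "0 \<le> Re (?f th)" unfolding Re using c by simp
        moreover have "?h th = - T" using False by simp
        ultimately show ?thesis using T by linarith
      qed
    qed
  qed
  have "t0 - 2 * pi * T \<le> 2 * pi * boltz y (int N)"
    by (rule has_integral_le[OF hint fint le])
  moreover have "2 * pi * T \<le> 2 * 4 * T" using pi_less_4 T by (intro mult_right_mono) auto
  moreover have "8 * T \<le> t0 / 2" using small unfolding T_def t0_def by simp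
  ultimately have 1: "t0 / 2 \<le> 2 * pi * boltz y (int N)" by linarith
  have "0 \<le> boltz y (int N)"
    unfolding boltz_def using pgf_pos[OF y(1)] by (intro divide_nonneg_nonneg) auto
  then have "2 * pi * boltz y (int N) \<le> 2 * 4 * boltz y (int N)"
    using pi_less_4 by (intro mult_right_mono) auto
  then show ?thesis using 1 unfolding t0_def by linarith
qed

text \<open>The Lipschitz constant, of order y^3, divided by the peak, of order y^(3/2), gives the
  relative error j y^(3/2). This is small for j of order 1 / y even up to powers of logarithms, so
  the pure exponential is accurate enough.\<close>

theorem partitions_local:
  "\<exists>N0 C. 0 < C \<and> (\<forall>N\<ge>N0. \<exists>y. 0 < y \<and> y \<le> 1 \<and> 1 / (3 * real N) \<le> y\<^sup>2 \<and> y\<^sup>2 \<le> 4 / real N \<and>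
     y powr (3/2) / 128 * pgf (exp (- y)) \<le> real (num_partitions N) * exp (- (y * real N)) \<and>
     (\<forall>j. \<bar>real (pd N j) - exp (- (y * real j)) * real (num_partitions N)\<bar>
        \<le> C * real j * y powr (3/2) * exp (- (y * real j)) * real (num_partitions N)))"
proof -
  define P where "P y \<longleftrightarrow> 8 * (exp (- (y powr (-1/3) / 1800)) + exp (- (1 / (50 * y)))) \<le> y powr (3/2) / 16" for y :: real
  have "eventually P (at_right 0)" unfolding P_def by real_asymp
  then obtain y0 where y0: "0 < y0" and small: "\<And>y. 0 < y \<Longrightarrow> y < y0 \<Longrightarrow> P y"
    unfolding eventually_at_right_field by blast
  define N0 where "N0 = max 5 (nat \<lceil>4 / y0\<^sup>2\<rceil> + 1)"
  \<comment> \<open>128 times the Lipschitz constant in \<open>boltz_lipschitz\<close>.\<close>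
  define C where "C = (15360000000::real)"
  show ?thesis
  proof (rule exI[of _ N0], rule exI[of _ C], intro conjI allI impI)
    show "0 < C" by (simp add: C_def)
    fix N assume N: "N0 \<le> N"
    then have N5: "5 \<le> N" and "4 / y0\<^sup>2 < real N" unfolding N0_def by (simp, linarith)
    then have lt: "4 / real N < y0\<^sup>2" using y0 by (simp add: field_simps)
    obtain y where y: "0 < y" "y \<le> 1" and mean: "mean_size (exp (- y)) = real N"
      and b: "1 / (3 * real N) \<le> y\<^sup>2" "y\<^sup>2 \<le> 4 / real N"
      by (rule exists_saddle_point[OF N5])
    have "y\<^sup>2 < y0\<^sup>2" using b lt by linarith
    then have "y < y0" using y0 by (simp add: power_less_imp_less_base)
    from boltz_ge[OF y mean small[OF y(1) this, unfolded P_def]]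
    have A: "y powr (3/2) / 128 \<le> boltz y (int N)" .
    let ?p = "real (num_partitions N)"
    have pg: "0 < pgf (exp (- y))" by (rule pgf_pos[OF y(1)])
    have bN: "boltz y (int N) * pgf (exp (- y)) = ?p * exp (- (y * real N))"
      using pg by (simp add: boltz_def exp_of_nat_mult[symmetric] mult.commute)
    have first: "y powr (3/2) / 128 * pgf (exp (- y)) \<le> ?p * exp (- (y * real N))"
      unfolding bN[symmetric] using A pg by (intro mult_right_mono) auto
    have "\<bar>real (pd N j) - exp (- (y * real j)) * ?p\<bar> \<le> C * real j * y powr (3/2) * exp (- (y * real j)) * ?p" for j
    proof -
      let ?e = "exp (- (y * real N))" and ?ej = "exp (- (y * real j))"
      have bj: "boltz y (int N - int j) * pgf (exp (- y)) * ?ej = real (pd N j) * ?e"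
      proof (cases "j \<le> N")
        case True
        then have "nat (int N - int j) = N - j" by simp
        then have "boltz y (int N - int j) * pgf (exp (- y)) = real (num_partitions (N - j)) * exp (- (y * real (N - j)))"
          using pg True by (simp add: boltz_def exp_of_nat_mult[symmetric] mult.commute)
        then show ?thesis using True
          by (simp add: pd_def mult.assoc exp_add[symmetric] of_nat_diff algebra_simps)
      next
        case False
        then show ?thesis by (simp add: boltz_def pd_def)
      qed
      have "\<bar>boltz y (int N - int j) - boltz y (int N)\<bar> \<le> 120000000 * y ^ 3 * real j"
        using boltz_lipschitz[OF y, of "int N - int j" "int N"] by simp
      also have "y ^ 3 = y powr (3/2) * y powr (3/2)"
        using y powr_realpow[of y 3] by (simp add: powr_add[symmetric])
      also have "120000000 * (y powr (3/2) * y powr (3/2)) * real j = C * real j * y powr (3/2) * (y powr (3/2) / 128)"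
        by (simp add: C_def)
      also have "\<dots> \<le> C * real j * y powr (3/2) * boltz y (int N)"
        using A by (intro mult_left_mono) (auto simp: C_def)
      finally have "\<bar>boltz y (int N - int j) - boltz y (int N)\<bar> * (pgf (exp (- y)) * ?ej) \<le> C * real j * y powr (3/2) * boltz y (int N) * (pgf (exp (- y)) * ?ej)"
        using pg by (intro mult_right_mono) auto
      moreover have "\<bar>boltz y (int N - int j) - boltz y (int N)\<bar> * (pgf (exp (- y)) * ?ej) = \<bar>real (pd N j) * ?e - ?p * ?e * ?ej\<bar>"
      proof -
        have "\<bar>boltz y (int N - int j) - boltz y (int N)\<bar> * (pgf (exp (- y)) * ?ej) =
          \<bar>(boltz y (int N - int j) - boltz y (int N)) * (pgf (exp (- y)) * ?ej)\<bar>"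
          using pg by (simp add: abs_mult)
        also have "(boltz y (int N - int j) - boltz y (int N)) * (pgf (exp (- y)) * ?ej) = real (pd N j) * ?e - ?p * ?e * ?ej"
          unfolding bj[symmetric] bN[symmetric] by (simp add: algebra_simps)
        finally show ?thesis .
      qed
      moreover have "\<bar>real (pd N j) * ?e - ?p * ?e * ?ej\<bar> = \<bar>real (pd N j) - ?ej * ?p\<bar> * ?e"
      proof -
        have "real (pd N j) * ?e - ?p * ?e * ?ej = (real (pd N j) - ?ej * ?p) * ?e" by (simp add: algebra_simps)
        then show ?thesis by (simp add: abs_mult)
      qed
      moreover have "C * real j * y powr (3/2) * boltz y (int N) * (pgf (exp (- y)) * ?ej) = C * real j * y powr (3/2) * ?ej * ?p * ?e"
        using bN by (simp add: mult_ac)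
      ultimately have "\<bar>real (pd N j) - ?ej * ?p\<bar> * ?e \<le> C * real j * y powr (3/2) * ?ej * ?p * ?e" by simp
      then show ?thesis by simp
    qed
    then show "\<exists>y. 0 < y \<and> y \<le> 1 \<and> 1 / (3 * real N) \<le> y\<^sup>2 \<and> y\<^sup>2 \<le> 4 / real N \<and>
     y powr (3/2) / 128 * pgf (exp (- y)) \<le> ?p * exp (- (y * real N)) \<and>
     (\<forall>j. \<bar>real (pd N j) - exp (- (y * real j)) * ?p\<bar> \<le> C * real j * y powr (3/2) * exp (- (y * real j)) * ?p)"
      using y b first by blast
  qed
qed

section \<open>Exponential tilting\<close>

text \<open>The function \<open>ln (pgf (exp (- y)))\<close> is convex in y with derivative
  \<open>- mean_size (exp (- y))\<close>. These are the tangent bounds at a and at b, obtained term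
  by term without differentiating the series.\<close>

lemma log_pgf_diff:
  assumes a: "0 < a" and ab: "a \<le> b"
  shows "pgf (exp (- a)) \<le> pgf (exp (- b)) * exp ((b - a) * mean_size (exp (- a)))"
    and "pgf (exp (- b)) * exp ((b - a) * mean_size (exp (- b))) \<le> pgf (exp (- a) :: real)"
proof -
  have b: "0 < b" using assms by simp
  let ?l = "\<lambda>c n. ln (1 - exp (- c) ^ Suc n)"
  have P: "pgf (exp (- c)) = exp (- (\<Sum>n. ?l c n))" "summable (?l c)" if "0 < c" for c :: real
    using pgf_real_eq_exp[of "exp (- c)"] summable_ln_real[of "exp (- c)"] that by simp_all
  have e: "exp (- c) ^ Suc n = exp (- (c * real (Suc n)))" for c :: real and n
    by (simp add: exp_of_nat_mult[symmetric] mult.commute del: power_Suc of_nat_Suc)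
  have up: "?l b n - ?l a n \<le> (b - a) * moment 1 (exp (- a)) n"
    and lo: "(b - a) * moment 1 (exp (- b)) n \<le> ?l b n - ?l a n" for n
  proof -
    let ?m = "real (Suc n)"
    define A B where "A = exp (- (a * ?m))" and "B = exp (- (b * ?m))"
    have A: "0 < A" "A < 1" and B: "0 < B" "B < 1" using a b by (auto simp: A_def B_def)
    have ratio: "ln (1 - B) - ln (1 - A) = ln ((1 - B) / (1 - A))" using A B by (subst ln_div) auto
    have AB1: "A - B \<le> (b - a) * ?m * A"
    proof -
      have "1 + - ((b - a) * ?m) \<le> exp (- ((b - a) * ?m))" by (rule exp_ge_add_one_self)
      then have "A * (1 - (b - a) * ?m) \<le> A * exp (- ((b - a) * ?m))" using A by (intro mult_left_mono) auto
      also have "\<dots> = B" unfolding A_def B_def exp_add[symmetric] by (simp add: algebra_simps)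
      finally show ?thesis by (simp add: algebra_simps)
    qed
    have AB2: "(b - a) * ?m * B \<le> A - B"
    proof -
      have "1 + ((b - a) * ?m) \<le> exp ((b - a) * ?m)" by (rule exp_ge_add_one_self)
      then have "B * (1 + (b - a) * ?m) \<le> B * exp ((b - a) * ?m)" using B by (intro mult_left_mono) auto
      also have "\<dots> = A" unfolding A_def B_def exp_add[symmetric] by (simp add: algebra_simps)
      finally show ?thesis by (simp add: algebra_simps)
    qed
    have "ln ((1 - B) / (1 - A)) \<le> (1 - B) / (1 - A) - 1" using A B by (intro ln_le_minus_one) auto
    also have "\<dots> = (A - B) / (1 - A)" using A by (simp add: field_simps)
    also have "\<dots> \<le> ((b - a) * ?m * A) / (1 - A)" using A AB1 by (intro divide_right_mono) auto
    finally show "?l b n - ?l a n \<le> (b - a) * moment 1 (exp (- a)) n"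
      using ratio by (simp add: e A_def B_def moment_def del: power_Suc of_nat_Suc)
    have "ln ((1 - A) / (1 - B)) \<le> (1 - A) / (1 - B) - 1" using A B by (intro ln_le_minus_one) auto
    also have "\<dots> = - ((A - B) / (1 - B))" using B by (simp add: field_simps)
    also have "\<dots> \<le> - (((b - a) * ?m * B) / (1 - B))" using B AB2 by (intro le_imp_neg_le divide_right_mono) auto
    finally have "((b - a) * ?m * B) / (1 - B) \<le> - ln ((1 - A) / (1 - B))" by simp
    also have "- ln ((1 - A) / (1 - B)) = ln (1 - B) - ln (1 - A)" using A B by (subst ln_div) auto
    finally show "(b - a) * moment 1 (exp (- b)) n \<le> ?l b n - ?l a n"
      by (simp add: e A_def B_def moment_def del: power_Suc of_nat_Suc)
  qed
  have sm: "summable (moment 1 (exp (- c)))" if "0 < c" for c using moment_sum(1)[OF that, of 1] by simp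
  have s1: "summable (\<lambda>n. ?l b n - ?l a n)" by (rule summable_diff[OF P(2)[OF b] P(2)[OF a]])
  have sd: "(\<Sum>n. ?l b n - ?l a n) = (\<Sum>n. ?l b n) - (\<Sum>n. ?l a n)"
    by (rule suminf_diff[symmetric]) (use P a b in auto)
  have "(\<Sum>n. ?l b n - ?l a n) \<le> (\<Sum>n. (b - a) * moment 1 (exp (- a)) n)"
    by (rule suminf_le[OF up s1 summable_mult[OF sm[OF a]]])
  also have "\<dots> = (b - a) * mean_size (exp (- a))"
    unfolding mean_size_def by (rule suminf_mult[OF sm[OF a]])
  finally have U: "(\<Sum>n. ?l b n) - (\<Sum>n. ?l a n) \<le> (b - a) * mean_size (exp (- a))" using sd by simp
  have "(b - a) * mean_size (exp (- b)) = (\<Sum>n. (b - a) * moment 1 (exp (- b)) n)"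
    unfolding mean_size_def by (rule suminf_mult[OF sm[OF b], symmetric])
  also have "\<dots> \<le> (\<Sum>n. ?l b n - ?l a n)"
    by (rule suminf_le[OF lo summable_mult[OF sm[OF b]] s1])
  finally have L: "(b - a) * mean_size (exp (- b)) \<le> (\<Sum>n. ?l b n) - (\<Sum>n. ?l a n)" using sd by simp
  show "pgf (exp (- a)) \<le> pgf (exp (- b)) * exp ((b - a) * mean_size (exp (- a)))"
    unfolding P(1)[OF a] P(1)[OF b] exp_add[symmetric] using U by simp
  show "pgf (exp (- b)) * exp ((b - a) * mean_size (exp (- b))) \<le> pgf (exp (- a) :: real)"
    unfolding P(1)[OF a] P(1)[OF b] exp_add[symmetric] using L by simp
qed

lemma mean_size_le: "0 < y \<Longrightarrow> mean_size (exp (- y)) \<le> 4 / y\<^sup>2"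
  using moment_sum(2)[of y 1] by (simp add: mean_size_def power2_eq_square)

lemma mean_size_ge_exp: assumes y: "0 < y" shows "exp (- y) \<le> mean_size (exp (- y))"
proof -
  have "exp (- y) / 1 \<le> exp (- y) / (1 - exp (- y))" using y by (intro divide_left_mono) auto
  then have "exp (- y) \<le> (\<Sum>n<1. moment 1 (exp (- y)) n)" by (simp add: moment_def)
  also have "\<dots> \<le> mean_size (exp (- y))"
    unfolding mean_size_def using moment_sum(1)[OF y, of 1] moment_nonneg[OF y]
    by (intro sum_le_suminf) auto
  finally show ?thesis .
qed

text \<open>The tilting argument below loses a constant factor between the means at nearby parameters;
  what matters is only that this factor is less than 2, the smallest relevant value of \<open>t\<close>.\<close>
lemma mean_size_ratio:
  assumes x: "0 < x" "x \<le> 1"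
  shows "mean_size (exp (- x)) \<le> 3 / 2 * mean_size (exp (- (1001 / 1000 * x)))"
proof -
  define c where "c = 1001 / 1000 * x"
  have c: "0 < c" using x by (simp add: c_def)
  define g where "g n = exp (- (x / 2 * real (Suc n) / 2))" for n
  have gs: "g sums (1 / (exp (x / 2 / 2) - 1))" unfolding g_def using x by (intro exp_half_sums) simp
  have e5: "97 \<le> exp (5::real)"
  proof -
    have "(5 / 2 :: real) \<le> exp 1" using exp_lower_Taylor_quadratic[of 1] by simp
    then have "(5 / 2 :: real) ^ 5 \<le> exp 1 ^ 5" by (intro power_mono) auto
    also have "\<dots> = exp 5" by (simp add: exp_of_nat_mult[symmetric])
    finally show ?thesis by (simp add: eval_nat_numeral)
  qed
  have tm: "moment 1 (exp (- x)) n \<le> 11 / 10 * moment 1 (exp (- c)) n + 2 / (97 * x) * g n" for n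
  proof -
    define v where "v = x * real (Suc n)"
    have v: "0 < v" using x by (simp add: v_def)
    have m: "moment 1 (exp (- d)) n = real (Suc n) / (exp (d * real (Suc n)) - 1)" if "0 < d" for d
    proof -
      have "exp (- d) ^ Suc n = exp (- (d * real (Suc n)))"
        by (simp add: exp_of_nat_mult[symmetric] mult.commute del: power_Suc of_nat_Suc)
      also have "\<dots> = 1 / exp (d * real (Suc n))" by (simp add: exp_minus inverse_eq_divide)
      finally have Q: "exp (- d) ^ Suc n = 1 / exp (d * real (Suc n))" .
      have "1 < exp (d * real (Suc n))" using that by simp
      then show ?thesis unfolding moment_def power_one_right Q by (simp add: field_simps del: of_nat_Suc)
    qed
    show ?thesis
    \<comment> \<open>Up to v = 20 the terms at x and at c differ by a factor of at most 11/10.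
      Larger v form a tail with \<open>exp (- (v / 4))\<close> at most exp (- 5) \<le> 1/97, which
      \<open>mean_size_ge\<close> turns into 24/97 of the left side; then 11/10 * 97/73 <
      3/2.\<close>
    proof (cases "v \<le> 20")
      case True
      have cv: "c * real (Suc n) = v + v / 1000" by (simp add: c_def v_def field_simps)
      have "exp (v / 1000) \<le> 1 + v / 1000 + (v / 1000)\<^sup>2"
        using v True by (intro exp_bound) auto
      also have "(v / 1000)\<^sup>2 \<le> v / 1000 * (1 / 50)"
        unfolding power2_eq_square using v True by (intro mult_left_mono) auto
      finally have e1: "exp (v / 1000) - 1 \<le> v * (51 / 50000)" by simp
      have vle: "v * exp v \<le> (1 + v) * (exp v - 1)"
        using exp_ge_add_one_self[of v] by (simp add: algebra_simps)
      have "exp (v + v / 1000) - 1 = (exp v - 1) + exp v * (exp (v / 1000) - 1)"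
        unfolding exp_add by (simp add: algebra_simps)
      also have "\<dots> \<le> (exp v - 1) + exp v * (v * (51 / 50000))"
        using e1 by (intro add_left_mono mult_left_mono) auto
      also have "\<dots> \<le> (exp v - 1) + (1 + v) * (exp v - 1) * (51 / 50000)"
        using vle by simp
      also have "\<dots> \<le> (exp v - 1) + 21 * (exp v - 1) * (51 / 50000)"
        using True v by (intro add_left_mono mult_right_mono) auto
      also have "\<dots> \<le> 11 / 10 * (exp v - 1)"
      proof -
        have "1 \<le> exp v" using v by simp
        then show ?thesis by (simp add: field_simps)
      qed
      finally have E: "exp (v + v / 1000) - 1 \<le> 11 / 10 * (exp v - 1)" .
      have gen: "a / b = 11 / 10 * (a / (11 / 10 * b))" for a b :: real by simp
      have "real (Suc n) / (exp v - 1) = 11 / 10 * (real (Suc n) / (11 / 10 * (exp v - 1)))"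
        by (rule gen)
      also have "\<dots> \<le> 11 / 10 * (real (Suc n) / (exp (v + v / 1000) - 1))"
        using E v by (intro mult_left_mono divide_left_mono mult_pos_pos) auto
      finally have "moment 1 (exp (- x)) n \<le> 11 / 10 * moment 1 (exp (- c)) n"
        unfolding m[OF x(1)] m[OF c] cv by (simp add: v_def)
      moreover have "0 \<le> 2 / (97 * x) * g n" using x by (simp add: g_def)
      ultimately show ?thesis by linarith
    next
      case False
      have "moment 1 (exp (- x)) n \<le> 2 / x * exp (- (v / 2))"
        using moment_le[OF x(1), of 1 n] by (simp add: v_def)
      also have "exp (- (v / 2)) = exp (- (v / 4)) * exp (- (v / 4))" by (simp add: exp_add[symmetric])
      also have "exp (- (v / 4)) * exp (- (v / 4)) \<le> exp (- 5) * exp (- (v / 4))"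
        using False by (intro mult_right_mono) auto
      also have "exp (- 5) \<le> (1 / 97 :: real)" using e5 by (simp add: exp_minus field_simps)
      finally have "moment 1 (exp (- x)) n \<le> 2 / x * (1 / 97 * exp (- (v / 4)))"
        using x by (simp add: mult_left_mono divide_right_mono)
      also have "\<dots> = 2 / (97 * x) * g n" by (simp add: g_def v_def)
      finally show ?thesis using moment_nonneg[OF c, of 1 n] by linarith
    qed
  qed
  have sm: "summable (moment 1 (exp (- d)))" if "0 < d" for d using moment_sum(1)[OF that, of 1] by simp
  have "mean_size (exp (- x)) \<le> (\<Sum>n. 11 / 10 * moment 1 (exp (- c)) n + 2 / (97 * x) * g n)"
    unfolding mean_size_def
    by (rule suminf_le[OF tm sm[OF x(1)] summable_add[OF summable_mult[OF sm[OF c]] summable_mult[OF sums_summable[OF gs]]]])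
  also have "\<dots> = 11 / 10 * mean_size (exp (- c)) + 2 / (97 * x) * (1 / (exp (x / 2 / 2) - 1))"
    unfolding mean_size_def
    using sums_add[OF sums_mult[OF summable_sums[OF sm[OF c]], of "11/10"] sums_mult[OF gs, of "2 / (97 * x)"]]
    by (simp add: sums_iff)
  also have "2 / (97 * x) * (1 / (exp (x / 2 / 2) - 1)) \<le> 2 / (97 * x) * (4 / x)"
  proof (rule mult_left_mono)
    have "x / 4 \<le> exp (x / 2 / 2) - 1" using exp_ge_add_one_self[of "x / 2 / 2"] by linarith
    then have "1 / (exp (x / 2 / 2) - 1) \<le> 1 / (x / 4)" using x by (intro divide_left_mono mult_pos_pos) auto
    then show "1 / (exp (x / 2 / 2) - 1) \<le> 4 / x" by simp
  qed (use x in simp)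
  also have "2 / (97 * x) * (4 / x) = 24 / 97 * (1 / (3 * x\<^sup>2))" by (simp add: power2_eq_square)
  also have "\<dots> \<le> 24 / 97 * mean_size (exp (- x))" using mean_size_ge[OF x] by (intro mult_left_mono) auto
  finally have "mean_size (exp (- x)) * (73 / 97) \<le> 11 / 10 * mean_size (exp (- c))" by simp
  moreover have "0 \<le> mean_size (exp (- c))" using mean_size_ge_exp[OF c] by (meson exp_ge_zero order_trans)
  ultimately show ?thesis unfolding c_def by simp
qed

text \<open>Tilting by \<open>exp u\<close>: upper bound for
  \<open>E (exp (u P\<^sub>t)) E (exp (- u H\<^sub>t))\<close> under the Boltzmann distribution.\<close>
lemma tilt_bound:
  assumes u: "0 \<le> u" "u < x"
  shows "pgf (exp (- (x - u))) / pgf (exp (- x)) * (pgf (exp (- (x + u))) / pgf (exp (- x :: real))) ^ t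
    \<le> exp (u * mean_size (exp (- (x - u))) - real t * (u * mean_size (exp (- (x + u)))))"
proof -
  have pos: "0 < pgf (exp (- c))" if "0 < c" for c :: real using pgf_pos[OF that] .
  have 1: "pgf (exp (- (x - u))) / pgf (exp (- x)) \<le> exp (u * mean_size (exp (- (x - u))))"
    using log_pgf_diff(1)[of "x - u" x] u pos[of x] by (simp add: pos_divide_le_eq mult.commute)
  have "pgf (exp (- (x + u))) * exp (u * mean_size (exp (- (x + u)))) \<le> pgf (exp (- x))"
    using log_pgf_diff(2)[of x "x + u"] u by simp
  then have "pgf (exp (- (x + u))) / pgf (exp (- x)) \<le> exp (- (u * mean_size (exp (- (x + u)))))"
    using u pos[of x] by (simp add: pos_divide_le_eq exp_minus field_simps)
  then have "(pgf (exp (- (x + u))) / pgf (exp (- x))) ^ t \<le> exp (- (u * mean_size (exp (- (x + u))))) ^ t"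
    using u pos[of x] pos[of "x + u"] by (intro power_mono) auto
  also have "\<dots> = exp (- (real t * (u * mean_size (exp (- (x + u))))))"
    by (simp add: exp_of_nat_mult[symmetric])
  finally have "pgf (exp (- (x - u))) / pgf (exp (- x)) * (pgf (exp (- (x + u))) / pgf (exp (- x))) ^ t
    \<le> exp (u * mean_size (exp (- (x - u)))) * exp (- (real t * (u * mean_size (exp (- (x + u))))))"
    using 1 u pos[of x] pos[of "x + u"] by (intro mult_mono) auto
  then show ?thesis by (simp add: exp_add[symmetric])
qed

text \<open>The tilted mean of P_t is at most 3/2 times the tilted mean of each of the t components
  of H_t, so the exponent is at most - (t - 3/2) times a positive amount. The assumption t \<ge> 2
  enters through t - 3/2 \<ge> t / 4.\<close>

lemma tilt_small:
  assumes x: "0 < x" "x \<le> 1 / 2" and t: "2 \<le> t"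
  obtains u where "0 < u" "u < x"
    "u * mean_size (exp (- (x - u))) - real t * (u * mean_size (exp (- (x + u)))) \<le> - (real t / (40000 * x))"
proof -
  \<comment> \<open>Makes x + u equal to 1001/1000 times x - u, as \<open>mean_size_ratio\<close>
    requires.\<close>
  define u where "u = x / 2001"
  have u: "0 < u" "u < x" using x by (auto simp: u_def)
  have xu: "x + u = 1001 / 1000 * (x - u)" by (simp add: u_def field_simps)
  let ?M = "mean_size (exp (- (x + u)))"
  have r: "mean_size (exp (- (x - u))) \<le> 3 / 2 * ?M"
    unfolding xu using u x by (intro mean_size_ratio) auto
  have "1 / (3 * (x + u)\<^sup>2) \<le> ?M" using u x by (intro mean_size_ge) auto
  moreover have "1 / (4 * x\<^sup>2) \<le> 1 / (3 * (x + u)\<^sup>2)"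
    using x by (simp add: u_def field_simps power2_eq_square)
  ultimately have M: "1 / (4 * x\<^sup>2) \<le> ?M" by linarith
  have M0: "0 \<le> ?M" using M by (meson order_trans zero_le_divide_1_iff mult_nonneg_nonneg zero_le_numeral zero_le_power2)
  have "u * mean_size (exp (- (x - u))) \<le> u * (3 / 2 * ?M)" using r u by (intro mult_left_mono) auto
  then have "u * mean_size (exp (- (x - u))) - real t * (u * ?M) \<le> - ((real t - 3 / 2) * (u * ?M))"
    by (simp add: algebra_simps)
  also have "\<dots> \<le> - (real t / 4 * (u * (1 / (4 * x\<^sup>2))))"
    using t u M M0 by (intro le_imp_neg_le mult_mono) auto
  also have "\<dots> \<le> - (real t / (40000 * x))"
    using x t by (simp add: u_def power2_eq_square field_simps)
  finally show thesis using that u by blast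
qed

text \<open>Here a fixed tilt is enough: the argument x - 1/4 is at least 1/4, so P_t costs at most
  64 / 4 = 16, while H_t gains a constant multiple of t exp (- x).\<close>

lemma tilt_large:
  assumes x: "1 / 2 \<le> x"
  shows "1 / 4 * mean_size (exp (- (x - 1 / 4))) - real t * (1 / 4 * mean_size (exp (- (x + 1 / 4)))) \<le> 16 - real t * exp (- x) / 6"
proof -
  have "mean_size (exp (- (x - 1 / 4))) \<le> 4 / (x - 1 / 4)\<^sup>2" using x by (intro mean_size_le) auto
  also have "\<dots> \<le> 4 / (1 / 4)\<^sup>2" using x by (intro divide_left_mono power_mono mult_pos_pos) auto
  finally have 1: "mean_size (exp (- (x - 1 / 4))) \<le> 64" by (simp add: power2_eq_square)
  have "1 + - (1 / 4) \<le> exp (- (1 / 4 :: real))" by (rule exp_ge_add_one_self)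
  then have "exp (- x) * (3 / 4) \<le> exp (- x) * exp (- (1 / 4))" by (intro mult_left_mono) auto
  also have "\<dots> = exp (- (x + 1 / 4))" by (simp add: exp_add[symmetric])
  also have "\<dots> \<le> mean_size (exp (- (x + 1 / 4)))" using x by (intro mean_size_ge_exp) simp
  finally have "exp (- x) * (3 / 4) \<le> mean_size (exp (- (x + 1 / 4)))" .
  moreover have "exp (- x) * (2 / 3) \<le> exp (- x) * (3 / 4)" by simp
  ultimately have "exp (- x) * (2 / 3) \<le> mean_size (exp (- (x + 1 / 4)))" by (rule order_trans[rotated])
  then have "real t * (1 / 4 * (exp (- x) * (2 / 3))) \<le> real t * (1 / 4 * mean_size (exp (- (x + 1 / 4))))"
    by (intro mult_left_mono) auto
  then show ?thesis using 1 by simp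
qed

section \<open>Chernoff bounds at a fixed size\<close>

lemma fps_partitions_power_nonneg: "0 \<le> fps_nth (fps_partitions ^ t) w"
  by (induction t arbitrary: w) (auto simp: fps_mult_nth fps_partitions_def intro!: sum_nonneg mult_nonneg_nonneg)

lemma fps_conv_radius_partitions: "1 \<le> fps_conv_radius fps_partitions"
  unfolding fps_conv_radius_def
proof (rule conv_radius_geI_ex')
  fix r :: real assume "0 < r" "ereal r < 1"
  then show "summable (\<lambda>n. fps_nth fps_partitions n * of_real r ^ n)"
    using summable_partitions_real[of r] by (simp add: fps_partitions_def)
qed

lemma fps_partitions_power_sums:
  assumes "0 \<le> v" "v < 1"
  shows "(\<lambda>w. fps_nth (fps_partitions ^ t) w * v ^ w) sums (pgf v ^ t)"
proof -
  have v: "ereal (norm v) < fps_conv_radius fps_partitions"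
    using fps_conv_radius_partitions assms by (metis abs_of_nonneg ereal_less(3) order_less_le_trans real_norm_def)
  then have "ereal (norm v) < fps_conv_radius (fps_partitions ^ t)"
    using fps_conv_radius_power order_less_le_trans by blast
  from sums_eval_fps[OF this] eval_fps_power[OF v, of t] show ?thesis
    by (simp add: eval_fps_def pgf_def fps_partitions_def)
qed

text \<open>Covers P_t, where k is the partition numbers, and H_t, where k is the coefficients of
  the t-th power. For fixed M the sizes M + t w are distinct and each contributes k w * b M objects,
  so b M * q ^ M * Kq is at most \<open>pgf q\<close>. Hence each b M is bounded separately, and no
  generating function of b has to be summed.\<close>

lemma chernoff_coefficient:
  fixes a :: "nat \<Rightarrow> nat \<Rightarrow> real" and b k :: "nat \<Rightarrow> real"
  assumes t: "0 < t" and q: "0 < q" "q < 1"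
    and a: "\<And>n w. a n w = (if t * w \<le> n then k w * b (n - t * w) else 0)"
    and ap: "\<And>n w. a n w \<le> real (num_partitions n)"
    and k: "\<And>w. 0 \<le> k w" and b: "\<And>n. 0 \<le> b n"
    and K: "(\<lambda>w. k w * (q ^ t) ^ w) sums Kq" and Kpos: "0 < Kq"
    and s: "0 \<le> s" and Ks: "(\<lambda>w. k w * (s * q ^ t) ^ w) sums Ksq"
  shows "(\<Sum>w\<le>N. a N w * s ^ w) \<le> pgf q / q ^ N * (Ksq / Kq)"
proof -
  have pg: "(\<lambda>n. real (num_partitions n) * q ^ n) sums pgf q" using pgf_sums[of q] q by simp
  have bM: "b M * q ^ M * Kq \<le> pgf q" for M
  proof -
    have "(\<Sum>w<W. b M * q ^ M * (k w * (q ^ t) ^ w)) \<le> pgf q" for W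
    proof -
      have pw: "q ^ (M + t * w) = q ^ M * (q ^ t) ^ w" for w by (simp add: power_add power_mult)
      have inj: "inj_on (\<lambda>w. M + t * w) {..<W}" using t by (auto simp: inj_on_def)
      have "(\<Sum>w<W. b M * q ^ M * (k w * (q ^ t) ^ w)) = (\<Sum>w<W. a (M + t * w) w * q ^ (M + t * w))"
        unfolding pw by (intro sum.cong refl) (simp add: a)
      also have "\<dots> \<le> (\<Sum>w<W. real (num_partitions (M + t * w)) * q ^ (M + t * w))"
        using ap q by (intro sum_mono mult_right_mono) auto
      also have "\<dots> = (\<Sum>n\<in>(\<lambda>w. M + t * w) ` {..<W}. real (num_partitions n) * q ^ n)"
        using inj by (simp add: sum.reindex)
      also have "\<dots> \<le> (\<Sum>n. real (num_partitions n) * q ^ n)"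
        using q sums_summable[OF pg] by (intro sum_le_suminf) auto
      finally show ?thesis using sums_unique[OF pg] by simp
    qed
    then have "(\<Sum>w. b M * q ^ M * (k w * (q ^ t) ^ w)) \<le> pgf q"
      by (intro suminf_le_const sums_summable[OF sums_mult[OF K]]) auto
    then show ?thesis using sums_unique[OF sums_mult[OF K, of "b M * q ^ M"]] by simp
  qed
  have aN: "a N w * s ^ w \<le> pgf q / (q ^ N * Kq) * (k w * (s * q ^ t) ^ w)" for w
  proof (cases "t * w \<le> N")
    case True
    have qN: "q ^ N = q ^ (N - t * w) * (q ^ t) ^ w"
      using True by (simp add: power_mult[symmetric] power_add[symmetric])
    have "b (N - t * w) \<le> pgf q / (q ^ (N - t * w) * Kq)"
      using bM[of "N - t * w"] q Kpos by (simp add: pos_le_divide_eq mult.assoc)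
    then have "k w * s ^ w * b (N - t * w) \<le> k w * s ^ w * (pgf q / (q ^ (N - t * w) * Kq))"
      using k s by (intro mult_left_mono) auto
    also have "\<dots> = pgf q / (q ^ N * Kq) * (k w * (s * q ^ t) ^ w)"
      unfolding qN using q Kpos by (simp add: power_mult_distrib field_simps)
    finally show ?thesis using True by (simp add: a mult_ac)
  next
    case False
    have "0 \<le> pgf q" using bM[of 0] b[of 0] Kpos q by (meson mult_nonneg_nonneg order_trans less_imp_le zero_le_power)
    then show ?thesis using False k s q Kpos by (simp add: a)
  qed
  have "(\<Sum>w\<le>N. a N w * s ^ w) \<le> (\<Sum>w\<le>N. pgf q / (q ^ N * Kq) * (k w * (s * q ^ t) ^ w))"
    by (intro sum_mono aN)
  also have "\<dots> = pgf q / (q ^ N * Kq) * (\<Sum>w\<le>N. k w * (s * q ^ t) ^ w)"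
    by (simp add: sum_distrib_left)
  also have "\<dots> \<le> pgf q / (q ^ N * Kq) * Ksq"
  proof (rule mult_left_mono)
    have "(\<Sum>w\<le>N. k w * (s * q ^ t) ^ w) \<le> (\<Sum>w. k w * (s * q ^ t) ^ w)"
      using k s q by (intro sum_le_suminf sums_summable[OF Ks]) auto
    then show "(\<Sum>w\<le>N. k w * (s * q ^ t) ^ w) \<le> Ksq" using sums_unique[OF Ks] by simp
    have "0 \<le> pgf q" using bM[of 0] b[of 0] Kpos q by (meson mult_nonneg_nonneg order_trans less_imp_le zero_le_power)
    then show "0 \<le> pgf q / (q ^ N * Kq)" using q Kpos by simp
  qed
  finally show ?thesis by (simp add: field_simps)
qed

lemma sum_by_value:
  fixes f :: "'a \<Rightarrow> nat" and g :: "nat \<Rightarrow> real"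
  assumes "finite A" "\<And>x. x \<in> A \<Longrightarrow> f x \<le> N"
  shows "(\<Sum>x\<in>A. g (f x)) = (\<Sum>w\<le>N. real (card {x \<in> A. f x = w}) * g w)"
proof -
  have "(\<Sum>x\<in>A. g (f x)) = (\<Sum>w\<le>N. \<Sum>x\<in>{x \<in> A. f x = w}. g (f x))"
    by (rule sum.group[symmetric]) (use assms in auto)
  also have "\<dots> = (\<Sum>w\<le>N. real (card {x \<in> A. f x = w}) * g w)" by (intro sum.cong) auto
  finally show ?thesis .
qed

lemma card_mult_weight_partitions:
  "0 < t \<Longrightarrow> card {mu \<in> partitions N. mult_weight t (mset mu) = v} =
    (if t * v \<le> N then num_partitions v * parts_in {x. \<not> t dvd x} (N - t * v) else 0)"
  using card_partitions_mset[of N "\<lambda>M. mult_weight t M = v"] card_mult_weight[of t N v] by simp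

lemma mult_weight_le:
  assumes "0 < t" "mu \<in> partitions N" shows "t * mult_weight t (mset mu) \<le> N"
proof (rule ccontr)
  assume "\<not> t * mult_weight t (mset mu) \<le> N"
  then have "card {nu \<in> partitions N. mult_weight t (mset nu) = mult_weight t (mset mu)} = 0"
    using card_mult_weight_partitions[OF assms(1)] by simp
  then show False using assms(2) by auto
qed

lemma hooks_div_le: "lam \<in> partitions N \<Longrightarrow> hooks_div t lam \<le> N"
proof -
  assume "lam \<in> partitions N"
  then have "card (boxes lam) = N" by (simp add: card_boxes partitions_def)
  moreover have "card {u \<in> boxes lam. t dvd hook lam u} \<le> card (boxes lam)"
    by (intro card_mono) auto
  ultimately show ?thesis by (simp add: hooks_div_def)
qed

definition bad_pairs :: "nat \<Rightarrow> nat \<Rightarrow> (nat list \<times> nat list) set" where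
  "bad_pairs N t = {(lam, mu). lam \<in> partitions N \<and> mu \<in> partitions N \<and> hooks_div t lam < mult_weight t (mset mu)}"

lemma finite_bad_pairs [simp]: "finite (bad_pairs N t)"
  by (rule finite_subset[of _ "partitions N \<times> partitions N"]) (auto simp: bad_pairs_def)

text \<open>Markov's inequality for exp (u (P_t - H_t)). The sum over pairs factors, and for each of
  the two statistics the sum at size N is at most a Boltzmann expectation times
  \<open>pgf q / q ^ N\<close>, hence the square.\<close>

lemma card_bad_pairs_chernoff:
  fixes y u :: real
  assumes t: "0 < t" and y: "0 < y" and u: "0 \<le> u" "u < y * real t"
  defines "x \<equiv> y * real t"
  shows "real (card (bad_pairs N t)) \<le> (pgf (exp (- y)) * exp (y * real N))\<^sup>2 *
    (pgf (exp (- (x - u))) / pgf (exp (- x)) * (pgf (exp (- (x + u))) / pgf (exp (- x))) ^ t)"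
proof -
  define q where "q = exp (- y)"
  have q: "0 < q" "q < 1" using y by (auto simp: q_def)
  have x: "0 < x" using y t by (simp add: x_def)
  have qt: "q ^ t = exp (- x)" by (simp add: q_def x_def exp_of_nat_mult[symmetric] mult.commute)
  have qN: "1 / q ^ N = exp (y * real N)"
    by (simp add: q_def exp_of_nat_mult[symmetric] exp_minus field_simps)
  have sq1: "exp u * q ^ t = exp (- (x - u))" and sq2: "exp (- u) * q ^ t = exp (- (x + u))"
    by (simp_all add: qt exp_add[symmetric])
  have ux: "u < x" using u by (simp add: x_def)
  let ?w = "\<lambda>mu. mult_weight t (mset mu)"
  have A: "(\<Sum>mu\<in>partitions N. exp u ^ ?w mu) \<le> pgf q / q ^ N * (pgf (exp (- (x - u))) / pgf (exp (- x)))"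
  proof -
    let ?a = "\<lambda>n v. real (card {mu \<in> partitions n. ?w mu = v})"
    have "?w mu \<le> N" if "mu \<in> partitions N" for mu
    proof -
      have "1 * ?w mu \<le> t * ?w mu" using t by (intro mult_le_mono1) simp
      then show ?thesis using mult_weight_le[OF t that] by linarith
    qed
    then have "(\<Sum>mu\<in>partitions N. exp u ^ ?w mu) = (\<Sum>w\<le>N. ?a N w * exp u ^ w)"
      by (intro sum_by_value[of _ ?w N "\<lambda>w. exp u ^ w"]) auto
    also have "\<dots> \<le> pgf q / q ^ N * (pgf (exp (- (x - u))) / pgf (exp (- x)))"
    proof (rule chernoff_coefficient[OF t q, where k = "\<lambda>v. real (num_partitions v)" and b = "\<lambda>n. real (parts_in {x. \<not> t dvd x} n)"])
      show "?a n w = (if t * w \<le> n then real (num_partitions w) * real (parts_in {x. \<not> t dvd x} (n - t * w)) else 0)" for n w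
        using card_mult_weight_partitions[OF t, of n w] by simp
      show "?a n w \<le> real (num_partitions n)" for n w
        unfolding num_partitions_def of_nat_le_iff by (intro card_mono) auto
      show "(\<lambda>w. real (num_partitions w) * (q ^ t) ^ w) sums pgf (exp (- x))"
        unfolding qt using pgf_sums[of "exp (- x)"] x by simp
      show "(\<lambda>w. real (num_partitions w) * (exp u * q ^ t) ^ w) sums pgf (exp (- (x - u)))"
        unfolding sq1 using pgf_sums[of "exp (- (x - u))"] ux by simp
    qed (use pgf_pos[OF x] in auto)
    finally show ?thesis .
  qed
  have B: "(\<Sum>lam\<in>partitions N. exp (- u) ^ hooks_div t lam) \<le> pgf q / q ^ N * (pgf (exp (- (x + u))) ^ t / pgf (exp (- x)) ^ t)"
  proof -
    let ?a = "\<lambda>n v. real (card {lam \<in> partitions n. hooks_div t lam = v})"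
    have "(\<Sum>lam\<in>partitions N. exp (- u) ^ hooks_div t lam) = (\<Sum>w\<le>N. ?a N w * exp (- u) ^ w)"
      by (intro sum_by_value[of _ "hooks_div t" N "\<lambda>w. exp (- u) ^ w"]) (auto intro: hooks_div_le)
    also have "\<dots> \<le> pgf q / q ^ N * (pgf (exp (- (x + u))) ^ t / pgf (exp (- x)) ^ t)"
    proof (rule chernoff_coefficient[OF t q, where k = "\<lambda>v. fps_nth (fps_partitions ^ t) v" and b = "\<lambda>n. real (cores t n)"])
      show "?a n w = (if t * w \<le> n then fps_nth (fps_partitions ^ t) w * real (cores t (n - t * w)) else 0)" for n w
        by (rule card_hooks_div[OF t])
      show "?a n w \<le> real (num_partitions n)" for n w
        unfolding num_partitions_def of_nat_le_iff by (intro card_mono) auto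
      show "(\<lambda>w. fps_nth (fps_partitions ^ t) w * (q ^ t) ^ w) sums (pgf (exp (- x)) ^ t)"
        unfolding qt using x by (intro fps_partitions_power_sums) auto
      show "(\<lambda>w. fps_nth (fps_partitions ^ t) w * (exp (- u) * q ^ t) ^ w) sums (pgf (exp (- (x + u))) ^ t)"
        unfolding sq2 using x u by (intro fps_partitions_power_sums) auto
    qed (use pgf_pos[OF x] fps_partitions_power_nonneg in auto)
    finally show ?thesis .
  qed
  have "real (card (bad_pairs N t)) = (\<Sum>z\<in>bad_pairs N t. 1)" by simp
  also have "\<dots> \<le> (\<Sum>z\<in>bad_pairs N t. exp (- u) ^ hooks_div t (fst z) * exp u ^ ?w (snd z))"
  proof (rule sum_mono)
    fix z assume z: "z \<in> bad_pairs N t"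
    then have "hooks_div t (fst z) \<le> ?w (snd z)" by (auto simp: bad_pairs_def)
    then have "0 \<le> u * (real (?w (snd z)) - real (hooks_div t (fst z)))" using u by (intro mult_nonneg_nonneg) auto
    then have "1 \<le> exp (u * (real (?w (snd z)) - real (hooks_div t (fst z))))" by simp
    also have "\<dots> = exp (- u) ^ hooks_div t (fst z) * exp u ^ ?w (snd z)"
      by (simp add: exp_of_nat_mult[symmetric] exp_add[symmetric] algebra_simps)
    finally show "1 \<le> exp (- u) ^ hooks_div t (fst z) * exp u ^ ?w (snd z)" .
  qed
  also have "\<dots> \<le> (\<Sum>z\<in>partitions N \<times> partitions N. exp (- u) ^ hooks_div t (fst z) * exp u ^ ?w (snd z))"
    by (intro sum_mono2) (auto simp: bad_pairs_def)
  also have "\<dots> = (\<Sum>lam\<in>partitions N. exp (- u) ^ hooks_div t lam) * (\<Sum>mu\<in>partitions N. exp u ^ ?w mu)"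
    by (simp add: sum_product sum.cartesian_product split_beta)
  also have "\<dots> \<le> (pgf q / q ^ N * (pgf (exp (- (x + u))) ^ t / pgf (exp (- x)) ^ t)) * (pgf q / q ^ N * (pgf (exp (- (x - u))) / pgf (exp (- x))))"
  proof (rule mult_mono[OF B A])
    show "0 \<le> pgf q / q ^ N * (pgf (exp (- (x + u))) ^ t / pgf (exp (- x)) ^ t)"
      by (rule order_trans[OF _ B]) (simp add: sum_nonneg)
  qed (simp add: sum_nonneg)
  also have "\<dots> = (pgf q * (1 / q ^ N))\<^sup>2 * (pgf (exp (- (x - u))) / pgf (exp (- x)) * (pgf (exp (- (x + u))) / pgf (exp (- x))) ^ t)"
    by (simp add: power2_eq_square power_divide mult_ac)
  finally show ?thesis unfolding qN by (simp only: q_def)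
qed

section \<open>Bonferroni inequalities for cores\<close>

definition fps_nonneg :: "real fps \<Rightarrow> bool" where
  "fps_nonneg f \<longleftrightarrow> (\<forall>n. 0 \<le> fps_nth f n)"

lemma fps_nonneg_intros:
  "fps_nonneg 1" "fps_nonneg f \<Longrightarrow> fps_nonneg g \<Longrightarrow> fps_nonneg (f + g)"
  "fps_nonneg f \<Longrightarrow> fps_nonneg g \<Longrightarrow> fps_nonneg (f * g)"
  "fps_nonneg (of_nat k)"
  by (auto simp: fps_nonneg_def fps_mult_nth fps_of_nat[symmetric] intro!: sum_nonneg mult_nonneg_nonneg)

lemma fps_nonneg_power: "fps_nonneg f \<Longrightarrow> fps_nonneg (f ^ n)"
  by (induction n) (auto intro: fps_nonneg_intros)

lemma fps_nonneg_partitions: "fps_nonneg fps_partitions"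
  by (simp add: fps_nonneg_def fps_partitions_def)

text \<open>\<open>(1 - X) \<Prod> 1 / (1 - X ^ n)\<close> counts the partitions without parts equal to 1.\<close>
definition fps_no_ones :: "real fps" where
  "fps_no_ones = fps_partitions * (1 - fps_X)"

lemma fps_no_ones_nth:
  "fps_nth fps_no_ones n = real (num_partitions n) - (if n = 0 then 0 else real (num_partitions (n - 1)))"
  by (simp add: fps_no_ones_def right_diff_distrib fps_partitions_def)

lemma fps_nonneg_no_ones: "fps_nonneg fps_no_ones"
  unfolding fps_nonneg_def fps_no_ones_nth
proof
  fix n show "0 \<le> real (num_partitions n) - (if n = 0 then 0 else real (num_partitions (n - 1)))"
    using num_partitions_mono[of "n - 1" n] by simp
qed

lemma num_partitions_1: "num_partitions 1 = 1"
  using parts_in_greaterThan_rec[of 0 1] parts_in_greaterThan_small[of 1 1]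
  by (simp add: parts_in_greaterThan_0)

text \<open>A union bound for coefficients: if not all t factors are 1, one of them comes from
  \<open>fps_no_ones - 1\<close>, and the others are dominated by \<open>fps_partitions\<close>.
  Allowing the full power t, not only t - 1, is what lets \<open>cores_ge_bonferroni\<close> turn
  cores times this power back into partitions.\<close>

lemma no_ones_power_le:
  "fps_nonneg (of_nat t * (fps_no_ones - 1) * fps_partitions ^ t - (fps_no_ones ^ t - 1))"
proof (induction t)
  case 0
  then show ?case by (simp add: fps_nonneg_def)
next
  case (Suc t)
  let ?P = fps_partitions and ?Q = fps_no_ones
  have Q1: "fps_nonneg (?Q - 1)"
    unfolding fps_nonneg_def
  proof
    fix n show "0 \<le> fps_nth (?Q - 1) n"
      using num_partitions_mono[of "n - 1" n] by (simp add: fps_no_ones_nth)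
  qed
  have PQ: "fps_nonneg (?P - ?Q)"
    using num_partitions_mono[of "n - 1" n for n]
    unfolding fps_nonneg_def by (simp add: fps_no_ones_nth fps_partitions_def)
  have P1: "fps_nonneg (?P ^ Suc t - 1)"
  proof -
    have "fps_nth (?P ^ Suc t) 0 = 1" by (simp only: fps_power_zeroth) (simp add: fps_partitions_def)
    then show ?thesis using fps_nonneg_power[OF fps_nonneg_partitions, of "Suc t"]
      by (auto simp: fps_nonneg_def)
  qed
  have "of_nat (Suc t) * (?Q - 1) * ?P ^ Suc t - (?Q ^ Suc t - 1) =
      ?Q * (of_nat t * (?Q - 1) * ?P ^ t - (?Q ^ t - 1))
      + of_nat t * (?Q - 1) * ?P ^ t * (?P - ?Q) + (?Q - 1) * (?P ^ Suc t - 1)"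
    by (simp add: algebra_simps)
  moreover have "fps_nonneg \<dots>"
    by (intro fps_nonneg_intros Suc fps_nonneg_no_ones Q1 PQ P1 fps_nonneg_power fps_nonneg_partitions)
  ultimately show ?case by simp
qed

text \<open>What results from multiplying the partition series by (1 - z^t)^r, for r = t the leading
  factor of the core product. It is close to p(N) (1 - exp (- y t))^r.\<close>

definition bonferroni :: "nat \<Rightarrow> nat \<Rightarrow> nat \<Rightarrow> real" where
  "bonferroni N t r = (\<Sum>k\<le>r. (- 1) ^ k * real (r choose k) * real (pd N (t * k)))"

text \<open>Cores and partitions are related by a series in z^t, so the residue classes of sizes mod
  t separate. U and V list the partitions and the cores in the class of N, with X standing for
  z^t.\<close>

lemma residue_class_fps:
  fixes t N r :: nat
  assumes t: "0 < t"
  defines "U \<equiv> Abs_fps (\<lambda>i. real (num_partitions (N mod t + t * i)))"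
    and "V \<equiv> Abs_fps (\<lambda>i. real (cores t (N mod t + t * i)))"
  shows "U = V * fps_partitions ^ t"
    and "fps_nth (U * (1 - fps_X) ^ r) (N div t) = bonferroni N t r"
    and "\<And>k. k \<le> N div t \<Longrightarrow> fps_nth U (N div t - k) = real (pd N (t * k))"
    and "fps_nth V (N div t) = real (cores t N)"
proof -
  let ?s = "N mod t"
  show "U = V * fps_partitions ^ t"
  proof (rule fps_ext)
    fix i
    let ?n = "?s + t * i"
    have iff: "t * w \<le> ?n \<longleftrightarrow> w \<le> i" for w
    proof
      assume "t * w \<le> ?n"
      then have "t * w < t + t * i" using mod_less_divisor[OF t, of N] by linarith
      then have "t * w < t * Suc i" by (simp only: mult_Suc_right)
      then have "w < Suc i" by (simp only: mult_less_cancel1)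
      then show "w \<le> i" by simp
    next
      assume "w \<le> i"
      then have "t * w \<le> t * i" by simp
      then show "t * w \<le> ?n" by linarith
    qed
    have "i \<le> ?n" using t iff[of i] by (metis dual_order.trans le_add2 mult_le_mono1 Suc_leI mult_1 One_nat_def)
    have "real (num_partitions ?n) = (\<Sum>lam\<in>partitions ?n. 1)" by (simp add: num_partitions_def)
    also have "\<dots> = (\<Sum>w\<le>?n. real (card {lam \<in> partitions ?n. hooks_div t lam = w}) * 1)"
      by (rule sum_by_value[of _ "hooks_div t" _ "\<lambda>_. 1"]) (auto intro: hooks_div_le)
    also have "\<dots> = (\<Sum>w\<le>?n. if t * w \<le> ?n then fps_nth (fps_partitions ^ t) w * real (cores t (?n - t * w)) else 0)"
      by (simp only: card_hooks_div[OF t] mult_1_right)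
    also have "\<dots> = (\<Sum>w\<le>i. fps_nth (fps_partitions ^ t) w * real (cores t (?n - t * w)))"
      using \<open>i \<le> ?n\<close> by (intro sum.mono_neutral_cong_right) (auto simp: iff)
    also have "\<dots> = (\<Sum>w\<le>i. fps_nth (fps_partitions ^ t) w * fps_nth V (i - w))"
      by (intro sum.cong refl) (simp add: V_def diff_mult_distrib2)
    also have "\<dots> = fps_nth (fps_partitions ^ t * V) i" by (simp add: fps_mult_nth atMost_atLeast0)
    finally show "fps_nth U i = fps_nth (V * fps_partitions ^ t) i" by (simp add: U_def mult.commute)
  qed
  have N: "N = ?s + t * (N div t)" by simp
  show U: "fps_nth U (N div t - k) = real (pd N (t * k))" if "k \<le> N div t" for k
  proof -
    have "t * k \<le> t * (N div t)" using that by simp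
    then have le: "t * k \<le> N" using N by linarith
    have "?s + t * (N div t - k) = N - t * k" using \<open>t * k \<le> t * (N div t)\<close> N by (simp add: diff_mult_distrib2)
    then show ?thesis using le by (simp add: U_def pd_def)
  qed
  show "fps_nth V (N div t) = real (cores t N)" by (simp add: V_def)
  have "(1 - fps_X) ^ r = (\<Sum>k\<le>r. of_nat (r choose k) * (- fps_X) ^ k * 1 ^ (r - k) :: real fps)"
    using binomial_ring[of "- fps_X" "1 :: real fps" r] by simp
  also have "\<dots> = (\<Sum>k\<le>r. fps_const ((- 1) ^ k * real (r choose k)) * fps_X ^ k)"
  proof (intro sum.cong refl)
    fix k
    have "(- fps_X) ^ k = fps_const ((- 1) ^ k) * (fps_X :: real fps) ^ k"
      by (subst power_minus) (simp add: fps_const_power[symmetric] fps_const_neg[symmetric] del: fps_const_neg)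
    then show "of_nat (r choose k) * (- fps_X) ^ k * 1 ^ (r - k) = fps_const ((- 1) ^ k * real (r choose k)) * (fps_X :: real fps) ^ k"
      by (simp add: fps_of_nat[symmetric] fps_const_mult[symmetric] mult_ac del: fps_const_mult)
  qed
  finally have "U * (1 - fps_X) ^ r = (\<Sum>k\<le>r. fps_const ((- 1) ^ k * real (r choose k)) * (U * fps_X ^ k))"
    by (simp add: sum_distrib_left mult_ac)
  then have "fps_nth (U * (1 - fps_X) ^ r) (N div t) = (\<Sum>k\<le>r. (- 1) ^ k * real (r choose k) * fps_nth (U * fps_X ^ k) (N div t))"
    by (simp add: fps_sum_nth)
  also have "\<dots> = bonferroni N t r"
    unfolding bonferroni_def
  proof (intro sum.cong refl arg_cong2[of _ _ _ _ "(*)"])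
    fix k
    show "fps_nth (U * fps_X ^ k) (N div t) = real (pd N (t * k))"
    proof (cases "k \<le> N div t")
      case True
      then show ?thesis using U[OF True] by (simp add: fps_X_power_mult_right_nth)
    next
      case False
      then have "N div t < k" by simp
      then have "N < t * k" using t by (simp add: div_less_iff_less_mult mult.commute)
      then show ?thesis using False by (simp add: fps_X_power_mult_right_nth pd_def)
    qed
  qed
  finally show "fps_nth (U * (1 - fps_X) ^ r) (N div t) = bonferroni N t r" .
qed

text \<open>Dropping \<open>t - r\<close> of the factors \<open>1 - X\<close> preserves the upper bound, since what remains
  has nonnegative coefficients; this makes the alternating sum usable when \<open>t\<close> is too large.\<close>
lemma cores_le_bonferroni:
  assumes t: "0 < t" and r: "r \<le> t"
  shows "real (cores t N) \<le> bonferroni N t r"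
proof -
  define U V where "U = Abs_fps (\<lambda>i. real (num_partitions (N mod t + t * i)))"
    and "V = Abs_fps (\<lambda>i. real (cores t (N mod t + t * i)))"
  note res = residue_class_fps[OF t, where N = N, folded U_def V_def]
  let ?S = "fps_partitions ^ (t - r) * fps_no_ones ^ r"
  have "fps_partitions ^ t = fps_partitions ^ (t - r) * fps_partitions ^ r"
    using r by (simp add: power_add[symmetric])
  then have "U * (1 - fps_X) ^ r = V * ?S"
    unfolding res(1) fps_no_ones_def power_mult_distrib by (simp add: mult_ac)
  then have "bonferroni N t r = fps_nth (V * ?S) (N div t)" using res(2)[of r] by simp
  also have "\<dots> = (\<Sum>i=0..N div t. fps_nth V i * fps_nth ?S (N div t - i))" by (rule fps_mult_nth)
  also have "\<dots> \<ge> (\<Sum>i\<in>{N div t}. fps_nth V i * fps_nth ?S (N div t - i))"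
  proof (rule sum_mono2)
    have "fps_nonneg ?S"
      by (intro fps_nonneg_intros fps_nonneg_power fps_nonneg_partitions fps_nonneg_no_ones)
    then show "0 \<le> fps_nth V i * fps_nth ?S (N div t - i)" for i
      by (simp add: fps_nonneg_def V_def)
  qed auto
  moreover have "fps_nth ?S 0 = 1"
    unfolding fps_mult_nth_0 fps_power_zeroth by (simp add: fps_partitions_def fps_no_ones_nth)
  ultimately show ?thesis using res(4) by simp
qed

text \<open>The left-out factors 1 - z^(2t), 1 - z^(3t), ... show up as Q^t - 1 with Q =
  \<open>fps_no_ones\<close>, which by the union bound costs at most t (Q - 1) U. Since Q - 1 starts
  in degree 2, this error is of second order in exp (- y t).\<close>

lemma cores_ge_bonferroni:
  assumes t: "0 < t"
  shows "bonferroni N t t - real t * (\<Sum>v=2..N. real (num_partitions v) * real (pd N (t * v))) \<le> real (cores t N)"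
proof -
  define U V where "U = Abs_fps (\<lambda>i. real (num_partitions (N mod t + t * i)))"
    and "V = Abs_fps (\<lambda>i. real (cores t (N mod t + t * i)))"
  note res = residue_class_fps[OF t, where N = N, folded U_def V_def]
  let ?P = fps_partitions and ?Q = fps_no_ones and ?n = "N div t"
  have "U * (1 - fps_X) ^ t = V * ?Q ^ t"
    unfolding res(1) fps_no_ones_def power_mult_distrib by (simp add: mult_ac)
  then have "bonferroni N t t = fps_nth (V * ?Q ^ t) ?n" using res(2)[of t] by simp
  then have 1: "bonferroni N t t - real (cores t N) = fps_nth (V * (?Q ^ t - 1)) ?n"
    using res(4) by (simp add: right_diff_distrib)
  have "fps_nonneg (V * (of_nat t * (?Q - 1) * ?P ^ t - (?Q ^ t - 1)))"
    by (intro fps_nonneg_intros no_ones_power_le) (simp add: fps_nonneg_def V_def)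
  also have "V * (of_nat t * (?Q - 1) * ?P ^ t - (?Q ^ t - 1)) = of_nat t * ((?Q - 1) * U) - V * (?Q ^ t - 1)"
    unfolding res(1) by (simp add: algebra_simps)
  finally have "fps_nth (V * (?Q ^ t - 1)) ?n \<le> fps_nth (of_nat t * ((?Q - 1) * U)) ?n"
    by (simp add: fps_nonneg_def)
  also have "\<dots> = real t * fps_nth ((?Q - 1) * U) ?n" by (simp add: fps_of_nat[symmetric] del: fps_of_nat)
  also have "fps_nth ((?Q - 1) * U) ?n = (\<Sum>v=0..?n. fps_nth (?Q - 1) v * real (pd N (t * v)))"
    unfolding fps_mult_nth by (intro sum.cong refl arg_cong2[of _ _ _ _ "(*)"] res(3)) auto
  also have "\<dots> \<le> (\<Sum>v=0..?n. if 2 \<le> v then real (num_partitions v) * real (pd N (t * v)) else 0)"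
  proof (rule sum_mono)
    fix v :: nat
    consider "v = 0" | "v = 1" | "2 \<le> v" by linarith
    then show "fps_nth (?Q - 1) v * real (pd N (t * v)) \<le> (if 2 \<le> v then real (num_partitions v) * real (pd N (t * v)) else 0)"
    proof cases
      case 2
      then have "fps_nth (?Q - 1) v = 0" using num_partitions_1 by (simp add: fps_no_ones_nth)
      then show ?thesis using 2 by simp
    qed (simp_all add: fps_no_ones_nth mult_right_mono)
  qed
  also have "\<dots> \<le> (\<Sum>v=2..N. real (num_partitions v) * real (pd N (t * v)))"
    unfolding sum.inter_filter[symmetric, OF finite_atLeastAtMost]
    by (intro sum_mono2) (auto intro: order_trans[OF _ div_le_dividend])
  finally have "bonferroni N t t - real (cores t N) \<le> real t * (\<Sum>v=2..N. real (num_partitions v) * real (pd N (t * v)))"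
    using 1 by (simp add: mult_left_mono)
  then show ?thesis by simp
qed

text \<open>Either some t j with j \<ge> 2 is a part, or t occurs twice. The second case is counted
  by p(N - 2 t), which is the j = 2 term again, hence the factor 2.\<close>

lemma card_mult_weight_ge_2:
  assumes t: "0 < t"
  shows "card {mu \<in> partitions N. 2 \<le> mult_weight t (mset mu)} \<le> 2 * (\<Sum>j=2..N. pd N (t * j))"
proof -
  let ?A = "\<lambda>j. {mu \<in> partitions N. t * j \<in> set mu}"
  let ?B = "{mu \<in> partitions N. {#t, t#} \<subseteq># mset mu}"
  have "{mu \<in> partitions N. 2 \<le> mult_weight t (mset mu)} \<subseteq> ?B \<union> (\<Union>j\<in>{2..N}. ?A j)"
  proof
    fix mu assume "mu \<in> {mu \<in> partitions N. 2 \<le> mult_weight t (mset mu)}"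
    then have mu: "mu \<in> partitions N" and w: "2 \<le> mult_weight t (mset mu)" by auto
    show "mu \<in> ?B \<union> (\<Union>j\<in>{2..N}. ?A j)"
    proof (cases "\<exists>j\<in>{2..N}. t * j \<in> set mu")
      case True
      then show ?thesis using mu by blast
    next
      case False
      let ?F = "filter_mset (\<lambda>x. t dvd x) (mset mu)"
      have eq: "x = t" if "x \<in># ?F" for x
      proof -
        have x: "x \<in> set mu" "t dvd x" using that by auto
        then obtain j where j: "x = t * j" by blast
        have "0 < x" "x \<le> N" using x mu member_le_sum_list[of x mu] by (auto simp: partitions_def)
        moreover have "j \<le> t * j" using t by simp
        ultimately have "0 < j" "j \<le> N" using j by (simp, linarith)
        moreover have "j \<notin> {2..N}" using False x j by blast
        ultimately have "j = 1" by simp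
        then show ?thesis using j by simp
      qed
      have F: "?F = replicate_mset (size ?F) t"
        using eq by (intro set_mset_subset_singletonD) blast
      have "mult_weight t (mset mu) = size ?F"
        unfolding mult_weight_def by (subst F) (use t in simp)
      then obtain k where "size ?F = Suc (Suc k)" using w by (metis Suc_le_D numeral_2_eq_2 Suc_le_mono)
      then have "{#t, t#} \<subseteq># ?F" by (subst F) simp
      then show ?thesis using mu multiset_filter_subset subset_mset.order_trans by blast
    qed
  qed
  then have "card {mu \<in> partitions N. 2 \<le> mult_weight t (mset mu)} \<le> card (?B \<union> (\<Union>j\<in>{2..N}. ?A j))"
    by (intro card_mono) auto
  also have "\<dots> \<le> card ?B + (\<Sum>j\<in>{2..N}. card (?A j))"
    by (rule order_trans[OF card_Un_le]) (intro add_left_mono card_UN_le, simp)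
  also have "\<dots> = pd N (t * 2) + (\<Sum>j\<in>{2..N}. pd N (t * j))"
    using card_containing2[OF t t, of N] card_containing[of "t * j" N for j] t by (simp add: mult_2_right)
  also have "pd N (t * 2) \<le> (\<Sum>j\<in>{2..N}. pd N (t * j))"
  proof (cases "2 \<le> N")
    case True
    then show ?thesis by (intro member_le_sum) auto
  next
    case False
    then have "\<not> t * 2 \<le> N" using t by (cases t) auto
    then show ?thesis by (simp add: pd_def)
  qed
  finally show ?thesis by simp
qed

section \<open>Estimates at the saddle point\<close>

lemma geometric_exp_tail:
  assumes c: "0 < c" "c \<le> (1::real)"
  shows "(\<Sum>t=T..M. exp (- (c * real t))) \<le> exp (- (c * real T)) * (2 / c)"
proof -
  have r: "exp (- c) < 1" "0 < exp (- c)" using c by auto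
  have "exp (- c) \<le> 1 / (1 + c)"
    using exp_ge_add_one_self[of c] c by (simp add: exp_minus field_simps)
  moreover have "1 - 1 / (1 + c) = c / (1 + c)" using c by (simp add: field_simps)
  moreover have "c / 2 \<le> c / (1 + c)" using c by (intro divide_left_mono) auto
  ultimately have c2: "c / 2 \<le> 1 - exp (- c)" by linarith
  have s: "(\<lambda>i. exp (- c) ^ i) sums (1 / (1 - exp (- c)))" using r by (intro geometric_sums) auto
  have "(\<Sum>t=T..M. exp (- (c * real t))) \<le> (\<Sum>t=T..<T + Suc M. exp (- (c * real t)))"
    by (intro sum_mono2) auto
  also have "\<dots> = (\<Sum>i<Suc M. exp (- (c * real T)) * exp (- c) ^ i)"
    by (simp add: sum.atLeastLessThan_shift_0[of _ T] lessThan_atLeast0 exp_of_nat_mult[symmetric] exp_add[symmetric] algebra_simps)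
  also have "\<dots> = exp (- (c * real T)) * (\<Sum>i<Suc M. exp (- c) ^ i)" by (simp only: sum_distrib_left)
  also have "\<dots> \<le> exp (- (c * real T)) * (1 / (1 - exp (- c)))"
    unfolding sums_unique[OF s] using sums_summable[OF s] by (intro mult_left_mono sum_le_suminf) auto
  also have "\<dots> \<le> exp (- (c * real T)) * (1 / (c / 2))"
    using c c2 r by (intro mult_left_mono divide_left_mono mult_pos_pos) auto
  finally show ?thesis by simp
qed

text \<open>Both sums telescope, since \<open>exp (- a exp (- y t))\<close> has derivative
  \<open>a y exp (- y t) exp (- a exp (- y t))\<close>.\<close>
lemma gumbel_sum_le:
  assumes a: "0 < a" and y: "0 < (y::real)"
  shows "(\<Sum>t=T..M. exp (- (y * real t)) * exp (- (a * exp (- (y * real t))))) \<le> (1 + y) / (a * y)"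
proof -
  define E where "E t = exp (- (a * exp (- (y * real t))))" for t
  have "1 - exp (- y) > 0" using y by simp
  have "exp (- y) \<le> 1 / (1 + y)"
    using exp_ge_add_one_self[of y] y by (simp add: exp_minus field_simps)
  then have y1: "y / (1 + y) \<le> 1 - exp (- y)" using y by (simp add: field_simps)
  have step: "exp (- (y * real t)) * E t \<le> (E (Suc t) - E t) / (a * (1 - exp (- y)))" for t
  proof -
    let ?e = "exp (- (y * real t))"
    have eS: "exp (- (y * real (Suc t))) = ?e * exp (- y)" by (simp add: exp_add[symmetric] algebra_simps)
    have "E (Suc t) = exp (- (a * ?e) + a * ?e * (1 - exp (- y)))"
      unfolding E_def eS by (simp add: right_diff_distrib mult.assoc)
    then have "E (Suc t) = E t * exp (a * ?e * (1 - exp (- y)))"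
      unfolding E_def by (simp only: exp_add)
    moreover have "1 + a * ?e * (1 - exp (- y)) \<le> exp (a * ?e * (1 - exp (- y)))" by (rule exp_ge_add_one_self)
    then have "E t * (1 + a * ?e * (1 - exp (- y))) \<le> E t * exp (a * ?e * (1 - exp (- y)))"
      by (intro mult_left_mono) (auto simp: E_def)
    ultimately have "?e * E t * (a * (1 - exp (- y))) \<le> E (Suc t) - E t" by (simp add: algebra_simps)
    then show ?thesis using a y by (simp add: pos_le_divide_eq)
  qed
  have E01: "0 \<le> E t" "E t \<le> 1" for t using a by (auto simp: E_def)
  have nn: "0 \<le> exp (- (y * real t)) * E t" for t using E01 by simp
  have "(\<Sum>t=T..M. exp (- (y * real t)) * E t) \<le> (\<Sum>t<Suc M. exp (- (y * real t)) * E t)"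
    by (intro sum_mono2) (auto simp: E_def)
  also have "\<dots> \<le> (\<Sum>t<Suc M. (E (Suc t) - E t) / (a * (1 - exp (- y))))"
    by (intro sum_mono step)
  also have "\<dots> = (E (Suc M) - E 0) / (a * (1 - exp (- y)))"
    unfolding sum_divide_distrib[symmetric] sum_lessThan_telescope ..
  also have "\<dots> \<le> 1 / (a * (1 - exp (- y)))"
    using E01[of "Suc M"] E01[of 0] a y by (intro divide_right_mono) auto
  also have "\<dots> \<le> 1 / (a * (y / (1 + y)))"
    using a y y1 by (intro divide_left_mono mult_left_mono mult_pos_pos) auto
  finally show ?thesis using a y by (simp add: E_def)
qed

lemma gumbel_sum_ge:
  assumes a: "0 < a" and y: "0 < y" "y \<le> (1::real)" and TM: "T \<le> M"
  shows "(exp (- (a * exp (- (y * real M)))) - exp (- (a * exp (- (y * real T))))) / (a * (y * (1 + y)))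
    \<le> (\<Sum>t=T..M. exp (- (y * real t)) * exp (- (a * exp (- (y * real t)))))"
proof -
  define E where "E t = exp (- (a * exp (- (y * real t))))" for t
  have y1: "exp y - 1 \<le> y * (1 + y)" using exp_bound[of y] y by (simp add: power2_eq_square algebra_simps)
  have step: "E (Suc t) - E t \<le> a * (y * (1 + y)) * (exp (- (y * real (Suc t))) * E (Suc t))" for t
  proof -
    let ?e = "exp (- (y * real (Suc t)))"
    have eS: "exp (- (y * real t)) = ?e * exp y" by (simp add: exp_add[symmetric] algebra_simps)
    have "E t = exp (- (a * ?e) + - (a * ?e * (exp y - 1)))"
      unfolding E_def eS by (simp add: right_diff_distrib mult.assoc)
    then have Et: "E t = E (Suc t) * exp (- (a * ?e * (exp y - 1)))"
      unfolding E_def by (simp only: exp_add)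
    have "1 + - (a * ?e * (exp y - 1)) \<le> exp (- (a * ?e * (exp y - 1)))" by (rule exp_ge_add_one_self)
    then have "E (Suc t) * (1 - a * ?e * (exp y - 1)) \<le> E t"
      unfolding Et by (intro mult_left_mono) (auto simp: E_def)
    then have "E (Suc t) - E t \<le> a * (exp y - 1) * (?e * E (Suc t))" by (simp add: algebra_simps)
    also have "\<dots> \<le> a * (y * (1 + y)) * (?e * E (Suc t))"
      using a y1 by (intro mult_right_mono mult_left_mono) (auto simp: E_def)
    finally show ?thesis .
  qed
  have tele: "E (T + n) - E T \<le> (\<Sum>t=T..T + n. a * (y * (1 + y)) * (exp (- (y * real t)) * E t))" for n
  proof (induction n)
    case 0
    then show ?case using a y by (simp add: E_def)
  next
    case (Suc n)
    then show ?case using step[of "T + n"] by simp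
  qed
  have "E M - E T \<le> a * (y * (1 + y)) * (\<Sum>t=T..M. exp (- (y * real t)) * E t)"
    using tele[of "M - T"] TM by (simp add: sum_distrib_left)
  then show ?thesis using a y by (simp add: E_def pos_divide_le_eq mult.commute)
qed

text \<open>The conclusions of \<open>partitions_local\<close> for a single N. With y at most 1/16,
  \<open>h = sqrt y\<close> is at most 1/4 and \<open>z\<close> is at least 3/4 of y.\<close>

locale saddle_point =
  fixes C y :: real and N :: nat
  assumes C: "0 < C" and y: "0 < y" "y \<le> 1 / 16"
    and y2: "1 / (3 * real N) \<le> y\<^sup>2" "y\<^sup>2 \<le> 4 / real N" and N: "3 \<le> N"
    and peak: "y powr (3/2) / 128 * pgf (exp (- y)) \<le> real (num_partitions N) * exp (- (y * real N))"
    and ratio: "\<And>j. \<bar>real (pd N j) - exp (- (y * real j)) * real (num_partitions N)\<bar>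
        \<le> C * real j * y powr (3/2) * exp (- (y * real j)) * real (num_partitions N)"
begin

abbreviation p where "p \<equiv> real (num_partitions N)"
abbreviation L where "L \<equiv> - ln y"
abbreviation h where "h \<equiv> sqrt y"
abbreviation e where "e t \<equiv> exp (- (y * real t))"
text \<open>Slightly smaller than \<open>y\<close>, so that \<open>pd_le\<close> below holds uniformly in \<open>j\<close>.\<close>
definition z where "z = y * (1 - h)"
abbreviation e' where "e' t \<equiv> exp (- (z * real t))"

lemma p_pos: "0 < p" using num_partitions_pos by simp

lemma powr_32: "y powr (3/2) = y * h"
proof -
  have "y powr (3/2) = y powr (1 + 1/2)" by simp
  also have "\<dots> = y powr 1 * y powr (1/2)" by (rule powr_add)
  finally show ?thesis using y by (simp add: powr_half_sqrt)
qed

lemma h: "0 < h" "h \<le> 1 / 4"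
proof -
  show "0 < h" using y by simp
  have "h \<le> sqrt (1 / 16)" using y by (intro real_sqrt_le_mono) auto
  also have "sqrt (1 / 16) = sqrt ((1 / 4)\<^sup>2)" by (simp add: power2_eq_square)
  finally show "h \<le> 1 / 4" by simp
qed

lemma z: "y / 2 \<le> z" "0 < z" "z \<le> y"
proof -
  have "y * (1 / 2) \<le> y * (1 - h)" using h y by (intro mult_left_mono) auto
  then show "y / 2 \<le> z" by (simp add: z_def)
  then show "0 < z" using y by simp
  show "z \<le> y" using h y by (simp add: z_def algebra_simps)
qed

lemma pd_ge: "e t * p * (1 - C * h * (y * real t)) \<le> real (pd N t)"
  and pd_le1: "real (pd N t) \<le> e t * p * (1 + C * h * (y * real t))"
  using ratio[of t] unfolding powr_32 by (auto simp: abs_le_iff algebra_simps)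

text \<open>The linear growth of the relative error is absorbed into the rate by 1 + C s \<le> (1 +
  C) exp s with s = h y j.\<close>

lemma pd_le: "real (pd N j) \<le> (1 + C) * p * e' j"
proof -
  let ?s = "h * (y * real j)"
  have s: "0 \<le> ?s" using h y by simp
  have "1 + C * ?s \<le> (1 + C) * (1 + ?s)" using C s by (simp add: algebra_simps)
  also have "\<dots> \<le> (1 + C) * exp ?s" using C by (intro mult_left_mono exp_ge_add_one_self) auto
  finally have "e j * p * (1 + C * ?s) \<le> e j * p * ((1 + C) * exp ?s)" by (intro mult_left_mono) auto
  also have "\<dots> = (1 + C) * p * e' j"
    unfolding z_def by (simp add: exp_add[symmetric] mult_ac) (simp add: algebra_simps)
  finally show ?thesis using pd_le1[of j] by (simp add: mult.assoc)
qed

text \<open>Term k has relative error at most C h y t k, and the sum of k binom(r, k) exp (- y t k)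
  is at most m exp m. Against a main term exp (- m) this restricts m to a fraction of L.\<close>

lemma bonferroni_approx:
  fixes t r :: nat
  defines "m \<equiv> real r * e t"
  shows "\<bar>bonferroni N t r - p * (1 - e t) ^ r\<bar> \<le> p * (C * h * (y * real t) * (m * exp m))"
proof -
  have ek: "exp (- (y * real (t * k))) = e t ^ k" for k
    by (simp add: exp_of_nat_mult[symmetric] mult_ac)
  have bin: "(1 - e t) ^ r = (\<Sum>k\<le>r. (- 1) ^ k * real (r choose k) * e t ^ k)"
    using binomial_ring[of "- e t" 1 r] by (simp add: power_minus[of "e t"] mult_ac)
  have "bonferroni N t r - p * (1 - e t) ^ r = (\<Sum>k\<le>r. (- 1) ^ k * real (r choose k) * (real (pd N (t * k)) - e t ^ k * p))"
    unfolding bonferroni_def bin by (simp add: sum_subtractf[symmetric] sum_distrib_left algebra_simps)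
  also have "\<bar>\<dots>\<bar> \<le> (\<Sum>k\<le>r. \<bar>(- 1) ^ k * real (r choose k) * (real (pd N (t * k)) - e t ^ k * p)\<bar>)"
    by (rule sum_abs)
  also have "\<dots> = (\<Sum>k\<le>r. real (r choose k) * \<bar>real (pd N (t * k)) - e t ^ k * p\<bar>)"
    by (simp add: abs_mult power_abs)
  also have "\<dots> \<le> (\<Sum>k\<le>r. real (r choose k) * (C * real (t * k) * (y * h) * e t ^ k * p))"
  proof (intro sum_mono mult_left_mono)
    fix k
    show "\<bar>real (pd N (t * k)) - e t ^ k * p\<bar> \<le> C * real (t * k) * (y * h) * e t ^ k * p"
      using ratio[of "t * k"] unfolding ek powr_32 .
  qed simp
  also have "\<dots> = p * (C * h * (y * real t)) * (\<Sum>k\<le>r. real k * real (r choose k) * e t ^ k)"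
    unfolding sum_distrib_left by (intro sum.cong refl) (simp only: of_nat_mult mult_ac)
  also have "(\<Sum>k\<le>r. real k * real (r choose k) * e t ^ k) \<le> m * exp m"
  proof -
    have "(\<Sum>k\<le>r. real k * real (r choose k) * e t ^ k) = e t * (\<Sum>k\<le>r. real k * real (r choose k) * e t ^ (k - 1) * 1 ^ (r - k))"
      unfolding sum_distrib_left
    proof (intro sum.cong refl)
      fix k
      show "real k * real (r choose k) * e t ^ k = e t * (real k * real (r choose k) * e t ^ (k - 1) * 1 ^ (r - k))"
        by (cases k) simp_all
    qed
    also have "\<dots> = e t * (real r * (e t + 1) ^ (r - 1))"
      using binomial_deriv1[of r "e t" 1] by simp
    finally have S: "(\<Sum>k\<le>r. real k * real (r choose k) * e t ^ k) = e t * (real r * (e t + 1) ^ (r - 1))" .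
    have "(e t + 1) ^ (r - 1) \<le> (e t + 1) ^ r" by (intro power_increasing) auto
    also have "(e t + 1) ^ r \<le> exp (e t) ^ r"
      using exp_ge_add_one_self[of "e t"] by (intro power_mono) (auto simp: add.commute intro: add_nonneg_nonneg)
    also have "exp (e t) ^ r = exp m" by (simp add: m_def exp_of_nat_mult[symmetric])
    finally have "(e t * real r) * (e t + 1) ^ (r - 1) \<le> (e t * real r) * exp m"
      by (intro mult_left_mono) auto
    then show ?thesis unfolding S by (simp add: m_def mult_ac)
  qed
  finally show ?thesis using C h y by (simp add: mult_left_mono mult.assoc)
qed

lemma one_minus_power_le: "(1 - e t) ^ r \<le> exp (- (real r * e t))"
proof -
  have "(1 - e t) ^ r \<le> exp (- e t) ^ r"
    using exp_ge_add_one_self[of "- e t"] y by (intro power_mono) auto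
  then show ?thesis by (simp add: exp_of_nat_mult[symmetric])
qed

lemma one_minus_power_ge:
  assumes "e t \<le> 1 / 2"
  shows "exp (- (real r * e t)) - real r * (e t)\<^sup>2 \<le> (1 - e t) ^ r"
proof -
  let ?d = "exp (- e t) - (1 - e t)"
  have d0: "1 - e t \<le> exp (- e t)" using exp_ge_add_one_self[of "- e t"] by simp
  have "exp (- e t) \<le> 1 / (1 + e t)"
    using exp_ge_add_one_self[of "e t"] by (simp add: exp_minus inverse_eq_divide add_pos_pos frac_le)
  also have "\<dots> \<le> 1 - e t + (e t)\<^sup>2"
  proof -
    have "1 \<le> (1 - e t + (e t)\<^sup>2) * (1 + e t)" by (simp add: power2_eq_square algebra_simps)
    then show ?thesis by (simp add: pos_divide_le_eq add_pos_pos)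
  qed
  finally have d: "exp (- e t) - (1 - e t) \<le> (e t)\<^sup>2" by simp
  have "exp (- e t) ^ r - (1 - e t) ^ r \<le> real r * (e t)\<^sup>2"
  proof (induction r)
    case (Suc r)
    have "0 \<le> 1 - e t" using assms by linarith
    moreover have "1 - e t \<le> 1" by simp
    ultimately have a: "0 \<le> (1 - e t) ^ r" "(1 - e t) ^ r \<le> 1" by (simp_all only: zero_le_power power_le_one)
    have "exp (- e t) ^ Suc r - (1 - e t) ^ Suc r = exp (- e t) * (exp (- e t) ^ r - (1 - e t) ^ r) + (exp (- e t) - (1 - e t)) * (1 - e t) ^ r"
      by (simp add: algebra_simps)
    also have "\<dots> \<le> 1 * (real r * (e t)\<^sup>2) + (e t)\<^sup>2 * 1"
    proof (intro add_mono mult_mono)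
      have "(1 - e t) ^ r \<le> exp (- e t) ^ r" using d0 \<open>0 \<le> 1 - e t\<close> by (rule power_mono)
      then show "0 \<le> exp (- e t) ^ r - (1 - e t) ^ r" by simp
    qed (use Suc d d0 a in auto)
    finally show ?case by (simp add: algebra_simps)
  qed simp
  then show ?thesis by (simp add: exp_of_nat_mult[symmetric])
qed

lemma cores_upper:
  assumes "0 < t" "r \<le> t"
  shows "real (cores t N) \<le> p * (exp (- (real r * e t)) + C * h * (y * real t) * (real r * e t * exp (real r * e t)))"
proof -
  have "real (cores t N) \<le> bonferroni N t r" by (rule cores_le_bonferroni[OF assms])
  also have "\<dots> \<le> p * (1 - e t) ^ r + p * (C * h * (y * real t) * (real r * e t * exp (real r * e t)))"
    using bonferroni_approx[of t r] by (simp add: abs_le_iff)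
  also have "\<dots> \<le> p * exp (- (real r * e t)) + p * (C * h * (y * real t) * (real r * e t * exp (real r * e t)))"
    by (intro add_right_mono mult_left_mono one_minus_power_le) auto
  finally show ?thesis by (simp add: distrib_left)
qed

text \<open>As 2 \<open>e' t\<close> is at most 1, its powers from the second on are at most its
  square; the remaining factors 2^(-v), weighted with the partition numbers, sum to at most
  \<open>pgf (1 / 2)\<close>.\<close>

lemma sum_partitions_pd_le:
  assumes t: "e' t \<le> 1 / 2"
  shows "(\<Sum>v=2..N. real (num_partitions v) * real (pd N (t * v))) \<le> 4 * (1 + C) * pgf (1 / 2) * p * (e' t)\<^sup>2"
proof -
  have s: "(\<lambda>v. real (num_partitions v) * (1 / 2) ^ v) sums pgf (1 / 2)" using pgf_sums[of "1 / 2 :: real"] by simp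
  have "real (num_partitions v) * real (pd N (t * v)) \<le> 4 * (1 + C) * p * (e' t)\<^sup>2 * (real (num_partitions v) * (1 / 2) ^ v)"
    if v: "2 \<le> v" for v
  proof -
    have "exp (- (z * real (t * v))) = (1 / 2) ^ v * (2 * e' t) ^ v"
      by (simp add: exp_of_nat_mult[symmetric] power_mult_distrib[symmetric] mult_ac)
    also have "(2 * e' t) ^ v \<le> (2 * e' t)\<^sup>2"
      using t v by (intro power_decreasing) auto
    finally have "exp (- (z * real (t * v))) \<le> (1 / 2) ^ v * (4 * (e' t)\<^sup>2)" by (simp add: power_mult_distrib)
    then have "(1 + C) * p * exp (- (z * real (t * v))) \<le> (1 + C) * p * ((1 / 2) ^ v * (4 * (e' t)\<^sup>2))"
      using C by (intro mult_left_mono) auto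
    then have "real (pd N (t * v)) \<le> (1 + C) * p * ((1 / 2) ^ v * (4 * (e' t)\<^sup>2))"
      using pd_le[of "t * v"] by linarith
    then have "real (num_partitions v) * real (pd N (t * v)) \<le> real (num_partitions v) * ((1 + C) * p * ((1 / 2) ^ v * (4 * (e' t)\<^sup>2)))"
      by (intro mult_left_mono) auto
    then show ?thesis by (simp only: mult_ac)
  qed
  then have "(\<Sum>v=2..N. real (num_partitions v) * real (pd N (t * v))) \<le> (\<Sum>v=2..N. 4 * (1 + C) * p * (e' t)\<^sup>2 * (real (num_partitions v) * (1 / 2) ^ v))"
    by (intro sum_mono) auto
  also have "\<dots> = 4 * (1 + C) * p * (e' t)\<^sup>2 * (\<Sum>v=2..N. real (num_partitions v) * (1 / 2) ^ v)"
    by (simp add: sum_distrib_left)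
  also have "\<dots> \<le> 4 * (1 + C) * p * (e' t)\<^sup>2 * pgf (1 / 2)"
    unfolding sums_unique[OF s] using C sums_summable[OF s] by (intro mult_left_mono sum_le_suminf) auto
  finally show ?thesis by (simp add: mult_ac)
qed

lemma cores_lower:
  assumes t: "0 < t" and et: "e' t \<le> 1 / 2"
  shows "p * (exp (- (real t * e t)) - C * h * (y * real t) * (real t * e t * exp (real t * e t))
      - real t * (1 + 4 * (1 + C) * pgf (1 / 2)) * (e' t)\<^sup>2) \<le> real (cores t N)"
proof -
  let ?R = "C * h * (y * real t) * (real t * e t * exp (real t * e t))"
  have ee: "e t \<le> e' t" using z by (simp add: mult_right_mono)
  have "e t \<le> 1 / 2" using ee et by linarith
  then have "p * (exp (- (real t * e t)) - real t * (e t)\<^sup>2) \<le> p * (1 - e t) ^ t"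
    by (intro mult_left_mono one_minus_power_ge) auto
  moreover have "p * (1 - e t) ^ t - p * ?R \<le> bonferroni N t t"
    using bonferroni_approx[of t t] by (simp add: abs_le_iff)
  moreover have "p * (real t * (e t)\<^sup>2) \<le> p * (real t * (e' t)\<^sup>2)"
    using ee by (intro mult_left_mono power_mono) auto
  moreover have "real t * (\<Sum>v=2..N. real (num_partitions v) * real (pd N (t * v))) \<le> real t * (4 * (1 + C) * pgf (1 / 2) * p * (e' t)\<^sup>2)"
    by (intro mult_left_mono sum_partitions_pd_le et) auto
  moreover have "bonferroni N t t - real t * (\<Sum>v=2..N. real (num_partitions v) * real (pd N (t * v))) \<le> real (cores t N)"
    by (rule cores_ge_bonferroni[OF t])
  ultimately show ?thesis by (simp add: algebra_simps)
qed

end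

section \<open>Covering the zeros\<close>

lemma sum_image_mset_remove:
  fixes f :: "'a \<Rightarrow> nat"
  assumes "x \<in># A"
  shows "sum_mset (image_mset f A) = f x + sum_mset (image_mset f (A - {#x#}))"
  using arg_cong[OF insert_DiffM[OF assms], of "\<lambda>A. sum_mset (image_mset f A)"]
  by (simp only: image_mset_add_mset sum_mset.add_mset)

lemma mult_weight_1_imp_member:
  assumes t: "0 < t" and M: "0 \<notin># M" and w: "mult_weight t M = 1"
  shows "t \<in># M"
proof -
  let ?F = "filter_mset (\<lambda>x. t dvd x) M"
  have "?F \<noteq> {#}"
  proof
    assume "?F = {#}"
    then have "mult_weight t M = 0" unfolding mult_weight_def by (simp only: image_mset_empty sum_mset.empty)
    then show False using w by simp
  qed
  then obtain x where x: "x \<in># ?F" by blast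
  then have xM: "x \<in># M" "t dvd x" by auto
  have "mult_weight t M = x div t + sum_mset (image_mset (\<lambda>x. x div t) (?F - {#x#}))"
    unfolding mult_weight_def by (rule sum_image_mset_remove[OF x])
  then have "x div t \<le> 1" using w by simp
  moreover have "x \<noteq> 0" using xM M by metis
  then have "x div t \<noteq> 0" using xM t by (auto elim!: dvdE)
  ultimately have "x div t = 1" by simp
  then have "x = t" using xM by (metis dvd_mult_div_cancel mult.right_neutral)
  then show ?thesis using xM by simp
qed

lemma mult_weight_pos:
  assumes t: "t \<in># M" "0 < t" shows "1 \<le> mult_weight t M"
proof -
  have x: "t \<in># filter_mset (\<lambda>x. t dvd x) M" using t by simp
  have "mult_weight t M = t div t + sum_mset (image_mset (\<lambda>x. x div t) (filter_mset (\<lambda>x. t dvd x) M - {#t#}))"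
    unfolding mult_weight_def by (rule sum_image_mset_remove[OF x])
  then show ?thesis using t by simp
qed

lemma zero_III_iff:
  "zero_III lam mu \<longleftrightarrow> (\<exists>t\<ge>1. hooks_div t lam < mult_weight t (mset mu))"
  unfolding zero_III_def using P_t_eq_mult_weight[of t mu for t] by (auto simp: Suc_le_eq)

lemma mult_weight_part_1: "mu \<in> partitions N \<Longrightarrow> mult_weight 1 (mset mu) = N"
  by (simp add: mult_weight_def partitions_def sum_mset_sum_list)

lemma hooks_div_1_part: "lam \<in> partitions N \<Longrightarrow> hooks_div 1 lam = N"
  using hooks_div_1[of lam] by (simp add: partitions_def)

definition zeros :: "(nat list \<Rightarrow> nat list \<Rightarrow> bool) \<Rightarrow> nat \<Rightarrow> (nat list \<times> nat list) set" where
  "zeros Z N = {(lam, mu). lam \<in> partitions N \<and> mu \<in> partitions N \<and> Z lam mu}"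

lemma count_zeros_eq: "count_zeros Z N = card (zeros Z N)"
  by (simp add: count_zeros_def zeros_def)

lemma finite_zeros [simp]: "finite (zeros Z N)"
  by (rule finite_subset[of _ "partitions N \<times> partitions N"]) (auto simp: zeros_def)

lemma partition_part_pos: "mu \<in> partitions N \<Longrightarrow> t \<in> set mu \<Longrightarrow> 0 < t"
  by (auto simp: partitions_def)

lemma partition_part_le: "mu \<in> partitions N \<Longrightarrow> t \<in> set mu \<Longrightarrow> t \<le> N"
  using member_le_sum_list[of t mu] by (auto simp: partitions_def)

lemma zeros_II_subset_III: "zeros zero_II N \<subseteq> zeros zero_III N"
proof
  fix x assume "x \<in> zeros zero_II N"
  then obtain lam mu t where x: "x = (lam, mu)" "lam \<in> partitions N" "mu \<in> partitions N" "t \<in> set mu" "is_core t lam"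
    by (auto simp: zeros_def zero_II_def)
  then have "0 < t" using partition_part_pos by blast
  moreover have "hooks_div t lam < mult_weight t (mset mu)"
    using mult_weight_pos[of t "mset mu"] x \<open>0 < t\<close> by (simp add: is_core_def)
  ultimately show "x \<in> zeros zero_III N" using x zero_III_iff[of lam mu] by (auto simp: zeros_def Suc_le_eq)
qed

lemma partition_first:
  assumes "mu \<in> partitions N" "0 < N"
  shows "mu ! 0 \<in> set mu" "\<And>t. t \<in> set mu \<Longrightarrow> t \<le> mu ! 0"
proof -
  have ne: "mu \<noteq> []" using assms by (auto simp: partitions_def)
  then show "mu ! 0 \<in> set mu" by simp
  fix t assume "t \<in> set mu"
  then obtain i where "i < length mu" "t = mu ! i" by (auto simp: in_set_conv_nth)
  then show "t \<le> mu ! 0" using assms by (cases i) (auto simp: partitions_def sorted_wrt_iff_nth_less)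
qed

lemma zeros_I_subset_II: "0 < N \<Longrightarrow> zeros zero_I N \<subseteq> zeros zero_II N"
  using partition_first(1) by (fastforce simp: zeros_def zero_I_def zero_II_def)

text \<open>If t is a part of mu and lam is a t-core, then P_t \<ge> 1 > 0 = H_t, so small t fall
  under the bad pairs. The value t = 1 cannot occur, because \<open>hooks_div 1 lam\<close> is
  N.\<close>

lemma zeros_II_subset:
  assumes N: "0 < N"
  shows "zeros zero_II N \<subseteq> (\<Union>t\<in>{2..<T}. bad_pairs N t) \<union>
    (\<Union>t\<in>{T..N}. {lam \<in> partitions N. is_core t lam} \<times> {mu \<in> partitions N. t \<in> set mu})"
proof
  fix x assume "x \<in> zeros zero_II N"
  then obtain lam mu t where x: "x = (lam, mu)" "lam \<in> partitions N" "mu \<in> partitions N" "t \<in> set mu" "is_core t lam"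
    by (auto simp: zeros_def zero_II_def)
  have t: "0 < t" "t \<le> N" using x partition_part_pos partition_part_le by blast+
  have "t \<noteq> 1" using hooks_div_1_part[OF x(2)] x(5) N by (auto simp: is_core_def)
  then have "2 \<le> t" using t by simp
  moreover have "hooks_div t lam < mult_weight t (mset mu)"
    using mult_weight_pos[of t "mset mu"] x t by (simp add: is_core_def)
  ultimately show "x \<in> (\<Union>t\<in>{2..<T}. bad_pairs N t) \<union>
    (\<Union>t\<in>{T..N}. {lam \<in> partitions N. is_core t lam} \<times> {mu \<in> partitions N. t \<in> set mu})"
    using x t by (cases "t < T") (auto simp: bad_pairs_def)
qed

text \<open>For t = 1 both statistics equal N, so no zero arises. Where P_t is at least 2 and t
  \<ge> T, the condition on lam is dropped altogether.\<close>

lemma zeros_III_subset: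
  "zeros zero_III N \<subseteq> zeros zero_II N \<union> (\<Union>t\<in>{2..<T}. bad_pairs N t) \<union>
    (\<Union>t\<in>{T..N}. partitions N \<times> {mu \<in> partitions N. 2 \<le> mult_weight t (mset mu)})"
proof
  fix x assume "x \<in> zeros zero_III N"
  then obtain lam mu t where x: "x = (lam, mu)" "lam \<in> partitions N" "mu \<in> partitions N"
    and t: "1 \<le> t" and lt: "hooks_div t lam < mult_weight t (mset mu)"
    by (auto simp: zeros_def zero_III_iff)
  have "t \<noteq> 1" using hooks_div_1_part[OF x(2)] mult_weight_part_1[OF x(3)] lt by auto
  then have t2: "2 \<le> t" using t by simp
  have "t * 1 \<le> t * mult_weight t (mset mu)" using lt by (intro mult_le_mono2) simp
  also have "\<dots> \<le> N" using t x by (intro mult_weight_le) auto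
  finally have tN: "t \<le> N" by simp
  show "x \<in> zeros zero_II N \<union> (\<Union>t\<in>{2..<T}. bad_pairs N t) \<union>
    (\<Union>t\<in>{T..N}. partitions N \<times> {mu \<in> partitions N. 2 \<le> mult_weight t (mset mu)})"
  proof (cases "t < T \<or> 2 \<le> mult_weight t (mset mu)")
    case True
    then show ?thesis using x t2 tN lt by (cases "t < T") (auto simp: bad_pairs_def)
  next
    case False
    then have "mult_weight t (mset mu) = 1" "hooks_div t lam = 0" using lt by auto
    moreover have "0 \<notin># mset mu" using x by (auto simp: partitions_def)
    ultimately have "t \<in> set mu" using mult_weight_1_imp_member[of t "mset mu"] t by simp
    then show ?thesis using x \<open>hooks_div t lam = 0\<close> by (auto simp: zeros_def zero_II_def is_core_def)
  qed
qed

lemma count_II_le: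
  assumes N: "0 < N" and T: "1 \<le> T"
  shows "real (count_zeros zero_II N) \<le> (\<Sum>t=2..<T. real (card (bad_pairs N t))) + (\<Sum>t=T..N. real (cores t N) * real (pd N t))"
proof -
  let ?B = "\<Union>t\<in>{2..<T}. bad_pairs N t"
  let ?D = "\<lambda>t. {lam \<in> partitions N. is_core t lam} \<times> {mu \<in> partitions N. t \<in> set mu}"
  have "card (zeros zero_II N) \<le> card (?B \<union> (\<Union>t\<in>{T..N}. ?D t))"
    by (rule card_mono[OF _ zeros_II_subset[OF N]]) auto
  also have "\<dots> \<le> card ?B + card (\<Union>t\<in>{T..N}. ?D t)" by (rule card_Un_le)
  also have "\<dots> \<le> (\<Sum>t=2..<T. card (bad_pairs N t)) + (\<Sum>t=T..N. card (?D t))"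
    by (intro add_mono card_UN_le) auto
  also have "(\<Sum>t=T..N. card (?D t)) = (\<Sum>t=T..N. cores t N * pd N t)"
    using T by (intro sum.cong refl) (simp add: card_cartesian_product cores_def card_containing)
  finally have "real (count_zeros zero_II N) \<le> real ((\<Sum>t=2..<T. card (bad_pairs N t)) + (\<Sum>t=T..N. cores t N * pd N t))"
    unfolding count_zeros_eq of_nat_le_iff .
  then show ?thesis by simp
qed

lemma count_III_le:
  "real (count_zeros zero_III N) \<le> real (count_zeros zero_II N) + (\<Sum>t=2..<T. real (card (bad_pairs N t)))
    + (\<Sum>t=T..N. real (num_partitions N) * real (card {mu \<in> partitions N. 2 \<le> mult_weight t (mset mu)}))"
proof -
  let ?B = "\<Union>t\<in>{2..<T}. bad_pairs N t"
  let ?D = "\<lambda>t. partitions N \<times> {mu \<in> partitions N. 2 \<le> mult_weight t (mset mu)}"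
  have "card (zeros zero_III N) \<le> card (zeros zero_II N \<union> ?B \<union> (\<Union>t\<in>{T..N}. ?D t))"
    by (rule card_mono[OF _ zeros_III_subset]) auto
  also have "\<dots> \<le> card (zeros zero_II N \<union> ?B) + card (\<Union>t\<in>{T..N}. ?D t)" by (rule card_Un_le)
  also have "\<dots> \<le> (card (zeros zero_II N) + card ?B) + card (\<Union>t\<in>{T..N}. ?D t)"
    by (intro add_right_mono card_Un_le)
  also have "\<dots> \<le> (card (zeros zero_II N) + (\<Sum>t=2..<T. card (bad_pairs N t))) + (\<Sum>t=T..N. card (?D t))"
    by (intro add_mono card_UN_le) auto
  also have "(\<Sum>t=T..N. card (?D t)) = (\<Sum>t=T..N. num_partitions N * card {mu \<in> partitions N. 2 \<le> mult_weight t (mset mu)})"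
    by (simp add: card_cartesian_product num_partitions_def)
  finally have "real (count_zeros zero_III N) \<le> real ((card (zeros zero_II N) + (\<Sum>t=2..<T. card (bad_pairs N t)))
    + (\<Sum>t=T..N. num_partitions N * card {mu \<in> partitions N. 2 \<le> mult_weight t (mset mu)}))"
    unfolding count_zeros_eq of_nat_le_iff .
  then show ?thesis by (simp add: count_zeros_eq)
qed

text \<open>If t is a part but not the first one, then the first part s exceeds t, and both t and s
  occur.\<close>

lemma card_first_part_ge:
  assumes t: "0 < t" and N: "0 < N"
  shows "real (pd N t) - (\<Sum>s=Suc t..N. real (pd N (t + s))) \<le> real (card {mu \<in> partitions N. mu ! 0 = t})"
proof -
  let ?F = "{mu \<in> partitions N. mu ! 0 = t}"
  let ?G = "\<lambda>s. {mu \<in> partitions N. {#t, s#} \<subseteq># mset mu}"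
  have "{mu \<in> partitions N. t \<in> set mu} \<subseteq> ?F \<union> (\<Union>s\<in>{Suc t..N}. ?G s)"
  proof
    fix mu assume "mu \<in> {mu \<in> partitions N. t \<in> set mu}"
    then have mu: "mu \<in> partitions N" "t \<in> set mu" by auto
    note first = partition_first[OF mu(1) N]
    show "mu \<in> ?F \<union> (\<Union>s\<in>{Suc t..N}. ?G s)"
    proof (cases "mu ! 0 = t")
      case False
      then have "mu ! 0 \<in> {Suc t..N}" using first(2)[OF mu(2)] partition_part_le[OF mu(1) first(1)] by simp
      moreover have "{#t, mu ! 0#} \<subseteq># mset mu"
        using False mu(2) first(1) by (auto simp: insert_subset_eq_iff in_diff_count)
      ultimately show ?thesis using mu(1) by blast
    qed (use mu in simp)
  qed
  then have "card {mu \<in> partitions N. t \<in> set mu} \<le> card (?F \<union> (\<Union>s\<in>{Suc t..N}. ?G s))"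
    by (intro card_mono) auto
  also have "\<dots> \<le> card ?F + card (\<Union>s\<in>{Suc t..N}. ?G s)" by (rule card_Un_le)
  also have "\<dots> \<le> card ?F + (\<Sum>s=Suc t..N. card (?G s))"
    by (intro add_left_mono card_UN_le) auto
  also have "(\<Sum>s=Suc t..N. card (?G s)) = (\<Sum>s=Suc t..N. pd N (t + s))"
    using t by (intro sum.cong refl card_containing2) auto
  finally have "real (pd N t) \<le> real (card ?F + (\<Sum>s=Suc t..N. pd N (t + s)))"
    unfolding card_containing[OF t] of_nat_le_iff .
  then show ?thesis by simp
qed

lemma count_I_ge:
  "(\<Sum>t=T..M. real (cores t N) * real (card {mu \<in> partitions N. mu ! 0 = t})) \<le> real (count_zeros zero_I N)"
proof -
  let ?D = "\<lambda>t. {lam \<in> partitions N. is_core t lam} \<times> {mu \<in> partitions N. mu ! 0 = t}"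
  have "(\<Sum>t=T..M. cores t N * card {mu \<in> partitions N. mu ! 0 = t}) = (\<Sum>t=T..M. card (?D t))"
    by (simp add: card_cartesian_product cores_def)
  also have "\<dots> = card (\<Union>t\<in>{T..M}. ?D t)"
    by (rule card_UN_disjoint[symmetric]) auto
  also have "\<dots> \<le> card (zeros zero_I N)"
    by (rule card_mono[OF finite_zeros]) (auto simp: zeros_def zero_I_def)
  finally have "real (\<Sum>t=T..M. cores t N * card {mu \<in> partitions N. mu ! 0 = t}) \<le> real (count_zeros zero_I N)"
    unfolding count_zeros_eq of_nat_le_iff .
  then show ?thesis by simp
qed

lemma cores_le: "cores t N \<le> num_partitions N"
  unfolding cores_def num_partitions_def by (intro card_mono) auto

section \<open>Upper bounds\<close>

context saddle_point
begin

text \<open>\<open>g\<close> is the fourth root of y, which is the value of exp (- m) at the cutoff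
  m = L / 4 used for cores.\<close>

abbreviation g where "g \<equiv> sqrt h"
abbreviation P2 where "P2 \<equiv> (pgf (1 / 2) :: real)"

lemma exp_L: "exp (- L) = y" "exp (- (L / 2)) = h" "exp (- (L / 4)) = g" "exp (L / 4) = 1 / g"
proof -
  show 1: "exp (- L) = y" using y by simp
  have "(exp (- (L / 2)))\<^sup>2 = y" unfolding exp_double[symmetric] using y by simp
  then show 2: "exp (- (L / 2)) = h" by (metis exp_ge_zero real_sqrt_unique)
  have "(exp (- (L / 4)))\<^sup>2 = h" unfolding exp_double[symmetric] using 2 by simp
  then show 3: "exp (- (L / 4)) = g" by (metis exp_ge_zero real_sqrt_unique)
  show "exp (L / 4) = 1 / g" unfolding 3[symmetric] by (simp add: exp_minus inverse_eq_divide)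
qed

lemma g: "0 < g" using h by simp

lemma pgf_peak: "pgf (exp (- y)) * exp (y * real N) \<le> 128 * p / (y * h)"
proof -
  have "y * h / 128 * pgf (exp (- y)) \<le> p * exp (- (y * real N))" using peak unfolding powr_32 .
  then have "y * h / 128 * pgf (exp (- y)) * exp (y * real N) \<le> p * exp (- (y * real N)) * exp (y * real N)"
    by (intro mult_right_mono) auto
  also have "\<dots> = p" by (simp add: mult.assoc exp_add[symmetric])
  finally show ?thesis using y h by (simp add: field_simps)
qed

lemma card_bad_pairs_tilt:
  assumes t: "0 < t" and u: "0 \<le> u" "u < y * real t"
    and b: "u * mean_size (exp (- (y * real t - u))) - real t * (u * mean_size (exp (- (y * real t + u)))) \<le> b"
  shows "real (card (bad_pairs N t)) \<le> 16384 / y ^ 3 * exp b * p\<^sup>2"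
proof -
  let ?x = "y * real t"
  have q: "0 \<le> pgf (exp (- y)) * exp (y * real N)" using pgf_pos[OF y(1)] by simp
  have "real (card (bad_pairs N t)) \<le> (pgf (exp (- y)) * exp (y * real N))\<^sup>2 *
    (pgf (exp (- (?x - u))) / pgf (exp (- ?x)) * (pgf (exp (- (?x + u))) / pgf (exp (- ?x))) ^ t)"
    using t y u by (intro card_bad_pairs_chernoff)
  also have "\<dots> \<le> (128 * p / (y * h))\<^sup>2 * exp b"
  proof (rule mult_mono)
    show "(pgf (exp (- y)) * exp (y * real N))\<^sup>2 \<le> (128 * p / (y * h))\<^sup>2"
      using pgf_peak q by (intro power_mono)
    have "pgf (exp (- (?x - u))) / pgf (exp (- ?x)) * (pgf (exp (- (?x + u))) / pgf (exp (- ?x))) ^ t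
      \<le> exp (u * mean_size (exp (- (?x - u))) - real t * (u * mean_size (exp (- (?x + u)))))"
      by (rule tilt_bound[OF u])
    also have "\<dots> \<le> exp b" using b by simp
    finally show "pgf (exp (- (?x - u))) / pgf (exp (- ?x)) * (pgf (exp (- (?x + u))) / pgf (exp (- ?x))) ^ t \<le> exp b" .
    have "0 < ?x - u" "0 < ?x" "0 < ?x + u" using u by linarith+
    from this[THEN pgf_pos] show "0 \<le> pgf (exp (- (?x - u))) / pgf (exp (- ?x)) * (pgf (exp (- (?x + u))) / pgf (exp (- ?x))) ^ t"
      by (intro mult_nonneg_nonneg zero_le_power divide_nonneg_nonneg) auto
  qed simp
  also have "(128 * p / (y * h))\<^sup>2 = 16384 / y ^ 3 * p\<^sup>2"
    using y h by (simp add: power_divide power_mult_distrib power3_eq_cube power2_eq_square)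
  finally show ?thesis by (simp add: mult_ac)
qed

text \<open>Three ranges of y t. Up to 1/2 the proportional tilt gives exp (- 1 / (40000 y)). From
  there to L / 2, t exp (- y t) is at least 1 / (2 h). Both bounds are eventually below any power of
  y, and \<open>E1\<close> records what is used. From L / 2 to L - ln 72, t \<ge> L / (2 y) and exp
  (- y t) \<ge> 72 y, whose product is 36 L.\<close>

lemma card_bad_pairs_le:
  assumes t: "2 \<le> t" and x: "y * real t \<le> L - ln 72"
    and E1: "exp (- (1 / (40000 * y))) + exp (16 - 1 / (12 * h)) \<le> y ^ 6"
  shows "real (card (bad_pairs N t)) \<le> 16384 * (1 + exp 16) * y ^ 3 * p\<^sup>2"
proof -
  let ?x = "y * real t"
  have x0: "0 < ?x" using y t by simp
  have "\<exists>b. real (card (bad_pairs N t)) \<le> 16384 / y ^ 3 * exp b * p\<^sup>2 \<and> exp b \<le> (1 + exp 16) * y ^ 6"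
  proof (cases "?x \<le> 1 / 2")
    case True
    obtain u where u: "0 < u" "u < ?x"
      and b: "u * mean_size (exp (- (?x - u))) - real t * (u * mean_size (exp (- (?x + u)))) \<le> - (real t / (40000 * ?x))"
      by (rule tilt_small[OF x0 True t])
    have eq: "real t / (40000 * ?x) = 1 / (40000 * y)" using t by simp
    have "exp (- (real t / (40000 * ?x))) \<le> y ^ 6"
      unfolding eq using E1 exp_ge_zero[of "16 - 1 / (12 * h)"] by linarith
    also have "\<dots> \<le> (1 + exp 16) * y ^ 6" using y by (simp add: algebra_simps)
    finally show ?thesis using card_bad_pairs_tilt[of t u] u b t by (intro exI[of _ "- (real t / (40000 * ?x))"]) auto
  next
    case False
    have b: "1 / 4 * mean_size (exp (- (?x - 1 / 4))) - real t * (1 / 4 * mean_size (exp (- (?x + 1 / 4)))) \<le> 16 - real t * e t / 6"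
      using False by (intro tilt_large) simp
    have "exp (16 - real t * e t / 6) \<le> (1 + exp 16) * y ^ 6"
    proof (cases "?x \<le> L / 2")
      case True
      have "1 / (2 * y) \<le> real t" using False y by (simp add: field_simps)
      moreover have "h \<le> e t" unfolding exp_L(2)[symmetric] using True by simp
      ultimately have "1 / (2 * y) * h \<le> real t * e t" using h y by (intro mult_mono) auto
      moreover have "1 / (2 * y) * h = 1 / (2 * h)" using y h by (simp add: field_simps)
      ultimately have "exp (16 - real t * e t / 6) \<le> exp (16 - 1 / (12 * h))" by simp
      also have "\<dots> \<le> y ^ 6" using E1 exp_ge_zero[of "- (1 / (40000 * y))"] by linarith
      also have "\<dots> \<le> (1 + exp 16) * y ^ 6" using y by (simp add: algebra_simps)
      finally show ?thesis .
    next
      case False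
      then have "L / (2 * y) \<le> real t" using y by (simp add: field_simps)
      moreover have "72 * y \<le> e t"
      proof -
        have "72 * y = exp (ln 72 + - L)" unfolding exp_add exp_L(1) by simp
        also have "\<dots> \<le> e t" using x by simp
        finally show ?thesis .
      qed
      moreover have "0 \<le> L" using y by simp
      ultimately have "L / (2 * y) * (72 * y) \<le> real t * e t" using y by (intro mult_mono) auto
      then have "6 * L \<le> real t * e t / 6" using y by simp
      then have "exp (16 - real t * e t / 6) \<le> exp (16 + 6 * ln y)" by simp
      also have "\<dots> = exp 16 * y ^ 6"
        using y exp_of_nat_mult[of 6 "ln y"] by (simp add: exp_add)
      also have "\<dots> \<le> (1 + exp 16) * y ^ 6" using y by (simp add: algebra_simps)
      finally show ?thesis .
    qed
    then show ?thesis using card_bad_pairs_tilt[of t "1 / 4"] False b t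
      by (intro exI[of _ "16 - real t * e t / 6"]) auto
  qed
  then obtain b where b: "real (card (bad_pairs N t)) \<le> 16384 / y ^ 3 * exp b * p\<^sup>2" "exp b \<le> (1 + exp 16) * y ^ 6" by blast
  have "16384 / y ^ 3 * exp b * p\<^sup>2 \<le> 16384 / y ^ 3 * ((1 + exp 16) * y ^ 6) * p\<^sup>2"
    using b y by (intro mult_right_mono mult_left_mono) auto
  also have "\<dots> = 16384 * (1 + exp 16) * y ^ 3 * p\<^sup>2"
    using y by (simp add: eval_nat_numeral)
  finally show ?thesis using b by linarith
qed

text \<open>Below this threshold \<open>t exp (- y t) \<ge> 36 L\<close>, so that the factor \<open>exp (16 - t exp (- y t) / 6)\<close>
  obtained by tilting is at most \<open>exp 16 y\<^sup>6\<close>.\<close>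
definition T where "T = nat \<lfloor>(L - ln 72) / y\<rfloor> + 1"

lemma T_less: assumes "t < T" "ln 72 \<le> L" shows "y * real t \<le> L - ln 72"
proof -
  have "real t \<le> (L - ln 72) / y" using assms y unfolding T_def by (simp add: less_Suc_eq_le le_nat_floor le_nat_iff le_floor_iff)
  then show ?thesis using y by (simp add: pos_le_divide_eq mult.commute)
qed

lemma T_ge: assumes "T \<le> t" shows "L - ln 72 < y * real t"
proof -
  have "(L - ln 72) / y < real t" using assms unfolding T_def by linarith
  then show ?thesis using y by (simp add: pos_divide_less_eq mult.commute)
qed

lemma sum_bad_pairs_le:
  assumes L72: "ln 72 \<le> L"
    and E1: "exp (- (1 / (40000 * y))) + exp (16 - 1 / (12 * h)) \<le> y ^ 6"
  shows "(\<Sum>t=2..<T. real (card (bad_pairs N t))) \<le> 32768 * (1 + exp 16) * y * p\<^sup>2"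
proof -
  have "(\<Sum>t=2..<T. real (card (bad_pairs N t))) \<le> (\<Sum>t=2..<T. 16384 * (1 + exp 16) * y ^ 3 * p\<^sup>2)"
    using T_less[OF _ L72] by (intro sum_mono card_bad_pairs_le E1) auto
  also have "\<dots> = real (T - 2) * (16384 * (1 + exp 16) * y ^ 3 * p\<^sup>2)" by simp
  \<comment> \<open>A crude count of the values of t, from L \<le> 1 / y; the factor y^3 leaves room
    for it.\<close>
  also have "\<dots> \<le> (2 / y\<^sup>2) * (16384 * (1 + exp 16) * y ^ 3 * p\<^sup>2)"
  proof (rule mult_right_mono)
    have "L \<le> 1 / y"
      using ln_le_minus_one[of "1 / y"] y by (simp add: ln_div)
    moreover have "0 < ln (72 :: real)" by simp
    ultimately have "L - ln 72 \<le> 1 / y" by linarith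
    then have "(L - ln 72) / y \<le> 1 / y / y" using y by (intro divide_right_mono) auto
    moreover have "0 \<le> (L - ln 72) / y" using L72 y by simp
    ultimately have "real (T - 2) \<le> 1 / y / y" unfolding T_def by linarith
    also have "\<dots> \<le> 2 / y\<^sup>2" using y by (simp add: power2_eq_square divide_right_mono)
    finally show "real (T - 2) \<le> 2 / y\<^sup>2" .
    have "0 < 1 + exp (16::real)" by (simp add: add_pos_pos)
    then show "0 \<le> 16384 * (1 + exp 16) * y ^ 3 * p\<^sup>2" using y by simp
  qed
  also have "\<dots> = 32768 * (1 + exp 16) * y * p\<^sup>2" using y by (simp add: eval_nat_numeral)
  finally show ?thesis .
qed

text \<open>Using the rate \<open>z\<close> instead of y costs a factor exp (h X), at most exp
  1.\<close>

lemma e'_le: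
  assumes X: "X \<le> y * real t" and hX: "h * X \<le> 1" 
  shows "e' t \<le> 3 * exp (- X)"
proof -
  have "X * (1 - h) \<le> y * real t * (1 - h)" 
    using X h(2) by (intro mult_right_mono) linarith+
  then have "X - 1 \<le> z * real t" using hX unfolding z_def by (simp add: algebra_simps)
  then have "e' t \<le> exp (1 + - X)" by simp
  also have "\<dots> = exp 1 * exp (- X)" by (rule exp_add)
  also have "\<dots> \<le> 3 * exp (- X)" using exp_le by (intro mult_right_mono) auto
  finally show ?thesis .
qed

lemma e'_T:
  assumes L72: "ln 72 \<le> L" and hL: "h * L \<le> 1" and t: "T \<le> t"
  shows "e' t \<le> 216 * y"
proof -
  have "h * (L - ln 72) \<le> h * L" using h by (intro mult_left_mono) auto
  then have "e' t \<le> 3 * exp (- (L - ln 72))" using T_ge[OF t] hL by (intro e'_le) auto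
  also have "exp (- (L - ln 72)) = exp (- L + ln 72)" by simp
  also have "\<dots> = y * 72" unfolding exp_add exp_L(1) by simp
  finally show ?thesis by simp
qed

text \<open>Beyond \<open>T\<close> the value \<open>e' t\<close> is O(y) and its square decays at
  rate 2 z, so the sum over t is of order y^2 / z, that is O(y).\<close>

lemma sum_card_mult_weight_le:
  assumes L72: "ln 72 \<le> L" and hL: "h * L \<le> 1" and y1: "y \<le> 1 / 1000"
  shows "(\<Sum>t=T..N. p * real (card {mu \<in> partitions N. 2 \<le> mult_weight t (mset mu)})) \<le> 746496 * (1 + C) * P2 * y * p\<^sup>2"
proof -
  have T0: "0 < T" by (simp add: T_def)
  have P20: "0 \<le> P2" using pgf_pos[of "ln 2"] by (simp add: exp_minus)
  have e'_half: "e' t \<le> 1 / 2" if "T \<le> t" for t using e'_T[OF L72 hL that] y1 by linarith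
  have "p * real (card {mu \<in> partitions N. 2 \<le> mult_weight t (mset mu)}) \<le> 8 * (1 + C) * P2 * p\<^sup>2 * exp (- ((2 * z) * real t))"
    if t: "T \<le> t" for t
  proof -
    have "real (card {mu \<in> partitions N. 2 \<le> mult_weight t (mset mu)}) \<le> real (2 * (\<Sum>j=2..N. pd N (t * j)))"
      unfolding of_nat_le_iff using t T0 by (intro card_mult_weight_ge_2) simp
    also have "\<dots> = 2 * (\<Sum>j=2..N. 1 * real (pd N (t * j)))" by simp
    also have "\<dots> \<le> 2 * (\<Sum>j=2..N. real (num_partitions j) * real (pd N (t * j)))"
      using num_partitions_pos by (intro mult_left_mono sum_mono mult_right_mono) (auto simp: Suc_le_eq)
    also have "\<dots> \<le> 2 * (4 * (1 + C) * P2 * p * (e' t)\<^sup>2)"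
      by (intro mult_left_mono sum_partitions_pd_le e'_half t) simp
    also have "(e' t)\<^sup>2 = exp (- ((2 * z) * real t))" by (simp add: exp_double[symmetric] mult.assoc)
    finally have "p * real (card {mu \<in> partitions N. 2 \<le> mult_weight t (mset mu)}) \<le> p * (2 * (4 * (1 + C) * P2 * p * exp (- ((2 * z) * real t))))"
      by (intro mult_left_mono) auto
    then show ?thesis by (simp add: power2_eq_square algebra_simps)
  qed
  then have "(\<Sum>t=T..N. p * real (card {mu \<in> partitions N. 2 \<le> mult_weight t (mset mu)})) \<le>
      (\<Sum>t=T..N. 8 * (1 + C) * P2 * p\<^sup>2 * exp (- ((2 * z) * real t)))" by (intro sum_mono) auto
  also have "\<dots> = 8 * (1 + C) * P2 * p\<^sup>2 * (\<Sum>t=T..N. exp (- ((2 * z) * real t)))" by (simp add: sum_distrib_left)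
  also have "\<dots> \<le> 8 * (1 + C) * P2 * p\<^sup>2 * (93312 * y)"
  proof (rule mult_left_mono)
    have "(\<Sum>t=T..N. exp (- ((2 * z) * real t))) \<le> exp (- ((2 * z) * real T)) * (2 / (2 * z))"
      using z y by (intro geometric_exp_tail) auto
    also have "\<dots> = (e' T)\<^sup>2 * (1 / z)" by (simp add: exp_double[symmetric] mult.assoc)
    also have "\<dots> \<le> (216 * y)\<^sup>2 * (2 / y)"
    proof (intro mult_mono power_mono)
      show "e' T \<le> 216 * y" by (rule e'_T[OF L72 hL]) simp
      have "1 / z \<le> 1 / (y / 2)" using z y by (intro divide_left_mono) auto
      then show "1 / z \<le> 2 / y" by simp
    qed (use z in auto)
    also have "\<dots> = 93312 * y" using y by (simp add: power2_eq_square)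
    finally show "(\<Sum>t=T..N. exp (- ((2 * z) * real t))) \<le> 93312 * y" .
    show "0 \<le> 8 * (1 + C) * P2 * p\<^sup>2" using C P20 by simp
  qed
  finally show ?thesis by (simp add: mult_ac)
qed

text \<open>\<open>eps\<close> bounds the relative error C h y t as long as y t \<le> 2 L.
  \<open>del\<close> is the additive error in the proportion of cores: 3 g comes from the shortened
  product, and the other term is eps m exp m at m = L / 4.\<close>

abbreviation eps where "eps \<equiv> 2 * C * h * L"
abbreviation del where "del \<equiv> 3 * g + eps * (L / 4) / g"

text \<open>If t exp (- y t) exceeds L / 4, use r factors with r exp (- y t) between L / 4 - 1 and L
  / 4. The bound is then only of order g up to powers of L, instead of exp (- t exp (- y t)), but
  that is small enough.\<close>

lemma cores_upper_del:
  assumes t: "0 < t" and x: "y * real t \<le> 2 * L" and L0: "0 < L"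
  shows "real (cores t N) \<le> p * (exp (- (real t * e t)) + del)"
proof -
  have bound: "C * h * (y * real t) * (real r * e t * exp (real r * e t)) \<le> eps * (L / 4) / g" if "real r * e t \<le> L / 4" for r :: nat
  proof -
    have "C * h * (y * real t) * (real r * e t * exp (real r * e t)) \<le> C * h * (2 * L) * (L / 4 * exp (L / 4))"
    proof (rule mult_mono)
      show "C * h * (y * real t) \<le> C * h * (2 * L)" using x C h by (intro mult_left_mono) auto
      show "real r * e t * exp (real r * e t) \<le> L / 4 * exp (L / 4)"
        using that L0 by (intro mult_mono) auto
      show "0 \<le> C * h * (2 * L)" by (intro mult_nonneg_nonneg) (use C h L0 in linarith)+
    qed simp
    also have "\<dots> = eps * (L / 4) / g" unfolding exp_L(4) by simp
    finally show ?thesis .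
  qed
  show ?thesis
  proof (cases "real t * e t \<le> L / 4")
    case True
    have "real (cores t N) \<le> p * (exp (- (real t * e t)) + C * h * (y * real t) * (real t * e t * exp (real t * e t)))"
      by (rule cores_upper[OF t order_refl])
    also have "\<dots> \<le> p * (exp (- (real t * e t)) + del)"
    proof (intro mult_left_mono add_left_mono)
      show "C * h * (y * real t) * (real t * e t * exp (real t * e t)) \<le> del" using bound[OF True] g by linarith
    qed simp
    finally show ?thesis .
  next
    case False
    define r where "r = nat \<lfloor>L / 4 / e t\<rfloor>"
    have "0 \<le> L / 4 / e t" using L0 by (intro divide_nonneg_nonneg) simp_all
    then have r1: "real r \<le> L / 4 / e t" unfolding r_def by (rule of_nat_floor)
    have et0: "0 < e t" by simp
    have r2: "real r * e t \<le> L / 4" using r1 by (simp only: pos_le_divide_eq[OF et0])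
    have "L / 4 / e t < real r + 1" using L0 unfolding r_def by linarith
    then have "L / 4 < (real r + 1) * e t" by (simp only: pos_divide_less_eq[OF et0])
    moreover have "e t \<le> 1" using y by simp
    ultimately have r3: "L / 4 - 1 \<le> real r * e t" unfolding distrib_right by linarith
    have "L / 4 / e t < real t" using False by (simp only: pos_divide_less_eq[OF et0] not_le)
    then have rt: "r \<le> t" using r1 by linarith
    have "real (cores t N) \<le> p * (exp (- (real r * e t)) + C * h * (y * real t) * (real r * e t * exp (real r * e t)))"
      by (rule cores_upper[OF t rt])
    also have "\<dots> \<le> p * (3 * g + eps * (L / 4) / g)"
    proof (intro mult_left_mono add_mono bound r2)
      have "exp (- (real r * e t)) \<le> exp (1 + - (L / 4))" using r3 by simp
      also have "\<dots> = exp 1 * g" unfolding exp_add exp_L(3) ..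
      also have "\<dots> \<le> 3 * g" using exp_le g by (intro mult_right_mono) auto
      finally show "exp (- (real r * e t)) \<le> 3 * g" .
    qed simp
    also have "\<dots> \<le> p * (exp (- (real t * e t)) + del)" by (intro mult_left_mono) auto
    finally show ?thesis .
  qed
qed

text \<open>Up to y t = 2 L the outer t in the exponent is replaced by its lower bound (L - ln 72) /
  y, which makes the sum telescope. Beyond, cores are bounded by all partitions.\<close>

lemma sum_cores_upper:
  assumes L72: "ln 72 < L"
  shows "(\<Sum>t=T..N. real (cores t N) * real (pd N t)) \<le>
    p\<^sup>2 * ((1 + eps) * ((1 + y) / (L - ln 72) + 144 * del) + 16 * (1 + C) * g)"
proof -
  have "0 < ln (72 :: real)" by simp
  then have L0: "0 < L" using L72 by linarith
  have eps0: "0 \<le> eps" by (intro mult_nonneg_nonneg) (use C h L0 in linarith)+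
  have "0 \<le> eps * (L / 4) / g" using L0 g by (intro divide_nonneg_nonneg mult_nonneg_nonneg[OF eps0]) auto
  then have del0: "0 \<le> del" using g by (intro add_nonneg_nonneg) simp_all
  let ?a = "(L - ln 72) / y"
  have a0: "0 < ?a" using L72 y by simp
  have T0: "0 < T" by (simp add: T_def)
  have tm: "real (cores t N) * real (pd N t) \<le>
    p\<^sup>2 * ((1 + eps) * (e t * exp (- (?a * e t)) + del * e t) + (1 + C) * y * g * exp (- ((y / 8) * real t)))"
    if t: "T \<le> t" for t
  proof (cases "y * real t \<le> 2 * L")
    case True
    have "?a \<le> real t" using T_ge[OF t] y by (simp add: pos_divide_le_eq mult.commute)
    then have "?a * e t \<le> real t * e t" by (rule mult_right_mono) simp
    then have "exp (- (real t * e t)) \<le> exp (- (?a * e t))" by (simp only: exp_le_cancel_iff neg_le_iff_le)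
    then have "p * (exp (- (real t * e t)) + del) \<le> p * (exp (- (?a * e t)) + del)" by (intro mult_left_mono) auto
    then have c: "real (cores t N) \<le> p * (exp (- (?a * e t)) + del)"
      using cores_upper_del[of t] t T0 True L0 by simp
    have "C * h * (y * real t) \<le> C * h * (2 * L)" using C h True by (intro mult_left_mono) auto
    then have "e t * p * (1 + C * h * (y * real t)) \<le> e t * p * (1 + eps)" by (intro mult_left_mono) (auto simp: mult_ac)
    then have d: "real (pd N t) \<le> e t * p * (1 + eps)" using pd_le1[of t] by linarith
    have "real (cores t N) * real (pd N t) \<le> (p * (exp (- (?a * e t)) + del)) * (e t * p * (1 + eps))"
      using c d del0 by (intro mult_mono) (auto intro!: mult_nonneg_nonneg add_nonneg_nonneg)
    also have "\<dots> = p\<^sup>2 * ((1 + eps) * (e t * exp (- (?a * e t)) + del * e t))"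
    proof -
      have "(P * (A + d)) * (E * P * (1 + s)) = P\<^sup>2 * ((1 + s) * (E * A + d * E))" for P A d E s :: real
        by (simp add: power2_eq_square algebra_simps)
      then show ?thesis .
    qed
    also have "\<dots> \<le> p\<^sup>2 * ((1 + eps) * (e t * exp (- (?a * e t)) + del * e t) + (1 + C) * y * g * exp (- ((y / 8) * real t)))"
      using C y g by (intro mult_left_mono) auto
    finally show ?thesis .
  next
    case False
    \<comment> \<open>Of 3/4 y t, the share 5/8 y t exceeds L + L / 4 and yields the factor y g; the
      share y t / 8 is kept for the summation over t.\<close>
    have "3 / 4 * (y * real t) \<le> z * real t"
    proof -
      have "y * (3 / 4) \<le> y * (1 - h)" using h(2) y by (intro mult_left_mono) linarith+
      then have "3 / 4 * y \<le> z" unfolding z_def by (simp only: mult.commute)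
      from mult_right_mono[OF this, of "real t"] show ?thesis by (simp add: mult.assoc)
    qed
    moreover have "L + L / 4 \<le> 5 / 8 * (y * real t)" using False by simp
    ultimately have "e' t \<le> exp (- L + - (L / 4) + - ((y / 8) * real t))" by simp
    also have "\<dots> = y * g * exp (- ((y / 8) * real t))" unfolding exp_add exp_L(1) exp_L(3) ..
    finally have "(1 + C) * p * e' t \<le> (1 + C) * p * (y * g * exp (- ((y / 8) * real t)))"
      using C by (intro mult_left_mono) auto
    then have "real (pd N t) \<le> (1 + C) * p * (y * g * exp (- ((y / 8) * real t)))" using pd_le[of t] by linarith
    moreover have "real (cores t N) \<le> p" using cores_le by simp
    ultimately have "real (cores t N) * real (pd N t) \<le> p * ((1 + C) * p * (y * g * exp (- ((y / 8) * real t))))"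
      by (intro mult_mono) auto
    also have "\<dots> = p\<^sup>2 * ((1 + C) * y * g * exp (- ((y / 8) * real t)))" by (simp add: power2_eq_square mult_ac)
    also have "\<dots> \<le> p\<^sup>2 * ((1 + eps) * (e t * exp (- (?a * e t)) + del * e t) + (1 + C) * y * g * exp (- ((y / 8) * real t)))"
      using eps0 del0 by (intro mult_left_mono) (auto intro!: mult_nonneg_nonneg add_nonneg_nonneg)
    finally show ?thesis .
  qed
  have "(\<Sum>t=T..N. real (cores t N) * real (pd N t)) \<le>
    (\<Sum>t=T..N. p\<^sup>2 * ((1 + eps) * (e t * exp (- (?a * e t)) + del * e t) + (1 + C) * y * g * exp (- ((y / 8) * real t))))"
    using tm by (intro sum_mono) auto
  also have "\<dots> = p\<^sup>2 * ((1 + eps) * ((\<Sum>t=T..N. e t * exp (- (?a * e t))) + del * (\<Sum>t=T..N. e t))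
      + (1 + C) * y * g * (\<Sum>t=T..N. exp (- ((y / 8) * real t))))"
    by (simp only: sum_distrib_left[symmetric] sum.distrib)
  also have "\<dots> \<le> p\<^sup>2 * ((1 + eps) * ((1 + y) / (L - ln 72) + del * 144) + (1 + C) * y * g * (16 / y))"
  proof (intro mult_left_mono add_mono)
    show "(\<Sum>t=T..N. e t * exp (- (?a * e t))) \<le> (1 + y) / (L - ln 72)"
      using gumbel_sum_le[OF a0 y(1), of T N] y by simp
    have "(\<Sum>t=T..N. e t) \<le> e T * (2 / y)" using y by (intro geometric_exp_tail) auto
    also have "e T \<le> exp (- L + ln 72)" using T_ge[of T] by simp
    also have "exp (- L + ln 72) = y * 72" unfolding exp_add exp_L(1) by simp
    finally show "(\<Sum>t=T..N. e t) \<le> 144" using y by (simp add: divide_right_mono mult_right_mono)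
    have "(\<Sum>t=T..N. exp (- ((y / 8) * real t))) \<le> exp (- ((y / 8) * real T)) * (2 / (y / 8))"
      using y by (intro geometric_exp_tail) auto
    also have "\<dots> \<le> 1 * (2 / (y / 8))" using y by (intro mult_right_mono) auto
    finally show "(\<Sum>t=T..N. exp (- ((y / 8) * real t))) \<le> 16 / y" by simp
  qed (use eps0 del0 C y g in auto)
  also have "\<dots> = p\<^sup>2 * ((1 + eps) * ((1 + y) / (L - ln 72) + 144 * del) + 16 * (1 + C) * g)"
    using y by (simp add: mult_ac)
  finally show ?thesis .
qed

end

section \<open>Lower bound\<close>

context saddle_point
begin

text \<open>At y t = \<open>X\<close> the quantity t exp (- y t) is of order 1 / L, so almost all
  partitions are t-cores and what lies beyond is of lower order. Replacing t by \<open>X / y\<close>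
  in the exponent turns 1 / L into 1 / X, at a cost of about 2 ln L / L^2.\<close>

abbreviation X where "X \<equiv> L + 2 * ln L"
abbreviation K where "K \<equiv> 1 + 4 * (1 + C) * P2"
text \<open>The additive error in \<open>cores_lower\<close>: one term from
  \<open>bonferroni_approx\<close> at m = L / 4, one from the second-order terms.\<close>

abbreviation del1 where "del1 \<equiv> eps * (L / 4) / g + 9 / 4 * K * L * y"

text \<open>For \<open>t \<in> {T1..M}\<close>, \<open>c t\<close> is the proportion of t-cores and
  \<open>f t\<close> that of partitions with first part t. The relative loss in \<open>f t\<close>
  through larger parts is of order m / L with m = t exp (- y t); multiplied by the core proportion
  exp (- m), it leads to a second telescoping sum, of total order 1 / L^2.\<close>

lemma sum_first_part_lower:
  assumes lnL: "2 \<le> ln L" and XL: "2 * ln L \<le> L / 2" and hL: "2 * (h * L) \<le> 1"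
    and XN: "X \<le> 1 / (3 * y)" and small: "exp (- (L / 27)) \<le> 1 / L"
  shows "p\<^sup>2 * ((1 - 11 / 2 / L) / (X * (1 + y)) - (del1 + del * (eps + 9 * (1 + C)) + eps + 36 * (1 + C) * (2 * (1 + y) / L) / L))
    \<le> real (count_zeros zero_I N)"
proof -
  have L0: "0 < L" using y by simp
  then have L3: "3 \<le> L" using ln_le_minus_one[OF L0] lnL by linarith
  have X1: "L + 4 \<le> X" and X2: "X \<le> 3 / 2 * L" using lnL XL by auto
  have X0: "0 < X" using X1 L0 by linarith
  have eps0: "0 \<le> eps" by (intro mult_nonneg_nonneg) (use C h L0 in linarith)+
  have "0 \<le> eps * (L / 4) / g" using L0 g by (intro divide_nonneg_nonneg mult_nonneg_nonneg[OF eps0]) auto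
  then have del0: "0 \<le> del" using g by (intro add_nonneg_nonneg) simp_all
  have P20: "0 \<le> P2" using pgf_pos[of "ln 2"] by (simp add: exp_minus)
  have K1: "1 \<le> K" using C P20 by simp
  have C36: "0 \<le> 36 * (1 + C)" using C by simp
  then have cL0: "0 \<le> 36 * (1 + C) / L" using L0 by (intro divide_nonneg_pos)
  \<comment> \<open>From y t = L + 2 on, exp (- y t) \<le> y / 6, and as X \<le> 3/2 L the value m
    stays at most L / 4, so all t factors can be kept. The telescoped sum loses only exp (- L / 27)
    at this end, see \<open>E2\<close>.\<close>
  define T1 where "T1 = nat \<lceil>(L + 2) / y\<rceil>"
  define M where "M = nat \<lfloor>X / y\<rfloor>"
  have fl: "x < real (nat \<lfloor>x\<rfloor>) + 1" and ce: "0 \<le> x \<Longrightarrow> real (nat \<lceil>x\<rceil>) < x + 1" for x :: real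
    by linarith+
  have "0 \<le> (L + 2) / y" using y L0 by (intro divide_nonneg_nonneg) linarith+
  then have t1: "(L + 2) / y \<le> real T1" "real T1 < (L + 2) / y + 1"
    unfolding T1_def using real_nat_ceiling_ge[of "(L + 2) / y"] ce by blast+
  have "0 \<le> X / y" using y X0 by (intro divide_nonneg_nonneg) linarith+
  then have m1: "real M \<le> X / y" "X / y < real M + 1"
    unfolding M_def using of_nat_floor fl by blast+
  have yT: "L + 2 \<le> y * real T1" "y * real T1 \<le> L + 3"
  proof -
    show "L + 2 \<le> y * real T1" using t1(1) y by (simp add: pos_divide_le_eq mult.commute)
    have "y * real T1 \<le> y * ((L + 2) / y + 1)" using t1(2) y by (intro mult_left_mono) auto
    also have "\<dots> = L + 2 + y" using y by (simp add: distrib_left)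
    finally show "y * real T1 \<le> L + 3" using y by linarith
  qed
  have yM: "y * real M \<le> X" "X - y \<le> y * real M"
  proof -
    show "y * real M \<le> X" using m1(1) y by (simp add: pos_le_divide_eq mult.commute)
    have "y * (X / y) \<le> y * (real M + 1)" using m1(2) y by (intro mult_left_mono) auto
    then show "X - y \<le> y * real M" using y by (simp add: distrib_left)
  qed
  have TM: "T1 \<le> M"
  proof -
    have "y * real T1 \<le> y * real M" using yT yM X1 y by linarith
    then show ?thesis using y by simp
  qed
  have MN: "M \<le> N"
  proof -
    have "real M \<le> 1 / (3 * y) / y" using m1(1) XN y by (meson divide_right_mono less_imp_le order_trans)
    also have "\<dots> = 1 / (3 * y\<^sup>2)" by (simp add: power2_eq_square)
    also have "\<dots> \<le> real N"
      using y2(1) N y by (simp add: field_simps)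
    finally show ?thesis by simp
  qed
  have xt: "L + 2 \<le> y * real t" "y * real t \<le> X" "0 < t" if "t \<in> {T1..M}" for t
  proof -
    have "y * real T1 \<le> y * real t" "y * real t \<le> y * real M" using that y by auto
    then show "L + 2 \<le> y * real t" "y * real t \<le> X" using yT yM by linarith+
    then show "0 < t" using L0 by (cases t) auto
  qed
  let ?m = "\<lambda>t. real t * e t"
  have basic: "e t \<le> y" "?m t \<le> L / 4" "e' t \<le> 3 * e t" "e t / y \<le> ?m t / L" if t: "t \<in> {T1..M}" for t
  proof -
    note x = xt[OF t]
    have "e t \<le> exp (- L + - 2)" using x by simp
    also have "\<dots> = y * exp (- 2)" unfolding exp_add exp_L(1) ..
    also have e2: "exp (- 2) \<le> (1 / 6 :: real)"
    proof -
      have "(5 / 2 :: real) \<le> exp 1" using exp_lower_Taylor_quadratic[of 1] by simp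
      then have "(5 / 2 :: real) * (5 / 2) \<le> exp 1 * exp 1" by (intro mult_mono) auto
      then have "6 \<le> exp (2 :: real)" by (simp add: exp_add[symmetric])
      then show ?thesis by (simp add: exp_minus field_simps)
    qed
    finally have et: "e t \<le> y * (1 / 6)" using y by (simp add: mult_left_mono)
    then show "e t \<le> y" using y by linarith
    have "real t \<le> X / y" using x y by (simp add: pos_le_divide_eq mult.commute)
    also have "\<dots> \<le> 3 / 2 * L / y" using X2 y by (intro divide_right_mono) auto
    finally have "?m t \<le> (3 / 2 * L / y) * (y * (1 / 6))" using et by (intro mult_mono) (use L0 y in auto)
    then show "?m t \<le> L / 4" using y by simp
    have "h * (y * real t) \<le> h * (2 * L)" using x X2 L0 h by (intro mult_left_mono) auto
    then have "e' t \<le> 3 * exp (- (y * real t))" using hL by (intro e'_le) auto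
    then show "e' t \<le> 3 * e t" .
    have "e t * L \<le> e t * (y * real t)" using x by (intro mult_left_mono) auto
    then show "e t / y \<le> ?m t / L" using y L0 by (simp add: field_simps)
  qed
  define c where "c t = real (cores t N) / p" for t
  define f where "f t = real (card {mu \<in> partitions N. mu ! 0 = t}) / p" for t
  have c0: "0 \<le> c t" and f0: "0 \<le> f t" for t by (simp_all add: c_def f_def)
  have c_up: "c t \<le> exp (- ?m t) + del" if t: "t \<in> {T1..M}" for t
  proof -
    have "real (cores t N) \<le> p * (exp (- ?m t) + del)"
      using xt[OF t] X2 L0 by (intro cores_upper_del) auto
    then show ?thesis using p_pos by (simp add: c_def pos_divide_le_eq mult.commute)
  qed
  have c_lo: "exp (- ?m t) - del1 \<le> c t" if t: "t \<in> {T1..M}" for t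
  proof -
    note x = xt[OF t] and b = basic[OF t]
    have "e' t \<le> 1 / 2" using b(1,3) y by linarith
    from cores_lower[OF x(3) this]
    have 1: "p * (exp (- ?m t) - C * h * (y * real t) * (?m t * exp (?m t)) - real t * K * (e' t)\<^sup>2) \<le> real (cores t N)" .
    have "C * h * (y * real t) * (?m t * exp (?m t)) \<le> C * h * (2 * L) * (L / 4 * exp (L / 4))"
    proof (rule mult_mono)
      show "C * h * (y * real t) \<le> C * h * (2 * L)" using x X2 C h L0 by (intro mult_left_mono) auto
      show "?m t * exp (?m t) \<le> L / 4 * exp (L / 4)" using b(2) L0 by (intro mult_mono) auto
      show "0 \<le> C * h * (2 * L)" by (intro mult_nonneg_nonneg) (use C h L0 in linarith)+
    qed simp
    also have "\<dots> = eps * (L / 4) / g" unfolding exp_L(4) by simp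
    finally have 2: "C * h * (y * real t) * (?m t * exp (?m t)) \<le> eps * (L / 4) / g" .
    have "(e' t)\<^sup>2 \<le> (3 * e t)\<^sup>2" using b(3) by (intro power_mono) auto
    then have "real t * K * (e' t)\<^sup>2 \<le> real t * K * (3 * e t)\<^sup>2" using K1 by (intro mult_left_mono) auto
    also have "\<dots> = 9 * K * (?m t * e t)" by (simp add: power2_eq_square)
    also have "\<dots> \<le> 9 * K * (L / 4 * y)" using b(1,2) K1 L0 by (intro mult_left_mono mult_mono) auto
    finally have 3: "real t * K * (e' t)\<^sup>2 \<le> 9 / 4 * K * L * y" by simp
    have "exp (- ?m t) - del1 \<le> exp (- ?m t) - C * h * (y * real t) * (?m t * exp (?m t)) - real t * K * (e' t)\<^sup>2"
      using 2 3 by linarith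
    then have "p * (exp (- ?m t) - del1) \<le> real (cores t N)"
      using 1 p_pos by (meson less_imp_le mult_left_mono order_trans)
    then show ?thesis using p_pos by (simp add: c_def pos_le_divide_eq mult.commute)
  qed
  \<comment> \<open>The relative loss: \<open>eps\<close> for replacing p(N - t) by an exponential,
    the rest for the presence of a larger part. The constant is 36 = 9 * 4, from the square of
    \<open>e' t \<le> 3 * e t\<close> and from the sum of \<open>e' s\<close> over s > t, at most
    \<open>e' t * (4 / y)\<close>.\<close>
  let ?w = "\<lambda>t. eps + 36 * (1 + C) * (?m t / L)"
  have f_lo: "e t * (1 - ?w t) \<le> f t" if t: "t \<in> {T1..M}" for t
  proof -
    note x = xt[OF t] and b = basic[OF t]
    have "(\<Sum>s=Suc t..N. real (pd N (t + s))) \<le> (\<Sum>s=Suc t..N. (1 + C) * p * e' t * e' s)"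
    proof (rule sum_mono)
      fix s
      have "e' (t + s) = e' t * e' s" by (simp add: exp_add[symmetric] distrib_left)
      then show "real (pd N (t + s)) \<le> (1 + C) * p * e' t * e' s" using pd_le[of "t + s"] by (simp add: mult.assoc)
    qed
    also have "\<dots> = (1 + C) * p * e' t * (\<Sum>s=Suc t..N. e' s)" by (simp add: sum_distrib_left)
    also have "\<dots> \<le> (1 + C) * p * e' t * (e' t * (4 / y))"
    proof (rule mult_left_mono)
      have "(\<Sum>s=Suc t..N. e' s) \<le> e' (Suc t) * (2 / z)" using z y by (intro geometric_exp_tail) auto
      also have "\<dots> \<le> e' t * (4 / y)"
      proof (intro mult_mono)
        show "e' (Suc t) \<le> e' t" using z by simp
        have "2 / z \<le> 2 / (y / 2)" using z y by (intro divide_left_mono) auto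
        then show "2 / z \<le> 4 / y" by simp
      qed (use z in auto)
      finally show "(\<Sum>s=Suc t..N. e' s) \<le> e' t * (4 / y)" .
      show "0 \<le> (1 + C) * p * e' t" using C by simp
    qed
    also have "\<dots> = (1 + C) * p * (4 / y) * (e' t)\<^sup>2" by (simp add: power2_eq_square)
    also have "\<dots> \<le> (1 + C) * p * (4 / y) * (3 * e t)\<^sup>2"
      using b(3) C y by (intro mult_left_mono power_mono) auto
    also have "\<dots> = p * e t * (36 * (1 + C) * (e t / y))" by (simp add: power2_eq_square)
    also have "\<dots> \<le> p * e t * (36 * (1 + C) * (?m t / L))"
      using b(4) C by (intro mult_left_mono) auto
    finally have 1: "(\<Sum>s=Suc t..N. real (pd N (t + s))) \<le> p * e t * (36 * (1 + C) * (?m t / L))" .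
    have "C * h * (y * real t) \<le> C * h * (2 * L)" using x X2 C h L0 by (intro mult_left_mono) auto
    then have "e t * p * (1 - eps) \<le> e t * p * (1 - C * h * (y * real t))" by (intro mult_left_mono) auto
    then have 2: "e t * p * (1 - eps) \<le> real (pd N t)" using pd_ge[of t] by linarith
    have "p * (e t * (1 - ?w t)) = e t * p * (1 - eps) - p * e t * (36 * (1 + C) * (?m t / L))" by (simp add: algebra_simps)
    also have "\<dots> \<le> real (pd N t) - (\<Sum>s=Suc t..N. real (pd N (t + s)))" using 1 2 by linarith
    also have "\<dots> \<le> real (card {mu \<in> partitions N. mu ! 0 = t})"
      using x(3) N by (intro card_first_part_ge) auto
    finally show ?thesis using p_pos by (simp add: f_def pos_le_divide_eq mult.commute)
  qed
  have tm: "e t * exp (- (X / y * e t)) - e t * (del1 + del * (eps + 9 * (1 + C)) + eps)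
      - 36 * (1 + C) / L * (e t * exp (- (L / (2 * y) * e t))) \<le> c t * f t" if t: "t \<in> {T1..M}" for t
  proof -
    note x = xt[OF t] and b = basic[OF t]
    have m0: "0 \<le> ?m t" by simp
    have "0 \<le> ?m t / L" using L0 by (intro divide_nonneg_pos[OF m0])
    then have "0 \<le> 36 * (1 + C) * (?m t / L)" by (rule mult_nonneg_nonneg[OF C36])
    then have w0: "0 \<le> ?w t" using eps0 by linarith
    have w9: "?w t \<le> eps + 9 * (1 + C)"
    proof -
      have "?m t / L \<le> 1 / 4" using b(2) by (simp only: pos_divide_le_eq[OF L0])
      then have "36 * (1 + C) * (?m t / L) \<le> 36 * (1 + C) * (1 / 4)" using C by (intro mult_left_mono) auto
      then show ?thesis by simp
    qed
    \<comment> \<open>Trading the factor m for half of the exponent brings the loss into the form of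
      \<open>gumbel_sum_le\<close> with parameter L / (2 y).\<close>
    have m_exp: "?m t * exp (- ?m t) \<le> exp (- (L / (2 * y) * e t))"
    proof -
      have "(1 + ?m t / 4)\<^sup>2 \<le> (exp (?m t / 4))\<^sup>2" using exp_ge_add_one_self[of "?m t / 4"] by (intro power_mono) auto
      moreover have "?m t \<le> (1 + ?m t / 4)\<^sup>2" 
      proof -
        have "0 \<le> (1 - ?m t / 4)\<^sup>2" by simp
        then show ?thesis by (simp add: power2_eq_square algebra_simps)
      qed
      moreover have "(exp (?m t / 4))\<^sup>2 = exp (?m t / 2)" by (simp add: exp_double[symmetric])
      ultimately have "?m t \<le> exp (?m t / 2)" by linarith
      then have "?m t * exp (- ?m t) \<le> exp (?m t / 2) * exp (- ?m t)" by (intro mult_right_mono) auto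
      also have "\<dots> = exp (- (?m t / 2))" by (simp add: exp_add[symmetric])
      also have "\<dots> \<le> exp (- (L / (2 * y) * e t))"
      proof -
        have "L \<le> real t * y" using x by (subst mult.commute) linarith
        then have "L / y \<le> real t" by (simp only: pos_divide_le_eq[OF y(1)])
        then have "L / y * e t \<le> ?m t" by (intro mult_right_mono) auto
        then show ?thesis by simp
      qed
      finally show ?thesis .
    qed
    have "real t \<le> X / y" using x y by (simp add: pos_le_divide_eq mult.commute)
    then have "?m t \<le> X / y * e t" by (intro mult_right_mono) auto
    then have a2: "exp (- (X / y * e t)) \<le> exp (- ?m t)" by simp
    have cw: "c t * ?w t \<le> del * (eps + 9 * (1 + C)) + eps + 36 * (1 + C) / L * (?m t * exp (- ?m t))"
    proof -
      have "c t * ?w t \<le> (exp (- ?m t) + del) * ?w t" using c_up[OF t] w0 by (intro mult_right_mono)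
      also have "\<dots> = exp (- ?m t) * eps + 36 * (1 + C) / L * (?m t * exp (- ?m t)) + del * ?w t"
      proof -
        have "(E + d) * (s + c * (m / l)) = E * s + c / l * (m * E) + d * (s + c * (m / l))" for E d s c m l :: real
          by (simp add: algebra_simps add_divide_distrib)
        then show ?thesis .
      qed
      also have "\<dots> \<le> 1 * eps + 36 * (1 + C) / L * (?m t * exp (- ?m t)) + del * (eps + 9 * (1 + C))"
        by (rule add_mono[OF add_mono[OF mult_right_mono[OF _ eps0] order_refl] mult_left_mono[OF w9 del0]]) simp
      finally show ?thesis by simp
    qed
    have "36 * (1 + C) / L * (?m t * exp (- ?m t)) \<le> 36 * (1 + C) / L * exp (- (L / (2 * y) * e t))"
      by (rule mult_left_mono[OF m_exp cL0])
    then have "exp (- (X / y * e t)) - (del1 + del * (eps + 9 * (1 + C)) + eps) - 36 * (1 + C) / L * exp (- (L / (2 * y) * e t))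
        \<le> c t - c t * ?w t"
      using cw a2 c_lo[OF t] by linarith
    then have "e t * (exp (- (X / y * e t)) - (del1 + del * (eps + 9 * (1 + C)) + eps) - 36 * (1 + C) / L * exp (- (L / (2 * y) * e t)))
        \<le> e t * (c t - c t * ?w t)" by (intro mult_left_mono) auto
    also have "\<dots> = c t * (e t * (1 - ?w t))" by (simp add: algebra_simps)
    also have "\<dots> \<le> c t * f t" by (rule mult_left_mono[OF f_lo[OF t] c0])
    finally show ?thesis by (simp add: algebra_simps)
  qed
  let ?D = "del1 + del * (eps + 9 * (1 + C)) + eps"
  have D0: "0 \<le> ?D"
  proof -
    have "0 \<le> 9 / 4 * K * L * y" by (intro mult_nonneg_nonneg) (use K1 L0 y in linarith)+
    then have "0 \<le> del1" using \<open>0 \<le> eps * (L / 4) / g\<close> by linarith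
    moreover have "0 \<le> eps + 9 * (1 + C)" using C by (intro add_nonneg_nonneg[OF eps0]) simp
    then have "0 \<le> del * (eps + 9 * (1 + C))" by (rule mult_nonneg_nonneg[OF del0])
    ultimately show ?thesis using eps0 by linarith
  qed
  have S1: "(1 - 11 / 2 / L) / (X * (1 + y)) \<le> (\<Sum>t=T1..M. e t * exp (- (X / y * e t)))"
  proof -
    have a0: "0 < X / y" using X0 y by simp
    \<comment> \<open>Since exp (- y M) is at most 3 y / L^2 and X \<le> 3/2 L, the exponent is at
      most 9 / (2 L); together with 1 / L from \<open>E2\<close> this makes 11 / (2 L).\<close>
    have E1: "1 - 9 / 2 / L \<le> exp (- (X / y * e M))"
    proof -
      have "e M \<le> exp (- L + (- (2 * ln L)) + y)" using yM(2) by simp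
      also have "\<dots> = y * exp (- (2 * ln L)) * exp y" unfolding exp_add exp_L(1) ..
      also have "exp (- (2 * ln L)) = 1 / L\<^sup>2"
        using L0 exp_double[of "ln L"] by (simp add: exp_minus inverse_eq_divide)
      also have "exp y \<le> 3"
      proof -
        have "exp y \<le> exp 1" using y by simp
        then show ?thesis using exp_le by linarith
      qed
      finally have "e M \<le> y * (1 / L\<^sup>2) * 3" using y by (simp add: mult_left_mono divide_right_mono)
      then have "X / y * e M \<le> X / y * (y * (1 / L\<^sup>2) * 3)" using a0 by (intro mult_left_mono) auto
      also have "\<dots> = 3 * X / L\<^sup>2" using y by simp
      also have "\<dots> \<le> 3 * (3 / 2 * L) / L\<^sup>2" using X2 by (intro divide_right_mono mult_left_mono) auto
      also have "\<dots> = 9 / 2 / L" using L0 by (simp add: power2_eq_square)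
      finally have "X / y * e M \<le> 9 / 2 / L" .
      moreover have "1 + - (X / y * e M) \<le> exp (- (X / y * e M))" by (rule exp_ge_add_one_self)
      ultimately show ?thesis by linarith
    qed
    have E2: "exp (- (X / y * e T1)) \<le> 1 / L"
    proof -
      have "y / 27 \<le> e T1"
      proof -
        have "exp 3 = (exp 1 :: real) ^ 3" by (simp add: exp_of_nat_mult[symmetric])
        also have "\<dots> \<le> 3 ^ 3" using exp_le by (intro power_mono) auto
        finally have "exp 3 \<le> (27 :: real)" by simp
        then have "1 / 27 \<le> exp (- 3 :: real)" by (simp add: exp_minus field_simps)
        then have "y * (1 / 27) \<le> y * exp (- 3)" using y by (intro mult_left_mono) auto
        also have "\<dots> = exp (- L + - 3)" unfolding exp_add exp_L(1) ..
        also have "\<dots> \<le> e T1" using yT(2) by simp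
        finally show ?thesis by simp
      qed
      moreover have "L / y \<le> X / y" using X1 y by (intro divide_right_mono) linarith+
      ultimately have "L / y * (y / 27) \<le> X / y * e T1" by (intro mult_mono) (use a0 y in linarith)+
      then have "L / 27 \<le> X / y * e T1" using y by simp
      then have "exp (- (X / y * e T1)) \<le> exp (- (L / 27))" by simp
      then show ?thesis using small by linarith
    qed
    have "9 / 2 / l + 1 / l = 11 / 2 / l" for l :: real by (simp only: add_divide_distrib[symmetric]) simp
    from this[of L] have "1 - 11 / 2 / L = 1 - 9 / 2 / L - 1 / L" by linarith
    moreover have "X / y * (y * (1 + y)) = X * (1 + y)" using y by simp
    ultimately have "(1 - 11 / 2 / L) / (X * (1 + y)) = (1 - 9 / 2 / L - 1 / L) / (X / y * (y * (1 + y)))"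
      by (simp only:)
    also have "\<dots> \<le> (exp (- (X / y * e M)) - exp (- (X / y * e T1))) / (X / y * (y * (1 + y)))"
      using E1 E2 X0 y by (intro divide_right_mono) auto
    also have "\<dots> \<le> (\<Sum>t=T1..M. e t * exp (- (X / y * e t)))"
      using y by (intro gumbel_sum_ge a0 TM) auto
    finally show ?thesis .
  qed
  have S2: "(\<Sum>t=T1..M. e t) \<le> 1"
  proof -
    have "(\<Sum>t=T1..M. e t) \<le> e T1 * (2 / y)" using y by (intro geometric_exp_tail) auto
    also have "\<dots> \<le> (y / 6) * (2 / y)"
    proof (rule mult_right_mono)
      have "e T1 \<le> exp (- L + - 2)" using yT by simp
      also have "\<dots> = y * exp (- 2)" unfolding exp_add exp_L(1) ..
      finally have 1: "e T1 \<le> y * exp (- 2)" .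
      have "(5 / 2 :: real) \<le> exp 1" using exp_lower_Taylor_quadratic[of 1] by simp
      then have "(5 / 2 :: real) * (5 / 2) \<le> exp 1 * exp 1" by (intro mult_mono) auto
      then have "6 \<le> exp (2 :: real)" by (simp add: exp_add[symmetric])
      then have "exp (- 2 :: real) \<le> 1 / 6" by (simp add: exp_minus field_simps)
      then have "y * exp (- 2) \<le> y * (1 / 6)" using y by (intro mult_left_mono) auto
      then show "e T1 \<le> y / 6" using 1 by linarith
    qed (use y in simp)
    also have "\<dots> \<le> 1" using y by simp
    finally show ?thesis .
  qed
  have S3: "(\<Sum>t=T1..M. e t * exp (- (L / (2 * y) * e t))) \<le> 2 * (1 + y) / L"
  proof -
    have "0 < L / (2 * y)" by (intro divide_pos_pos) (use y L0 in linarith)+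
    have "(\<Sum>t=T1..M. e t * exp (- (L / (2 * y) * e t))) \<le> (1 + y) / (L / (2 * y) * y)"
      by (intro gumbel_sum_le) (fact | use y in linarith)+
    also have "\<dots> = 2 * (1 + y) / L" using y by simp
    finally show ?thesis .
  qed
  have "(1 - 11 / 2 / L) / (X * (1 + y)) - (?D + 36 * (1 + C) * (2 * (1 + y) / L) / L)
    \<le> (\<Sum>t=T1..M. e t * exp (- (X / y * e t))) - (\<Sum>t=T1..M. e t) * ?D - 36 * (1 + C) / L * (\<Sum>t=T1..M. e t * exp (- (L / (2 * y) * e t)))"
  proof -
    have "(\<Sum>t=T1..M. e t) * ?D \<le> 1 * ?D" using S2 D0 by (rule mult_right_mono)
    moreover have "36 * (1 + C) / L * (\<Sum>t=T1..M. e t * exp (- (L / (2 * y) * e t))) \<le> 36 * (1 + C) * (2 * (1 + y) / L) / L"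
      using mult_left_mono[OF S3 cL0] by (simp only: times_divide_eq_left)
    moreover have "a - (D + F) \<le> s1 - s * D - u" if "a \<le> s1" "s * D \<le> 1 * D" "u \<le> F" for a D F s1 s u :: real
      using that by linarith
    ultimately show ?thesis using S1 by blast
  qed
  also have "\<dots> = (\<Sum>t=T1..M. e t * exp (- (X / y * e t)) - e t * ?D - 36 * (1 + C) / L * (e t * exp (- (L / (2 * y) * e t))))"
    by (simp only: sum_subtractf sum_distrib_left sum_distrib_right)
  also have "\<dots> \<le> (\<Sum>t=T1..M. c t * f t)" by (intro sum_mono tm)
  finally have "p\<^sup>2 * ((1 - 11 / 2 / L) / (X * (1 + y)) - (?D + 36 * (1 + C) * (2 * (1 + y) / L) / L)) \<le> p\<^sup>2 * (\<Sum>t=T1..M. c t * f t)"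
    by (intro mult_left_mono) auto
  also have "\<dots> = (\<Sum>t=T1..M. real (cores t N) * real (card {mu \<in> partitions N. mu ! 0 = t}))"
    unfolding sum_distrib_left using p_pos by (intro sum.cong refl) (simp add: c_def f_def power2_eq_square)
  also have "\<dots> \<le> real (count_zeros zero_I N)" by (rule count_I_ge)
  finally show ?thesis by (simp only: add.assoc)
qed

end

section \<open>Asymptotics\<close>

text \<open>Here \<open>L = - ln y\<close>, so that \<open>y\<close>, \<open>h = sqrt y\<close> and \<open>g = sqrt h\<close> become \<open>exp (- L)\<close>, \<open>exp (- (L / 2))\<close>
  and \<open>exp (- (L / 4))\<close>.\<close>
definition large :: "real \<Rightarrow> real \<Rightarrow> bool" where
  "large C L \<longleftrightarrow> 2 \<le> ln L \<and> 2 * ln L \<le> L / 2 \<and> 2 * (exp (- (L / 2)) * L) \<le> 1 \<and> ln 72 < L \<and>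
    exp (- L) \<le> 1 / 1000 \<and> L + 2 * ln L \<le> 1 / (3 * exp (- L)) \<and> exp (- (L / 27)) \<le> 1 / L \<and>
    exp (- (1 / (40000 * exp (- L)))) + exp (16 - 1 / (12 * exp (- (L / 2)))) \<le> exp (- L) ^ 6"

lemma eventually_large: "eventually (large C) at_top"
  unfolding large_def by (intro eventually_conj; real_asymp)

definition upper_main :: "real \<Rightarrow> real \<Rightarrow> real \<Rightarrow> real" where
  "upper_main C A L = (1 + 2 * C * exp (- (L / 2)) * L) * ((1 + exp (- L)) / (L - ln 72)
      + 144 * (3 * exp (- (L / 4)) + 2 * C * exp (- (L / 2)) * L * (L / 4) / exp (- (L / 4))))
    + 16 * (1 + C) * exp (- (L / 4)) + A * exp (- L)"

text \<open>The only error that is not exponentially small in L comes from 1 / (L - ln 72), and it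
  is of order 1 / L^2.\<close>

lemma eventually_upper_main:
  assumes "0 < C" "0 < A"
  shows "eventually (\<lambda>L. upper_main C A L \<le> 1 / L + 3 * ln L / L\<^sup>2) at_top"
  unfolding upper_main_def using assms by real_asymp

definition lower_main :: "real \<Rightarrow> real \<Rightarrow> real \<Rightarrow> real" where
  "lower_main C B L = (1 - 11 / 2 / L) / ((L + 2 * ln L) * (1 + exp (- L)))
    - (2 * C * exp (- (L / 2)) * L * (L / 4) / exp (- (L / 4)) + 9 / 4 * B * L * exp (- L)
      + (3 * exp (- (L / 4)) + 2 * C * exp (- (L / 2)) * L * (L / 4) / exp (- (L / 4))) * (2 * C * exp (- (L / 2)) * L + 9 * (1 + C))
      + 2 * C * exp (- (L / 2)) * L + 36 * (1 + C) * (2 * (1 + exp (- L)) / L) / L)"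

text \<open>To leading order 1 / (L + 2 ln L) is 1 / L - 2 ln L / L^2, and everything else is of
  lower order than ln L / L^2, so the coefficient 3 suffices.\<close>

lemma eventually_lower_main:
  assumes "0 < C" "0 < B"
  shows "eventually (\<lambda>L. 1 / L - 3 * ln L / L\<^sup>2 \<le> lower_main C B L) at_top"
  unfolding lower_main_def using assms by real_asymp

context saddle_point
begin

text \<open>In the bound for type III the bad pairs enter twice, once for type II and once for the
  difference of types III and II, hence 65536 = 2 * 32768.\<close>

abbreviation A where "A \<equiv> 65536 * (1 + exp 16) + 746496 * (1 + C) * P2"

lemma count_bounds:
  assumes "large C L"
  shows "real (count_zeros zero_III N) - real (count_zeros zero_II N) \<le> A * y * p\<^sup>2"
    and "real (count_zeros zero_III N) \<le> p\<^sup>2 * upper_main C A L"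
    and "p\<^sup>2 * lower_main C K L \<le> real (count_zeros zero_I N)"
proof -
  note 1 = assms[unfolded large_def exp_L]
  have L0: "0 < L" using y by simp
  have hL: "h * L \<le> 1" using 1 h L0 mult_nonneg_nonneg[of h L] by linarith
  have L72: "ln 72 \<le> L" using 1 by linarith
  have b: "(\<Sum>t=2..<T. real (card (bad_pairs N t))) \<le> 32768 * (1 + exp 16) * y * p\<^sup>2"
    using 1 by (intro sum_bad_pairs_le L72) blast
  have m: "(\<Sum>t=T..N. p * real (card {mu \<in> partitions N. 2 \<le> mult_weight t (mset mu)})) \<le> 746496 * (1 + C) * P2 * y * p\<^sup>2"
    using 1 by (intro sum_card_mult_weight_le L72 hL) blast
  have "0 \<le> 32768 * (1 + exp 16) * y * p\<^sup>2" using y by (intro mult_nonneg_nonneg add_nonneg_nonneg) auto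
  then show d: "real (count_zeros zero_III N) - real (count_zeros zero_II N) \<le> A * y * p\<^sup>2"
    using count_III_le[of N T] b m by (simp only: distrib_right)
  have "real (count_zeros zero_II N) \<le> 32768 * (1 + exp 16) * y * p\<^sup>2 +
      p\<^sup>2 * ((1 + eps) * ((1 + y) / (L - ln 72) + 144 * del) + 16 * (1 + C) * g)"
    using count_II_le[of N T] N b sum_cores_upper 1 by (simp add: T_def)
  then have "real (count_zeros zero_III N) \<le> 32768 * (1 + exp 16) * y * p\<^sup>2 + 32768 * (1 + exp 16) * y * p\<^sup>2 
      + 746496 * (1 + C) * P2 * y * p\<^sup>2 + p\<^sup>2 * ((1 + eps) * ((1 + y) / (L - ln 72) + 144 * del) + 16 * (1 + C) * g)"
    using count_III_le[of N T] b m by linarith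
  also have "\<dots> = p\<^sup>2 * upper_main C A L"
  proof -
    have "a * y * q + a * y * q + b * y * q + q * (s + r) = q * (s + r + (a' + b) * y)" if "a' = 2 * a" for a a' b q s r :: real
      unfolding that by (simp add: algebra_simps)
    note * = this
    show ?thesis unfolding upper_main_def exp_L by (rule *) simp
  qed
  finally show "real (count_zeros zero_III N) \<le> p\<^sup>2 * upper_main C A L" .
  show "p\<^sup>2 * lower_main C K L \<le> real (count_zeros zero_I N)"
    using sum_first_part_lower 1 unfolding lower_main_def exp_L by (simp only: add.assoc)
qed

lemma log_N: "2 * L \<le> ln (real N) + ln 3" "ln (real N) - ln 4 \<le> 2 * L"
proof -
  have l: "ln (y\<^sup>2) = - (2 * L)" using y by (simp add: ln_realpow)
  have "ln (1 / (3 * real N)) \<le> ln (y\<^sup>2)" using y2 y N by (subst ln_le_cancel_iff) auto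
  then show "2 * L \<le> ln (real N) + ln 3" using l N by (simp add: ln_div ln_mult)
  have "ln (y\<^sup>2) \<le> ln (4 / real N)" using y2 y N by (subst ln_le_cancel_iff) auto
  then show "ln (real N) - ln 4 \<le> 2 * L" using l N by (simp add: ln_div)
qed

lemma y_le_powr: "y \<le> 2 * real N powr (- 1 / 2)"
proof -
  have "real N powr (- 1 / 2) = 1 / sqrt (real N)"
    using N powr_minus[of "real N" "1 / 2"] by (simp add: powr_half_sqrt inverse_eq_divide)
  moreover have "y \<le> sqrt (4 / real N)" using y2(2) by (rule real_le_rsqrt)
  ultimately show ?thesis by (simp add: real_sqrt_divide)
qed

text \<open>The estimate obtained is linear in ln (ln N); as ln (ln N) is at least 4, it is bounded
  by the square, with 56 = 8 + 48. The 8 comes from |ln N - 2 L| \<le> 2 and L \<ge> ln N /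
  4.\<close>

lemma main_term:
  assumes N4: "4 \<le> ln (ln (real N))"
  shows "\<bar>1 / L - 2 / ln (real N)\<bar> + 3 * ln L / L\<^sup>2 \<le> 56 * (ln (ln (real N)))\<^sup>2 / (ln (real N))\<^sup>2"
proof -
  let ?l = "ln (real N)"
  have l0: "0 < ?l" using N by simp
  then have l: "5 \<le> ?l" using ln_le_minus_one[OF l0] N4 by linarith
  have 3: "ln 3 \<le> (2 :: real)" using ln_le_minus_one[of 3] by simp
  have 4: "ln 4 \<le> (2 :: real)"
    using ln_le_minus_one[of "2 :: real"] ln_realpow[of 2 2] by simp
  have L: "?l / 4 \<le> L" "L \<le> ?l" and d: "\<bar>?l - 2 * L\<bar> \<le> 2" using log_N l 3 4 by linarith+
  have L0: "0 < L" using L l0 by linarith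
  have "\<bar>1 / L - 2 / ?l\<bar> = \<bar>?l - 2 * L\<bar> / (L * ?l)"
    using L0 l0 by (subst diff_frac_eq) (auto simp: abs_mult)
  also have "\<dots> \<le> 2 / (?l / 4 * ?l)" using d L l0 by (intro frac_le mult_mono) auto
  also have "\<dots> = 8 / ?l\<^sup>2" by (simp add: power2_eq_square)
  finally have a: "\<bar>1 / L - 2 / ?l\<bar> \<le> 8 / ?l\<^sup>2" .
  have "3 * ln L / L\<^sup>2 \<le> 3 * ln ?l / (?l / 4)\<^sup>2"
  proof (rule frac_le)
    show "3 * ln L \<le> 3 * ln ?l" using L(2) ln_le_cancel_iff[OF L0 l0] by linarith
    show "(?l / 4)\<^sup>2 \<le> L\<^sup>2" using L(1) l0 by (intro power_mono) linarith+
  qed (use l l0 N4 in auto)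
  also have "\<dots> = 48 * ln ?l / ?l\<^sup>2" by (simp add: power_divide)
  finally have "\<bar>1 / L - 2 / ?l\<bar> + 3 * ln L / L\<^sup>2 \<le> (8 + 48 * ln ?l) / ?l\<^sup>2" using a by (simp add: add_divide_distrib)
  also have "\<dots> \<le> 56 * (ln ?l)\<^sup>2 / ?l\<^sup>2"
  proof (rule divide_right_mono)
    have "ln ?l * 4 \<le> ln ?l * ln ?l" using N4 by (intro mult_left_mono) auto
    then show "8 + 48 * ln ?l \<le> 56 * (ln ?l)\<^sup>2" using N4 unfolding power2_eq_square by linarith
  qed simp
  finally show ?thesis .
qed

lemma counts:
  assumes large: "large C L" and up: "upper_main C A L \<le> 1 / L + 3 * ln L / L\<^sup>2"
    and lo: "1 / L - 3 * ln L / L\<^sup>2 \<le> lower_main C K L"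
    and N4: "4 \<le> ln (ln (real N))"
  shows "Z \<in> {zero_I, zero_II, zero_III} \<Longrightarrow> 
      \<bar>real (count_zeros Z N) - p\<^sup>2 * (2 / ln (real N))\<bar> \<le> 56 * (p\<^sup>2 * (ln (ln (real N)))\<^sup>2 / (ln (real N))\<^sup>2)"
    and "\<bar>real (count_zeros zero_III N) - real (count_zeros zero_II N)\<bar> \<le> (2 * A) * (real N powr (- 1 / 2) * p\<^sup>2)"
proof -
  have N0: "0 < N" using N by simp
  have I_II: "real (count_zeros zero_I N) \<le> real (count_zeros zero_II N)"
    and II_III: "real (count_zeros zero_II N) \<le> real (count_zeros zero_III N)"
    unfolding count_zeros_eq of_nat_le_iff using zeros_I_subset_II[OF N0] zeros_II_subset_III by (auto intro!: card_mono)
  note cb = count_bounds[OF large]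
  have P20: "0 \<le> P2" using pgf_pos[of "ln 2"] by (simp add: exp_minus)
  have A0: "0 \<le> A" using P20 C by (intro add_nonneg_nonneg mult_nonneg_nonneg) auto
  have "A * y * p\<^sup>2 \<le> A * (2 * real N powr (- 1 / 2)) * p\<^sup>2"
    using y_le_powr A0 by (intro mult_right_mono mult_left_mono) auto
  then show "\<bar>real (count_zeros zero_III N) - real (count_zeros zero_II N)\<bar> \<le> (2 * A) * (real N powr (- 1 / 2) * p\<^sup>2)"
  proof -
    have "A * (2 * real N powr (- 1 / 2)) * p\<^sup>2 = (2 * A) * (real N powr (- 1 / 2) * p\<^sup>2)" by (simp only: mult_ac)
    then show ?thesis using cb(1) II_III \<open>A * y * p\<^sup>2 \<le> _\<close> by linarith
  qed
  assume Z: "Z \<in> {zero_I, zero_II, zero_III}"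
  let ?c = "real (count_zeros Z N)"
  have "real (count_zeros zero_I N) \<le> ?c" "?c \<le> real (count_zeros zero_III N)" using Z I_II II_III by auto
  moreover have "p\<^sup>2 * upper_main C A L \<le> p\<^sup>2 * (1 / L + 3 * ln L / L\<^sup>2)" using up by (intro mult_left_mono) auto
  moreover have "p\<^sup>2 * (1 / L - 3 * ln L / L\<^sup>2) \<le> p\<^sup>2 * lower_main C K L" using lo by (intro mult_left_mono) auto
  ultimately have "p\<^sup>2 * (1 / L - 3 * ln L / L\<^sup>2) \<le> ?c" "?c \<le> p\<^sup>2 * (1 / L + 3 * ln L / L\<^sup>2)"
    using cb(2,3) by linarith+
  moreover have "\<bar>c / q - l\<bar> \<le> d" if "q * (l - d) \<le> c" "c \<le> q * (l + d)" "0 < q" for c q l d :: real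
  proof -
    have "l - d \<le> c / q" "c / q \<le> l + d" using that by (simp_all add: pos_le_divide_eq pos_divide_le_eq mult.commute)
    then show ?thesis by linarith
  qed
  moreover have "0 < p\<^sup>2" using p_pos by simp
  ultimately have "\<bar>?c / p\<^sup>2 - 1 / L\<bar> \<le> 3 * ln L / L\<^sup>2" by blast
  then have "\<bar>?c / p\<^sup>2 - 2 / ln (real N)\<bar> \<le> 56 * (ln (ln (real N)))\<^sup>2 / (ln (real N))\<^sup>2"
    using main_term[OF N4] by linarith
  then have "p\<^sup>2 * \<bar>?c / p\<^sup>2 - 2 / ln (real N)\<bar> \<le> p\<^sup>2 * (56 * (ln (ln (real N)))\<^sup>2 / (ln (real N))\<^sup>2)"
    by (intro mult_left_mono) auto
  moreover have "p\<^sup>2 * \<bar>?c / p\<^sup>2 - 2 / ln (real N)\<bar> = \<bar>p\<^sup>2 * (?c / p\<^sup>2 - 2 / ln (real N))\<bar>" by (simp add: abs_mult)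
  moreover have "p\<^sup>2 * (?c / p\<^sup>2 - 2 / ln (real N)) = ?c - p\<^sup>2 * (2 / ln (real N))" using p_pos by (simp add: right_diff_distrib)
  ultimately show "\<bar>?c - p\<^sup>2 * (2 / ln (real N))\<bar> \<le> 56 * (p\<^sup>2 * (ln (ln (real N)))\<^sup>2 / (ln (real N))\<^sup>2)"
    by (simp add: mult_ac)
qed

end

lemma eventually_counts:
  "\<exists>K. \<forall>\<^sub>F N in sequentially.
     (\<forall>Z\<in>{zero_I, zero_II, zero_III}. \<bar>real (count_zeros Z N) - (real (num_partitions N))\<^sup>2 * (2 / ln (real N))\<bar>
       \<le> 56 * ((real (num_partitions N))\<^sup>2 * (ln (ln (real N)))\<^sup>2 / (ln (real N))\<^sup>2)) \<and>
     \<bar>real (count_zeros zero_III N) - real (count_zeros zero_II N)\<bar> \<le> K * (real N powr (- 1 / 2) * (real (num_partitions N))\<^sup>2)"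
proof -
  obtain N0 C where C: "0 < C" and loc: "\<And>N. N0 \<le> N \<Longrightarrow> \<exists>y. 0 < y \<and> y \<le> 1 \<and> 1 / (3 * real N) \<le> y\<^sup>2 \<and> y\<^sup>2 \<le> 4 / real N \<and>
     y powr (3/2) / 128 * pgf (exp (- y)) \<le> real (num_partitions N) * exp (- (y * real N)) \<and>
     (\<forall>j. \<bar>real (pd N j) - exp (- (y * real j)) * real (num_partitions N)\<bar>
        \<le> C * real j * y powr (3/2) * exp (- (y * real j)) * real (num_partitions N))"
    using partitions_local by blast
  let ?P2 = "pgf (1 / 2) :: real"
  let ?A = "65536 * (1 + exp 16) + 746496 * (1 + C) * ?P2"
  let ?K = "1 + 4 * (1 + C) * ?P2"
  have P20: "0 < ?P2" using pgf_pos[of "ln 2"] by (simp add: exp_minus)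
  have A0: "0 < ?A" using P20 C by (intro add_pos_pos mult_pos_pos) auto
  have K0: "0 < ?K" using P20 C by (intro add_pos_pos mult_pos_pos) auto
  have "\<forall>\<^sub>F L in at_top. large C L \<and> upper_main C ?A L \<le> 1 / L + 3 * ln L / L\<^sup>2 \<and> 1 / L - 3 * ln L / L\<^sup>2 \<le> lower_main C ?K L"
    by (intro eventually_conj eventually_large eventually_upper_main eventually_lower_main C A0 K0)
  then obtain L0 where L0: "\<And>L. L0 \<le> L \<Longrightarrow> large C L" "\<And>L. L0 \<le> L \<Longrightarrow> upper_main C ?A L \<le> 1 / L + 3 * ln L / L\<^sup>2"
    "\<And>L. L0 \<le> L \<Longrightarrow> 1 / L - 3 * ln L / L\<^sup>2 \<le> lower_main C ?K L"
    unfolding eventually_at_top_linorder by blast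
  have 1: "\<forall>\<^sub>F N in sequentially. 4 / real N \<le> (1 / 16)\<^sup>2" by real_asymp
  have 2: "\<forall>\<^sub>F N in sequentially. 4 \<le> ln (ln (real N))" by real_asymp
  have 3: "\<forall>\<^sub>F N in sequentially. 2 * L0 + ln 4 \<le> ln (real N)" by real_asymp
  show ?thesis
  proof (rule exI[of _ "2 * ?A"])
    show "\<forall>\<^sub>F N in sequentially.
     (\<forall>Z\<in>{zero_I, zero_II, zero_III}. \<bar>real (count_zeros Z N) - (real (num_partitions N))\<^sup>2 * (2 / ln (real N))\<bar>
       \<le> 56 * ((real (num_partitions N))\<^sup>2 * (ln (ln (real N)))\<^sup>2 / (ln (real N))\<^sup>2)) \<and>
     \<bar>real (count_zeros zero_III N) - real (count_zeros zero_II N)\<bar> \<le> 2 * ?A * (real N powr (- 1 / 2) * (real (num_partitions N))\<^sup>2)"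
      using 1 2 3 eventually_ge_at_top[of N0] eventually_ge_at_top[of 3]
    proof eventually_elim
      case (elim N)
      from loc[OF elim(4)] obtain y where y: "0 < y" "1 / (3 * real N) \<le> y\<^sup>2" "y\<^sup>2 \<le> 4 / real N"
        and p: "y powr (3/2) / 128 * pgf (exp (- y)) \<le> real (num_partitions N) * exp (- (y * real N))"
        and r: "\<And>j. \<bar>real (pd N j) - exp (- (y * real j)) * real (num_partitions N)\<bar>
        \<le> C * real j * y powr (3/2) * exp (- (y * real j)) * real (num_partitions N)" by blast
      have "y\<^sup>2 \<le> (1 / 16)\<^sup>2" using y(3) elim(1) by linarith
      then have y16: "y \<le> 1 / 16" by (rule power2_le_imp_le) simp
      interpret saddle_point C y N by unfold_locales (fact C y y16 p r elim)+
      have L: "L0 \<le> - ln y" using log_N(2) elim(3) by linarith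
      show ?case using counts[OF L0[OF L] elim(2)] by blast
    qed
  qed
qed

text \<open>The finitely many n from m up to the threshold enter the constant through the sum of
  their ratios, which is where positivity of b from m on is used.\<close>

lemma eventually_bound_imp_bound:
  fixes f b :: "nat \<Rightarrow> real"
  assumes ev: "\<forall>\<^sub>F n in sequentially. \<bar>f n\<bar> \<le> K * b n" and pos: "\<And>n. m \<le> n \<Longrightarrow> 0 < b n"
  shows "\<exists>C. \<forall>n\<ge>m. \<bar>f n\<bar> \<le> C * b n"
proof -
  obtain n0 where n0: "\<And>n. n0 \<le> n \<Longrightarrow> \<bar>f n\<bar> \<le> K * b n" using ev unfolding eventually_sequentially by blast
  let ?S = "\<Sum>n=m..<n0. \<bar>f n\<bar> / b n"
  have S0: "0 \<le> ?S" using pos by (intro sum_nonneg divide_nonneg_nonneg) (auto intro: less_imp_le)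
  have "\<bar>f n\<bar> \<le> (\<bar>K\<bar> + ?S) * b n" if n: "m \<le> n" for n
  proof -
    have "\<bar>f n\<bar> / b n \<le> \<bar>K\<bar> + ?S"
    proof (cases "n0 \<le> n")
      case True
      then have "\<bar>f n\<bar> / b n \<le> K" using n0 pos[OF n] by (simp add: pos_divide_le_eq)
      then show ?thesis using S0 by linarith
    next
      case False
      then have "\<bar>f n\<bar> / b n \<le> ?S"
        using n pos by (intro member_le_sum divide_nonneg_nonneg) (auto intro: less_imp_le)
      then show ?thesis by linarith
    qed
    then show ?thesis using pos[OF n] by (simp add: pos_divide_le_eq)
  qed
  then show ?thesis by blast
qed

theorem theorem1:
  shows "(\<forall>Z \<in> {zero_I, zero_II, zero_III}. \<exists>C::real. \<forall>N::nat. N \<ge> 3 \<longrightarrow>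
           \<bar>real (count_zeros Z N) - (real (num_partitions N))^2 * (2 / ln (real N))\<bar>
             \<le> C * (real (num_partitions N))^2 * (ln (ln (real N)))^2 / (ln (real N))^2) \<and>
         (\<exists>C::real. \<forall>N::nat. N \<ge> 3 \<longrightarrow>
           \<bar>real (count_zeros zero_III N) - real (count_zeros zero_II N)\<bar>
             \<le> C * (real N) powr (-1/2) * (real (num_partitions N))^2)"
proof -
  let ?p = "\<lambda>N. (real (num_partitions N))\<^sup>2"
  obtain K where K: "\<forall>\<^sub>F N in sequentially.
     (\<forall>Z\<in>{zero_I, zero_II, zero_III}. \<bar>real (count_zeros Z N) - ?p N * (2 / ln (real N))\<bar>
       \<le> 56 * (?p N * (ln (ln (real N)))\<^sup>2 / (ln (real N))\<^sup>2)) \<and>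
     \<bar>real (count_zeros zero_III N) - real (count_zeros zero_II N)\<bar> \<le> K * (real N powr (- 1 / 2) * ?p N)"
    using eventually_counts by blast
  have p: "0 < ?p N" for N using num_partitions_pos by (intro zero_less_power) simp
  \<comment> \<open>As exp 1 < 3, the iterated logarithm is positive from N = 3 on, so the error
    term does not vanish.\<close>
  have l: "1 < ln (real N)" if "3 \<le> N" for N
  proof -
    have "exp 1 < real N" using e_less_272 that by linarith
    then have "ln (exp 1) < ln (real N)" using that by (subst ln_less_cancel_iff) auto
    then show ?thesis by simp
  qed
  have "\<exists>C. \<forall>N\<ge>3. \<bar>real (count_zeros Z N) - ?p N * (2 / ln (real N))\<bar> \<le> C * (?p N * (ln (ln (real N)))\<^sup>2 / (ln (real N))\<^sup>2)"
    if "Z \<in> {zero_I, zero_II, zero_III}" for Z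
  proof (rule eventually_bound_imp_bound)
    show "\<forall>\<^sub>F N in sequentially. \<bar>real (count_zeros Z N) - ?p N * (2 / ln (real N))\<bar> \<le> 56 * (?p N * (ln (ln (real N)))\<^sup>2 / (ln (real N))\<^sup>2)"
      using K by (rule eventually_mono) (use that in blast)
    fix N :: nat assume "3 \<le> N"
    then have "0 < ln (real N)" "0 < ln (ln (real N))" using l[of N] by auto
    then show "0 < ?p N * (ln (ln (real N)))\<^sup>2 / (ln (real N))\<^sup>2" by (intro divide_pos_pos mult_pos_pos[OF p] zero_less_power)
  qed
  moreover have "\<exists>C. \<forall>N\<ge>3. \<bar>real (count_zeros zero_III N) - real (count_zeros zero_II N)\<bar> \<le> C * (real N powr (- 1 / 2) * ?p N)"
  proof (rule eventually_bound_imp_bound)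
    show "\<forall>\<^sub>F N in sequentially. \<bar>real (count_zeros zero_III N) - real (count_zeros zero_II N)\<bar> \<le> K * (real N powr (- 1 / 2) * ?p N)"
      using K by (rule eventually_mono) blast
    show "0 < real N powr (- 1 / 2) * ?p N" if "3 \<le> N" for N using that p by (intro mult_pos_pos) auto
  qed
  ultimately show ?thesis by (simp add: mult.assoc)
qed

end
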